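(* Let $\mathcal{K}$ be a FUR-class with monster model $\mathbb{M}$. Let $a\in\mathbb{M}$, $A\subset\mathbb{M}$, and let $\alpha=\mathrm{Cb}(a/A)$. Then $a\downarrow_\alpha A$.
   Context: SETTING. $(\mathcal{K},\preccurlyeq)$ is an abstract elementary class (AEC) with monster model $\mathbb{M}$: a $\delta$-model homogeneous and $\delta$-universal member of $\mathcal{K}$, $\delta$ a large cardinal. "Bounded" means of size $<\delta$. "Model" means $\mathcal{A}\in\mathcal{K}$, $\mathcal{A}\preccurlyeq\mathbb{M}$; models and parameter sets are bounded unless $\mathbb{M}$ itself is mentioned. $a\in X$ may be a finite tuple; juxtaposition denotes union or concatenation. TYPES. $\mathrm{Aut}(\mathbb{M}/A)$ is the group of automorphisms of $\mathbb{M}$ fixing $A$ pointwise. $a,b$ have the same Galois type over $A$, $t^g(a/A)=t^g(b/A)$, if $f(a)=b$ for some $f\in\mathrm{Aut}(\mathbb{M}/A)$; they have the same weak type, $t(a/A)=t(b/A)$, if $t^g(a/B)=t^g(b/B)$ for all finite $B\subseteq A$ (types of models are types of enumerations). For $A\subseteq B$ with $A$ finite, $t(a/B)$ splits over $A$ if there are $b,c\in B$ with $t(b/A)=t(c/A)$ but $t(ab/A)\ne t(ac/A)$. $a\downarrow^{ns}_B C$ means that $t(a/B\cup C)$ does not split over some finite $A\subseteq B$; $A\downarrow^{ns}_B C$ means $a\downarrow^{ns}_BC$ for each $a\in A$. FUR-CLASS. $\mathcal{K}$ is a FUR-class if it has AP and JEP, $LS(\mathcal{K})=\omega$, has arbitrarily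 large structures, contains no finite models, and satisfies: (AI) Every countable model $\mathcal{A}$ is s-saturated: for any $b\in\mathbb{M}$ and finite $A\subseteq\mathcal{A}$ there is $a\in\mathcal{A}$ with $t(a/A)=t(b/A)$. (AII) For all $a$ and countable $\mathcal{A}$ there is an s-primary model $\mathcal{B}=\mathcal{A}a\cup\bigcup_{i<\omega}a_i$ over $\mathcal{A}a$. [s-primary: the $a_i$ are singletons and for all $n<\omega$ there is a finite $A_n\subset\mathcal{A}$ such that for all $(a',a_0',\dots,a_n')$ with $t(a'/\mathcal{A})=t(a/\mathcal{A})$: $t(a',a_0',\dots,a_n'/A_n)=t(a,a_0,\dots,a_n/A_n)$ implies $t(a',a_0',\dots,a_n'/\mathcal{A})=t(a,a_0,\dots,a_n/\mathcal{A})$.] (AIII) Let $\mathcal{A},\mathcal{B},\mathcal{C}$ be models with $\mathcal{A}\downarrow^{ns}_{\mathcal{B}}\mathcal{C}$ and $\mathcal{B}=\mathcal{A}\cap\mathcal{C}$. Then there is a unique (not only up to isomorphism) s-prime model $\mathcal{D}$ over $\mathcal{A}\cup\mathcal{C}$; furthermore, if $\mathcal{C}\subseteq\mathcal{C}'$ and $\mathcal{A}\downarrow^{ns}_{\mathcal{B}}\mathcal{C}'$, then $\mathcal{D}\downarrow^{ns}_{\mathcal{C}}\mathcal{C}'$. [For models $\mathcal{A}_i$, $i<\alpha$, and $A=\bigcup_{i<\alpha}\mathcal{A}_i$, a map $f:A\to\mathbb{M}$ is weakly elementary w.r.t. $(\mathcal{A}_i)_{i<\alpha}$ if $t(a/\emptyset)=t(f(a)/\emptyset)$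 for all $a\in A$ and $f(\mathcal{A}_i)\preccurlyeq\mathbb{M}$ for all $i$. A model $\mathcal{D}$ is s-prime over $A$ if for every model $\mathcal{B}$ and every $f:A\to\mathcal{B}$ weakly elementary w.r.t. $(\mathcal{A}_i)_{i<\alpha}$ there is an elementary embedding $g:\mathcal{D}\to\mathcal{B}$ with $f\subseteq g$.] (AIV) For each $a\in\mathbb{M}$ there is $n<\omega$ such that for every countable model $\mathcal{A}$ and finite $A\subset\mathcal{A}$, player II has a winning strategy in $GI(a,A,\mathcal{A})$ in $n$ moves. [$GI(a,A,\mathcal{A})$: start with $a_0=a$, $A_0=A$. At move $n$, player I chooses $a_{n+1}\in\mathbb{M}$ and a finite $A_{n+1}'\subseteq\mathcal{A}$ with $t(a_{n+1}/A_n)=t(a_n/A_n)$, $A_n\subseteq A'_{n+1}$ and $t(a_{n+1}/A'_{n+1})\ne t(a_n/A'_{n+1})$; then player II chooses a finite $A_{n+1}\subseteq\mathcal{A}$ with $A'_{n+1}\subseteq A_{n+1}$. Player II wins if player I can no longer move.] (AV) If $\mathcal{A}\subseteq\mathcal{B}$ are countable models, $a\in\mathbb{M}$ and $\mathcal{B}\downarrow^{ns}_{\mathcal{A}}a$, then $a\downarrow^{ns}_{\mathcal{A}}\mathcal{B}$. (AVI) For all models $\mathcal{A},\mathcal{B},\mathcal{D}$ with $\mathcal{A}\subseteq\mathcal{B}\cap\mathcal{D}$ there is a model $\mathcal{C}$ with $t(\mathcal{C}/\mathcal{A})=t(\mathcal{B}/\mathcal{A})$ and $\mathcal{C}\downarrow^{ns}_{\mathcal{A}}\mathcal{D}$.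 INDEPENDENCE. For finite $A$, $E(A)$ is the set of $\mathrm{Aut}(\mathbb{M}/A)$-invariant equivalence relations on powers $\mathbb{M}^n$ with boundedly many classes; $Lt(a/B)=Lt(b/B)$ means $(a,b)\in E$ for all finite $A\subseteq B$ and $E\in E(A)$. For $A\subseteq B$, $A$ finite, $t(a/B)$ Lascar splits over $A$ if there are $b,c\in B$ with $Lt(b/A)=Lt(c/A)$ and $t(ab/A)\neq t(ac/A)$. $a\downarrow_B C$ means: there is a finite $A\subseteq B$ such that for all $D\supseteq B\cup C$ there is $b$ with $t(b/B\cup C)=t(a/B\cup C)$ and $t(b/D)$ not Lascar splitting over $A$. IMAGINARIES. $\mathcal{E}$ is a countable collection of $\emptyset$-invariant equivalence relations $E\subseteq\mathbb{M}^n\times\mathbb{M}^n$ (various $n$), containing equality, each given by a countable collection $G_E$ of Galois types via $(a,b)\in E$ iff $t^g(ab/\emptyset)\in G_E$. $\mathbb{M}^{eq}=\{a/E:a\in\mathbb{M},E\in\mathcal{E}\}$, with $a$ identified with $a/{=}$, the structure of $\mathbb{M}$ on $P_=$, and predicates $P_E$ for $\{a/E:a\in\mathbb{M}\}$ and functions $F_E(a)=a/E$. All notions above also apply in $\mathbb{M}^{eq}$, with models $\mathcal{A}^{eq}=\{a/E:a\in\mathcal{A},E\in\mathcal{E}\}$; $a\downarrow_\alpha A$ is understood in $\mathbb{M}^{eq}$. GLOBAL TYPES. The supermonster $\mathbb{M}'\in\mathcal{K}$ is a $|\mathbb{M}'|$-model homogeneous and universal structure with $\mathbb{M}\preccurlyeq\mathbb{M}'$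 and $|\mathbb{M}'|>|\mathbb{M}|$. Types, Lascar types and independence for elements of $\mathbb{M}'$ are computed in $\mathbb{M}'$. A global type $p$ is a maximal collection $\{p_A:A\subset\mathbb{M}\text{ finite}\}$ such that $p_A$ is a Galois type over $A$, whenever $A\subseteq B$ and $b\in\mathbb{M}$ realizes $p_B$ then $b$ realizes $p_A$, and some single $b\in\mathbb{M}'$ realizes $p_A$ for every finite $A\subset\mathbb{M}$. For $f\in\mathrm{Aut}(\mathbb{M}^{eq})$, $f(p)=p$ means: for all finite $A,B\subset\mathbb{M}$ with $f(B)=A$ and all $b$ realizing $p_B$, $f(b)$ realizes $p_A$. $\alpha\in\mathbb{M}^{eq}$ is a canonical base for $p$ if for every $f\in\mathrm{Aut}(\mathbb{M}^{eq})$: $f(p)=p$ iff $f(\alpha)=\alpha$. For $a\in\mathbb{M}$ and $A\subset\mathbb{M}$, there is $b\in\mathbb{M}'$ with $Lt(b/A)=Lt(a/A)$ and $b\downarrow_A\mathbb{M}$; a canonical base for $a$ over $A$, written $\alpha=\mathrm{Cb}(a/A)$, is a canonical base of $t(b/\mathbb{M})$. STANDING CHOICE OF $\mathcal{E}$ (ensuring canonical bases exist in $\mathbb{M}^{eq}$). For a global type $p$ realized by $b\in\mathbb{M}'$ with $t(b/\mathbb{M})$ not splitting over a finite tuple $a\in\mathbb{M}$: for $c\in\mathbb{M}$ let $q_c=t(bc/\emptyset)$ and let $q_i^c$, $i<\omega$, be types over $\emptyset$ such that for all $d\in\mathbb{M}$, $bd$ realizes $q_c$ iff $ad$ realizes some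 $q_i^c$. Let $(a_0,a_1)\in E$ iff for all $c,d\in\mathbb{M}$: $a_0d$ realizes some $q_i^c$ iff $a_1d$ realizes some $q_i^c$. These $E$ depend only on $t(ba/\emptyset)$; $\mathcal{E}$ contains all of them. *)

theory Defs
  imports "HOL-Library.NList" "HOL-Library.Countable_Set"
begin

unbundle cardinal_syntax

section \<open>Structures\<close>

text \<open>
  All structures of a class live on subsets of one (arbitrary) type \<open>'u\<close>, which plays the
  role of the set-theoretic universe.  Finite tuples are lists; \<^term>\<open>nlists n X\<close> is the
  \<open>n\<close>-th power of \<open>X\<close>, and a tuple \<open>a\<close> used as a parameter set is \<^term>\<open>set a\<close>.
\<close>

record ('f, 'r) lang =
  fsyms :: "'f set"
  rsyms :: "'r set"
  farity :: "'f \<Rightarrow> nat"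
  rarity :: "'r \<Rightarrow> nat"

record ('u, 'f, 'r) struct =
  univ :: "'u set"
  fint :: "'f \<Rightarrow> 'u list \<Rightarrow> 'u"
  rint :: "'r \<Rightarrow> 'u list set"

text \<open>
  Interpretations are normalised outside the universe (and outside the language), so that equality
  of records is equality of structures.
\<close>

definition fdom :: "('f, 'r) lang \<Rightarrow> 'u set \<Rightarrow> ('f \<times> 'u list) set" where
  "fdom L X = {(f, xs). f \<in> fsyms L \<and> xs \<in> nlists (farity L f) X}"

definition rdom :: "('f, 'r) lang \<Rightarrow> 'u set \<Rightarrow> 'r \<Rightarrow> 'u list set" where
  "rdom L X r = (if r \<in> rsyms L then nlists (rarity L r) X else {})"

definition is_struct :: "('f, 'r) lang \<Rightarrow> ('u, 'f, 'r) struct \<Rightarrow> bool" where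
  "is_struct L A \<longleftrightarrow>
     (\<forall>f xs. (f, xs) \<in> fdom L (univ A) \<longrightarrow> fint A f xs \<in> univ A) \<and>
     (\<forall>f xs. (f, xs) \<notin> fdom L (univ A) \<longrightarrow> fint A f xs = undefined) \<and>
     (\<forall>r. rint A r \<subseteq> rdom L (univ A) r)"

definition restr :: "('f, 'r) lang \<Rightarrow> ('u, 'f, 'r) struct \<Rightarrow> 'u set \<Rightarrow> ('u, 'f, 'r) struct" where
  "restr L A X =
     \<lparr>univ = X,
      fint = (\<lambda>f xs. if (f, xs) \<in> fdom L X then fint A f xs else undefined),
      rint = (\<lambda>r. rint A r \<inter> rdom L X r)\<rparr>"

definition substruct ::
  "('f, 'r) lang \<Rightarrow> ('u, 'f, 'r) struct \<Rightarrow> ('u, 'f, 'r) struct \<Rightarrow> bool" where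
  "substruct L A B \<longleftrightarrow>
     is_struct L A \<and> is_struct L B \<and> univ A \<subseteq> univ B \<and> A = restr L B (univ A)"

definition iso ::
  "('f, 'r) lang \<Rightarrow> ('u \<Rightarrow> 'u) \<Rightarrow> ('u, 'f, 'r) struct \<Rightarrow> ('u, 'f, 'r) struct \<Rightarrow> bool" where
  "iso L h A B \<longleftrightarrow>
     bij_betw h (univ A) (univ B) \<and>
     (\<forall>f xs. (f, xs) \<in> fdom L (univ A) \<longrightarrow> h (fint A f xs) = fint B f (map h xs)) \<and>
     (\<forall>r. \<forall>xs \<in> rdom L (univ A) r. xs \<in> rint A r \<longleftrightarrow> map h xs \<in> rint B r)"

text \<open>Only the values of an automorphism on the universe matter.\<close>

definition autos :: "('f, 'r) lang \<Rightarrow> ('u, 'f, 'r) struct \<Rightarrow> ('u \<Rightarrow> 'u) set" where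
  "autos L A = {h. iso L h A A}"

definition chain_union ::
  "('f, 'r) lang \<Rightarrow> ('u, 'f, 'r) struct set \<Rightarrow> ('u, 'f, 'r) struct" where
  "chain_union L C =
     \<lparr>univ = (\<Union>A\<in>C. univ A),
      fint = (\<lambda>f xs. if \<exists>A\<in>C. (f, xs) \<in> fdom L (univ A)
                    then THE y. \<exists>A\<in>C. (f, xs) \<in> fdom L (univ A) \<and> y = fint A f xs
                    else undefined),
      rint = (\<lambda>r. \<Union>A\<in>C. rint A r)\<rparr>"


section \<open>Abstract elementary classes\<close>

record ('u, 'f, 'r) aec =
  lang :: "('f, 'r) lang"
  mods :: "('u, 'f, 'r) struct set"
  le :: "('u, 'f, 'r) struct \<Rightarrow> ('u, 'f, 'r) struct \<Rightarrow> bool"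

text \<open>
  An increasing chain indexed by an ordinal is given by its range, i.e. by a nonempty set
  of structures that is well-ordered by \<open>\<preceq>\<close>.
\<close>

definition is_chain :: "('u, 'f, 'r) aec \<Rightarrow> ('u, 'f, 'r) struct set \<Rightarrow> bool" where
  "is_chain K C \<longleftrightarrow>
     C \<noteq> {} \<and> C \<subseteq> mods K \<and> (\<forall>S\<subseteq>C. S \<noteq> {} \<longrightarrow> (\<exists>m\<in>S. \<forall>x\<in>S. le K m x))"

definition LS_property :: "('u, 'f, 'r) aec \<Rightarrow> 'c rel \<Rightarrow> bool" where
  "LS_property K \<kappa> \<longleftrightarrow>
     |fsyms (lang K)| \<le>o \<kappa> \<and> |rsyms (lang K)| \<le>o \<kappa> \<and>
     (\<forall>A\<in>mods K. \<forall>X\<subseteq>univ A. \<exists>B. le K B A \<and> X \<subseteq> univ B \<and> |univ B| \<le>o |X| +c \<kappa>)"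

text \<open>
  A Loewenheim-Skolem number is by convention infinite and at least the size of the language,
  so \<open>LS(K) = \<omega>\<close> says that \<open>\<omega>\<close> has the Loewenheim-Skolem property.
\<close>

definition AEC_LS_omega :: "('u, 'f, 'r) aec \<Rightarrow> bool" where
  "AEC_LS_omega K \<longleftrightarrow>
     (\<forall>A\<in>mods K. is_struct (lang K) A) \<and>
     (\<forall>A B. le K A B \<longrightarrow> A \<in> mods K \<and> B \<in> mods K) \<and>
     (\<forall>A\<in>mods K. \<forall>B h. is_struct (lang K) B \<and> iso (lang K) h A B \<longrightarrow> B \<in> mods K) \<and>
     (\<forall>A B A' B' h. le K A B \<and> is_struct (lang K) A' \<and> is_struct (lang K) B' \<and>
        iso (lang K) h B B' \<and> substruct (lang K) A' B' \<and> univ A' = h ` univ A \<longrightarrow> le K A' B') \<and>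
     (\<forall>A B. le K A B \<longrightarrow> substruct (lang K) A B) \<and>
     (\<forall>A\<in>mods K. le K A A) \<and>
     (\<forall>A B. le K A B \<and> le K B A \<longrightarrow> A = B) \<and>
     (\<forall>A B C. le K A B \<and> le K B C \<longrightarrow> le K A C) \<and>
     (\<forall>C. is_chain K C \<longrightarrow>
        chain_union (lang K) C \<in> mods K \<and>
        (\<forall>A\<in>C. le K A (chain_union (lang K) C)) \<and>
        (\<forall>B. (\<forall>A\<in>C. le K A B) \<longrightarrow> le K (chain_union (lang K) C) B)) \<and>
     (\<forall>A B C. le K A C \<and> le K B C \<and> substruct (lang K) A B \<longrightarrow> le K A B) \<and>
     LS_property K natLeq"

definition elem_emb ::
  "('u, 'f, 'r) aec \<Rightarrow> ('u \<Rightarrow> 'u) \<Rightarrow> ('u, 'f, 'r) struct \<Rightarrow> ('u, 'f, 'r) struct \<Rightarrow> bool" where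
  "elem_emb K h A B \<longleftrightarrow>
     h ` univ A \<subseteq> univ B \<and>
     iso (lang K) h A (restr (lang K) B (h ` univ A)) \<and>
     le K (restr (lang K) B (h ` univ A)) B"

definition AP :: "('u, 'f, 'r) aec \<Rightarrow> bool" where
  "AP K \<longleftrightarrow>
     (\<forall>A\<in>mods K. \<forall>B\<in>mods K. \<forall>C\<in>mods K. \<forall>f g. elem_emb K f A B \<and> elem_emb K g A C \<longrightarrow>
        (\<exists>D\<in>mods K. \<exists>f' g'. elem_emb K f' B D \<and> elem_emb K g' C D \<and>
           (\<forall>x\<in>univ A. f' (f x) = g' (g x))))"

definition JEP :: "('u, 'f, 'r) aec \<Rightarrow> bool" where
  "JEP K \<longleftrightarrow>
     (\<forall>A\<in>mods K. \<forall>B\<in>mods K. \<exists>D\<in>mods K. \<exists>f g. elem_emb K f A D \<and> elem_emb K g B D)"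

text \<open>Cardinalities are those available in the universe \<open>'u\<close>.\<close>

definition arbitrarily_large :: "('u, 'f, 'r) aec \<Rightarrow> bool" where
  "arbitrarily_large K \<longleftrightarrow> (\<forall>X :: 'u set. \<exists>A\<in>mods K. |X| \<le>o |univ A| )"


section \<open>Monster models\<close>

text \<open>
  A model \<open>\<A> \<preceq> N\<close> is represented by its universe.  Here \<open>\<kappa>\<close> is the bound on sizes
  that belongs to \<open>N\<close>.
\<close>

definition is_model ::
  "('u, 'f, 'r) aec \<Rightarrow> ('u, 'f, 'r) struct \<Rightarrow> 'c rel \<Rightarrow> 'u set \<Rightarrow> bool" where
  "is_model K N \<kappa> X \<longleftrightarrow> X \<subseteq> univ N \<and> le K (restr (lang K) N X) N \<and> |X| <o \<kappa>"

definition model_homogeneous ::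
  "('u, 'f, 'r) aec \<Rightarrow> 'c rel \<Rightarrow> ('u, 'f, 'r) struct \<Rightarrow> bool" where
  "model_homogeneous K \<kappa> N \<longleftrightarrow>
     (\<forall>X Y f. is_model K N \<kappa> X \<and> is_model K N \<kappa> Y \<and>
        iso (lang K) f (restr (lang K) N X) (restr (lang K) N Y) \<longrightarrow>
        (\<exists>g\<in>autos (lang K) N. \<forall>x\<in>X. g x = f x))"

definition universal :: "('u, 'f, 'r) aec \<Rightarrow> 'c rel \<Rightarrow> ('u, 'f, 'r) struct \<Rightarrow> bool" where
  "universal K \<kappa> N \<longleftrightarrow> (\<forall>A\<in>mods K. |univ A| <o \<kappa> \<longrightarrow> (\<exists>f. elem_emb K f A N))"

text \<open>
  ``Large cardinal'' is read as strongly inaccessible.  Every cardinal below a cardinal on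
  \<open>'u\<close> is the size of some set over \<open>'u\<close>.
\<close>

definition strongly_inaccessible :: "'u rel \<Rightarrow> bool" where
  "strongly_inaccessible \<delta> \<longleftrightarrow>
     Card_order \<delta> \<and> natLeq <o \<delta> \<and> regularCard \<delta> \<and>
     (\<forall>X :: 'u set. |X| <o \<delta> \<longrightarrow> |Pow X| <o \<delta>)"

definition monster_model ::
  "('u, 'f, 'r) aec \<Rightarrow> 'u rel \<Rightarrow> ('u, 'f, 'r) struct \<Rightarrow> bool" where
  "monster_model K \<delta> M \<longleftrightarrow>
     strongly_inaccessible \<delta> \<and> M \<in> mods K \<and> model_homogeneous K \<delta> M \<and> universal K \<delta> M"

definition supermonster ::
  "('u, 'f, 'r) aec \<Rightarrow> ('u, 'f, 'r) struct \<Rightarrow> ('u, 'f, 'r) struct \<Rightarrow> bool" where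
  "supermonster K M M' \<longleftrightarrow>
     M' \<in> mods K \<and> le K M M' \<and> |univ M| <o |univ M'| \<and>
     model_homogeneous K |univ M'| M' \<and> universal K |univ M'| M'"


section \<open>Types, splitting, Lascar types and independence\<close>

text \<open>
  These notions depend only on a set of points, its automorphisms and the bound on sizes.
  They are used for \<open>M\<close>, for the supermonster \<open>M'\<close> and for \<open>M\<^sup>e\<^sup>q\<close>.
\<close>

record ('x, 'c) ambient =
  pts :: "'x set"
  aut :: "('x \<Rightarrow> 'x) set"
  bound :: "'c rel"

definition monster_ambient ::
  "('u, 'f, 'r) aec \<Rightarrow> 'u rel \<Rightarrow> ('u, 'f, 'r) struct \<Rightarrow> ('u, 'u) ambient" where
  "monster_ambient K \<kappa> N = \<lparr>pts = univ N, aut = autos (lang K) N, bound = \<kappa>\<rparr>"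

definition bounded_set :: "('x, 'c) ambient \<Rightarrow> 'x set \<Rightarrow> bool" where
  "bounded_set S X \<longleftrightarrow> X \<subseteq> pts S \<and> |X| <o bound S"

definition fixing :: "('x, 'c) ambient \<Rightarrow> 'x set \<Rightarrow> ('x \<Rightarrow> 'x) set" where
  "fixing S A = {f \<in> aut S. \<forall>x\<in>A. f x = x}"

text \<open>The Galois type of a tuple is its orbit, so that realizing a type is membership.\<close>

definition gtp :: "('x, 'c) ambient \<Rightarrow> 'x set \<Rightarrow> 'x list \<Rightarrow> 'x list set" where
  "gtp S A a = {map f a | f. f \<in> fixing S A}"

definition gtypes :: "('x, 'c) ambient \<Rightarrow> 'x set \<Rightarrow> 'x list set set" where
  "gtypes S A = gtp S A ` lists (pts S)"

definition wtp_eq :: "('x, 'c) ambient \<Rightarrow> 'x set \<Rightarrow> 'x list \<Rightarrow> 'x list \<Rightarrow> bool" where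
  "wtp_eq S A a b \<longleftrightarrow> (\<forall>B\<subseteq>A. finite B \<longrightarrow> gtp S B a = gtp S B b)"

text \<open>
  Equality \<open>t(X/A) = t(Y/A)\<close> of weak types of (possibly infinite) sets: the bijection \<open>h\<close>
  matches an enumeration of \<open>X\<close> with one of \<open>Y\<close>.
\<close>

definition wtp_eq_set :: "('x, 'c) ambient \<Rightarrow> 'x set \<Rightarrow> 'x set \<Rightarrow> 'x set \<Rightarrow> bool" where
  "wtp_eq_set S A X Y \<longleftrightarrow>
     (\<exists>h. bij_betw h X Y \<and>
        (\<forall>B\<subseteq>A. finite B \<longrightarrow> (\<exists>f\<in>fixing S B. \<forall>x\<in>X. f x = h x)))"

definition splits :: "('x, 'c) ambient \<Rightarrow> 'x list \<Rightarrow> 'x set \<Rightarrow> 'x set \<Rightarrow> bool" where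
  "splits S a B A \<longleftrightarrow>
     (\<exists>b\<in>lists B. \<exists>c\<in>lists B. wtp_eq S A b c \<and> \<not> wtp_eq S A (a @ b) (a @ c))"

definition ns_indep :: "('x, 'c) ambient \<Rightarrow> 'x list \<Rightarrow> 'x set \<Rightarrow> 'x set \<Rightarrow> bool" where
  "ns_indep S a B C \<longleftrightarrow> (\<exists>A\<subseteq>B. finite A \<and> \<not> splits S a (B \<union> C) A)"

definition ns_indep_set :: "('x, 'c) ambient \<Rightarrow> 'x set \<Rightarrow> 'x set \<Rightarrow> 'x set \<Rightarrow> bool" where
  "ns_indep_set S X B C \<longleftrightarrow> (\<forall>a\<in>lists X. ns_indep S a B C)"

definition inv_equivs :: "('x, 'c) ambient \<Rightarrow> nat \<Rightarrow> 'x set \<Rightarrow> 'x list rel set" where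
  "inv_equivs S n A =
     {E. equiv (nlists n (pts S)) E \<and>
         (\<forall>f\<in>fixing S A. \<forall>x y. (x, y) \<in> E \<longrightarrow> (map f x, map f y) \<in> E) \<and>
         |nlists n (pts S) // E| <o bound S}"

definition Lt_eq :: "('x, 'c) ambient \<Rightarrow> 'x set \<Rightarrow> 'x list \<Rightarrow> 'x list \<Rightarrow> bool" where
  "Lt_eq S B a b \<longleftrightarrow>
     length a = length b \<and>
     (\<forall>A\<subseteq>B. finite A \<longrightarrow> (\<forall>E\<in>inv_equivs S (length a) A. (a, b) \<in> E))"

definition Lsplits :: "('x, 'c) ambient \<Rightarrow> 'x list \<Rightarrow> 'x set \<Rightarrow> 'x set \<Rightarrow> bool" where
  "Lsplits S a B A \<longleftrightarrow>
     (\<exists>b\<in>lists B. \<exists>c\<in>lists B. Lt_eq S A b c \<and> \<not> wtp_eq S A (a @ b) (a @ c))"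

definition indep :: "('x, 'c) ambient \<Rightarrow> 'x list \<Rightarrow> 'x set \<Rightarrow> 'x set \<Rightarrow> bool" where
  "indep S a B C \<longleftrightarrow>
     (\<exists>A\<subseteq>B. finite A \<and>
        (\<forall>D. bounded_set S D \<and> B \<union> C \<subseteq> D \<longrightarrow>
           (\<exists>b\<in>lists (pts S). wtp_eq S (B \<union> C) b a \<and> \<not> Lsplits S b D A)))"


section \<open>FUR-classes\<close>

definition s_saturated :: "('x, 'c) ambient \<Rightarrow> 'x set \<Rightarrow> bool" where
  "s_saturated S X \<longleftrightarrow>
     (\<forall>b\<in>lists (pts S). \<forall>A\<subseteq>X. finite A \<longrightarrow> (\<exists>a\<in>lists X. wtp_eq S A a b))"

text \<open>\<open>X \<union> set a \<union> range as\<close> is s-primary over \<open>X \<union> set a\<close>, as witnessed by \<open>as\<close>.\<close>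

definition s_primary_seq ::
  "('x, 'c) ambient \<Rightarrow> 'x set \<Rightarrow> 'x list \<Rightarrow> (nat \<Rightarrow> 'x) \<Rightarrow> bool" where
  "s_primary_seq S X a as \<longleftrightarrow>
     (\<forall>n. \<exists>A\<subseteq>X. finite A \<and>
        (\<forall>a' \<in> lists (pts S). \<forall>as' \<in> nlists (Suc n) (pts S).
           wtp_eq S X a' a \<and> wtp_eq S A (a' @ as') (a @ map as [0..<Suc n]) \<longrightarrow>
           wtp_eq S X (a' @ as') (a @ map as [0..<Suc n])))"

definition weakly_elementary ::
  "('u, 'f, 'r) aec \<Rightarrow> 'u rel \<Rightarrow> ('u, 'f, 'r) struct \<Rightarrow> 'u set set \<Rightarrow> ('u \<Rightarrow> 'u) \<Rightarrow> bool" where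
  "weakly_elementary K \<delta> M \<F> f \<longleftrightarrow>
     (\<forall>a\<in>lists (\<Union>\<F>). wtp_eq (monster_ambient K \<delta> M) {} a (map f a)) \<and>
     (\<forall>X\<in>\<F>. is_model K M \<delta> (f ` X))"

definition s_prime ::
  "('u, 'f, 'r) aec \<Rightarrow> 'u rel \<Rightarrow> ('u, 'f, 'r) struct \<Rightarrow> 'u set set \<Rightarrow> 'u set \<Rightarrow> bool" where
  "s_prime K \<delta> M \<F> D \<longleftrightarrow>
     is_model K M \<delta> D \<and> \<Union>\<F> \<subseteq> D \<and>
     (\<forall>B f. is_model K M \<delta> B \<and> f ` \<Union>\<F> \<subseteq> B \<and> weakly_elementary K \<delta> M \<F> f \<longrightarrow>
        (\<exists>g. elem_emb K g (restr (lang K) M D) (restr (lang K) M B) \<and>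
             (\<forall>x\<in>\<Union>\<F>. g x = f x)))"

text \<open>
  The game \<open>GI(a, A, X)\<close>.  A position is the current pair \<open>(a\<^sub>n, A\<^sub>n)\<close>.  A strategy \<open>\<sigma>\<close>
  of player II assigns to the list of the moves of player I so far the answer to the last one.
\<close>

definition GI_legal ::
  "('x, 'c) ambient \<Rightarrow> 'x set \<Rightarrow> 'x list \<times> 'x set \<Rightarrow> 'x list \<times> 'x set \<Rightarrow> bool" where
  "GI_legal S X = (\<lambda>(a, A) (a', A').
     a' \<in> lists (pts S) \<and> finite A' \<and> A' \<subseteq> X \<and> A \<subseteq> A' \<and>
     wtp_eq S A a' a \<and> \<not> wtp_eq S A' a' a)"

definition GI_position ::
  "'x list \<Rightarrow> 'x set \<Rightarrow> (('x list \<times> 'x set) list \<Rightarrow> 'x set) \<Rightarrow> ('x list \<times> 'x set) list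
    \<Rightarrow> 'x list \<times> 'x set" where
  "GI_position a A \<sigma> ms = (if ms = [] then (a, A) else (fst (last ms), \<sigma> ms))"

inductive GI_play ::
  "('x, 'c) ambient \<Rightarrow> 'x list \<Rightarrow> 'x set \<Rightarrow> 'x set \<Rightarrow> (('x list \<times> 'x set) list \<Rightarrow> 'x set)
    \<Rightarrow> ('x list \<times> 'x set) list \<Rightarrow> bool"
  for S a A X \<sigma> where
  start: "GI_play S a A X \<sigma> []"
| move: "GI_play S a A X \<sigma> ms \<Longrightarrow> GI_legal S X (GI_position a A \<sigma> ms) m \<Longrightarrow>
     GI_play S a A X \<sigma> (ms @ [m])"

definition GI_strategy ::
  "('x, 'c) ambient \<Rightarrow> 'x list \<Rightarrow> 'x set \<Rightarrow> 'x set \<Rightarrow> (('x list \<times> 'x set) list \<Rightarrow> 'x set) \<Rightarrow> bool"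
  where
  "GI_strategy S a A X \<sigma> \<longleftrightarrow>
     (\<forall>ms m. GI_play S a A X \<sigma> (ms @ [m]) \<longrightarrow>
        finite (\<sigma> (ms @ [m])) \<and> \<sigma> (ms @ [m]) \<subseteq> X \<and> snd m \<subseteq> \<sigma> (ms @ [m]))"

definition GI_wins ::
  "('x, 'c) ambient \<Rightarrow> nat \<Rightarrow> 'x list \<Rightarrow> 'x set \<Rightarrow> 'x set \<Rightarrow> bool" where
  "GI_wins S n a A X \<longleftrightarrow>
     (\<exists>\<sigma>. GI_strategy S a A X \<sigma> \<and> (\<forall>ms. GI_play S a A X \<sigma> ms \<longrightarrow> length ms \<le> n))"

definition axiom_AI :: "('u, 'f, 'r) aec \<Rightarrow> 'u rel \<Rightarrow> ('u, 'f, 'r) struct \<Rightarrow> bool"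
  where
  "axiom_AI K \<delta> M \<longleftrightarrow>
     (\<forall>A. is_model K M \<delta> A \<and> countable A \<longrightarrow> s_saturated (monster_ambient K \<delta> M) A)"

definition axiom_AII :: "('u, 'f, 'r) aec \<Rightarrow> 'u rel \<Rightarrow> ('u, 'f, 'r) struct \<Rightarrow> bool"
  where
  "axiom_AII K \<delta> M \<longleftrightarrow>
     (\<forall>a\<in>lists (univ M). \<forall>A. is_model K M \<delta> A \<and> countable A \<longrightarrow>
        (\<exists>as. is_model K M \<delta> (A \<union> set a \<union> range as) \<and>
              s_primary_seq (monster_ambient K \<delta> M) A a as))"

definition axiom_AIII :: "('u, 'f, 'r) aec \<Rightarrow> 'u rel \<Rightarrow> ('u, 'f, 'r) struct \<Rightarrow> bool"
  where
  "axiom_AIII K \<delta> M \<longleftrightarrow>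
     (let S = monster_ambient K \<delta> M; model = is_model K M \<delta> in
      \<forall>A B C. model A \<and> model B \<and> model C \<and> ns_indep_set S A B C \<and> B = A \<inter> C \<longrightarrow>
        (\<exists>!D. s_prime K \<delta> M {A, C} D) \<and>
        (\<forall>D C'. s_prime K \<delta> M {A, C} D \<and> model C' \<and> C \<subseteq> C' \<and> ns_indep_set S A B C' \<longrightarrow>
           ns_indep_set S D C C'))"

definition axiom_AIV :: "('u, 'f, 'r) aec \<Rightarrow> 'u rel \<Rightarrow> ('u, 'f, 'r) struct \<Rightarrow> bool"
  where
  "axiom_AIV K \<delta> M \<longleftrightarrow>
     (\<forall>a\<in>lists (univ M). \<exists>n. \<forall>X A.
        is_model K M \<delta> X \<and> countable X \<and> finite A \<and> A \<subseteq> X \<longrightarrow>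
        GI_wins (monster_ambient K \<delta> M) n a A X)"

definition axiom_AV :: "('u, 'f, 'r) aec \<Rightarrow> 'u rel \<Rightarrow> ('u, 'f, 'r) struct \<Rightarrow> bool"
  where
  "axiom_AV K \<delta> M \<longleftrightarrow>
     (let S = monster_ambient K \<delta> M; model = is_model K M \<delta> in
      \<forall>A B. \<forall>a\<in>lists (univ M).
        model A \<and> countable A \<and> model B \<and> countable B \<and> A \<subseteq> B \<and>
        ns_indep_set S B A (set a) \<longrightarrow> ns_indep S a A B)"

definition axiom_AVI :: "('u, 'f, 'r) aec \<Rightarrow> 'u rel \<Rightarrow> ('u, 'f, 'r) struct \<Rightarrow> bool"
  where
  "axiom_AVI K \<delta> M \<longleftrightarrow>
     (let S = monster_ambient K \<delta> M; model = is_model K M \<delta> in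
      \<forall>A B D. model A \<and> model B \<and> model D \<and> A \<subseteq> B \<inter> D \<longrightarrow>
        (\<exists>C. model C \<and> wtp_eq_set S A C B \<and> ns_indep_set S C A D))"

definition FUR_class :: "('u, 'f, 'r) aec \<Rightarrow> 'u rel \<Rightarrow> ('u, 'f, 'r) struct \<Rightarrow> bool" where
  "FUR_class K \<delta> M \<longleftrightarrow>
     AEC_LS_omega K \<and> AP K \<and> JEP K \<and> arbitrarily_large K \<and>
     (\<forall>A\<in>mods K. infinite (univ A)) \<and>
     axiom_AI K \<delta> M \<and> axiom_AII K \<delta> M \<and> axiom_AIII K \<delta> M \<and>
     axiom_AIV K \<delta> M \<and> axiom_AV K \<delta> M \<and> axiom_AVI K \<delta> M"


section \<open>Imaginaries\<close>

text \<open>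
  An imaginary \<open>a/E\<close> is literally the class \<^term>\<open>E `` {a}\<close>; an element \<open>x\<close> of \<open>M\<close> is
  identified with its class modulo equality.
\<close>

definition emb :: "'u \<Rightarrow> 'u list set" where
  "emb x = {[x]}"

definition imaginary_sorts ::
  "('u, 'f, 'r) aec \<Rightarrow> 'u rel \<Rightarrow> ('u, 'f, 'r) struct \<Rightarrow> 'u list rel set \<Rightarrow> bool" where
  "imaginary_sorts K \<delta> M \<E> \<longleftrightarrow>
     countable \<E> \<and> Id_on (nlists 1 (univ M)) \<in> \<E> \<and>
     (\<forall>E\<in>\<E>. \<exists>n.
        equiv (nlists n (univ M)) E \<and>
        (\<forall>f\<in>autos (lang K) M. \<forall>x y. (x, y) \<in> E \<longrightarrow> (map f x, map f y) \<in> E) \<and>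
        (\<exists>G \<subseteq> gtypes (monster_ambient K \<delta> M) {}. countable G \<and>
           (\<forall>a\<in>nlists n (univ M). \<forall>b\<in>nlists n (univ M).
              (a, b) \<in> E \<longleftrightarrow> gtp (monster_ambient K \<delta> M) {} (a @ b) \<in> G)))"

definition sort_of :: "'u list rel \<Rightarrow> 'u list set set" where
  "sort_of E = Domain E // E"

definition eq_points :: "'u list rel set \<Rightarrow> 'u list set set" where
  "eq_points \<E> = (\<Union>E\<in>\<E>. sort_of E)"

text \<open>
  Automorphisms preserve the structure of \<open>M\<close> on the home sort, the predicates \<open>P\<^sub>E\<close> and
  the functions \<open>F\<^sub>E\<close>.
\<close>

definition eq_autos ::
  "('u, 'f, 'r) aec \<Rightarrow> ('u, 'f, 'r) struct \<Rightarrow> 'u list rel set \<Rightarrow> ('u list set \<Rightarrow> 'u list set) set"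
  where
  "eq_autos K M \<E> =
     {g. bij_betw g (eq_points \<E>) (eq_points \<E>) \<and>
         (\<forall>E\<in>\<E>. g ` sort_of E = sort_of E) \<and>
         (\<exists>f\<in>autos (lang K) M.
            (\<forall>x\<in>univ M. g (emb x) = emb (f x)) \<and>
            (\<forall>E\<in>\<E>. \<forall>a\<in>Domain E. g (E `` {a}) = E `` {map f a}))}"

definition eq_ambient ::
  "('u, 'f, 'r) aec \<Rightarrow> 'u rel \<Rightarrow> ('u, 'f, 'r) struct \<Rightarrow> 'u list rel set
    \<Rightarrow> ('u list set, 'u) ambient" where
  "eq_ambient K \<delta> M \<E> =
     \<lparr>pts = eq_points \<E>, aut = eq_autos K M \<E>, bound = \<delta>\<rparr>"


section \<open>Global types and canonical bases\<close>

text \<open>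
  In this section \<open>S\<close> is the ambient of the supermonster and \<open>U\<close> the universe of \<open>M\<close>.
  A collection \<open>{p\<^sub>A}\<close> is a partial map from finite subsets of \<open>U\<close> to types, ordered
  by \<open>\<subseteq>\<^sub>m\<close>.
\<close>

definition type_collection ::
  "('u, 'c) ambient \<Rightarrow> 'u set \<Rightarrow> ('u set \<rightharpoonup> 'u list set) \<Rightarrow> bool" where
  "type_collection S U p \<longleftrightarrow>
     (\<forall>A q. p A = Some q \<longrightarrow> finite A \<and> A \<subseteq> U \<and> q \<in> gtypes S A) \<and>
     (\<forall>A B q r. A \<subseteq> B \<and> p A = Some q \<and> p B = Some r \<longrightarrow> (\<forall>b\<in>lists U. b \<in> r \<longrightarrow> b \<in> q)) \<and>
     (\<exists>b\<in>lists (pts S). \<forall>A q. p A = Some q \<longrightarrow> b \<in> q)"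

definition global_type ::
  "('u, 'c) ambient \<Rightarrow> 'u set \<Rightarrow> ('u set \<rightharpoonup> 'u list set) \<Rightarrow> bool" where
  "global_type S U p \<longleftrightarrow>
     type_collection S U p \<and> (\<forall>p'. type_collection S U p' \<and> p \<subseteq>\<^sub>m p' \<longrightarrow> p' = p)"

text \<open>The global type \<open>t(b/M)\<close>.\<close>

definition global_tp ::
  "('u, 'c) ambient \<Rightarrow> 'u set \<Rightarrow> 'u list \<Rightarrow> ('u set \<rightharpoonup> 'u list set)" where
  "global_tp S U b = (\<lambda>A. if finite A \<and> A \<subseteq> U then Some (gtp S A b) else None)"

text \<open>\<open>g(p) = p\<close>, where \<open>g\<close> is an automorphism of \<open>M\<^sup>e\<^sup>q\<close>.\<close>

definition preserves_global ::
  "'u set \<Rightarrow> ('u list set \<Rightarrow> 'u list set) \<Rightarrow> ('u set \<rightharpoonup> 'u list set) \<Rightarrow> bool" where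
  "preserves_global U g p \<longleftrightarrow>
     (\<forall>A B q r. finite A \<and> A \<subseteq> U \<and> finite B \<and> B \<subseteq> U \<and> g ` emb ` B = emb ` A \<and>
        p A = Some q \<and> p B = Some r \<longrightarrow>
        (\<forall>b\<in>lists U. \<forall>b'\<in>lists U. b \<in> r \<and> map g (map emb b) = map emb b' \<longrightarrow> b' \<in> q))"

definition canonical_base ::
  "('u, 'f, 'r) aec \<Rightarrow> ('u, 'f, 'r) struct \<Rightarrow> ('u, 'f, 'r) struct \<Rightarrow> 'u list rel set
    \<Rightarrow> ('u set \<rightharpoonup> 'u list set) \<Rightarrow> 'u list set list \<Rightarrow> bool" where
  "canonical_base K M M' \<E> p \<alpha> \<longleftrightarrow>
     global_type (monster_ambient K |univ M'| M') (univ M) p \<and>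
     \<alpha> \<in> lists (eq_points \<E>) \<and>
     (\<forall>g\<in>eq_autos K M \<E>. preserves_global (univ M) g p \<longleftrightarrow> map g \<alpha> = \<alpha>)"

text \<open>\<open>\<alpha> = Cb(a/A)\<close>.\<close>

definition is_Cb ::
  "('u, 'f, 'r) aec \<Rightarrow> ('u, 'f, 'r) struct \<Rightarrow> ('u, 'f, 'r) struct \<Rightarrow> 'u list rel set
    \<Rightarrow> 'u list \<Rightarrow> 'u set \<Rightarrow> 'u list set list \<Rightarrow> bool" where
  "is_Cb K M M' \<E> a A \<alpha> \<longleftrightarrow>
     (let S' = monster_ambient K |univ M'| M' in
      \<exists>b\<in>lists (univ M').
        Lt_eq S' A b a \<and> indep S' b A (univ M) \<and>
        canonical_base K M M' \<E> (global_tp S' (univ M) b) \<alpha>)"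

text \<open>
  The choice of \<open>\<E>\<close>.  In \<^term>\<open>cb_types\<close>, \<open>q c i\<close> is the type \<open>q\<^sub>i\<^sup>c\<close>; its
  defining condition determines only which \<open>q c i\<close> extend the type of \<open>a\<close>, so it is
  required of \<open>\<E>\<close> that it contains the relation obtained from some such choice.
\<close>

definition cb_types ::
  "('u, 'c) ambient \<Rightarrow> 'u set \<Rightarrow> 'u list \<Rightarrow> 'u list \<Rightarrow> ('u list \<Rightarrow> nat \<Rightarrow> 'u list set) \<Rightarrow> bool"
  where
  "cb_types S U b a q \<longleftrightarrow>
     (\<forall>c\<in>lists U.
        (\<forall>i. q c i \<in> gtypes S {}) \<and>
        (\<forall>d\<in>lists U. b @ d \<in> gtp S {} (b @ c) \<longleftrightarrow> (\<exists>i. a @ d \<in> q c i)))"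

definition cb_equiv :: "'u set \<Rightarrow> nat \<Rightarrow> ('u list \<Rightarrow> nat \<Rightarrow> 'u list set) \<Rightarrow> 'u list rel" where
  "cb_equiv U n q =
     {(a0, a1). a0 \<in> nlists n U \<and> a1 \<in> nlists n U \<and>
        (\<forall>c\<in>lists U. \<forall>d\<in>lists U. (\<exists>i. a0 @ d \<in> q c i) \<longleftrightarrow> (\<exists>i. a1 @ d \<in> q c i))}"

definition contains_cb_sorts ::
  "('u, 'f, 'r) aec \<Rightarrow> ('u, 'f, 'r) struct \<Rightarrow> ('u, 'f, 'r) struct \<Rightarrow> 'u list rel set \<Rightarrow> bool" where
  "contains_cb_sorts K M M' \<E> \<longleftrightarrow>
     (let S' = monster_ambient K |univ M'| M' in
      \<forall>b\<in>lists (univ M'). \<forall>a\<in>lists (univ M).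
        \<not> splits S' b (univ M) (set a) \<longrightarrow>
        (\<exists>q. cb_types S' (univ M) b a q \<and> cb_equiv (univ M) (length a) q \<in> \<E>))"

end

theory Submission
  imports Defs "HOL-Library.FuncSet"
begin

text \<open>
  Let \<open>b\<close> realise in \<open>M'\<close> the global type with canonical base \<open>\<alpha>\<close>, so that the automorphisms of
  \<open>M\<close> fixing \<open>\<alpha>\<close> are exactly those preserving \<open>t(b/M)\<close>.  Given a bounded \<open>D\<close>, the witness for
  independence is a realisation \<open>a'\<close> in \<open>M\<close> of \<open>t(b/D)\<close>.  It does not Lascar split over \<open>\<alpha>\<close>, because tuples of \<open>D\<close>
  with the same Lascar type over \<open>\<alpha>\<close> are conjugate over \<open>\<alpha>\<close> and such a conjugation preserves \<open>t(b/M)\<close>.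

  It remains to see that \<open>a\<close> and \<open>a'\<close> have the same type over \<open>\<alpha>\<close> and any finite \<open>B \<subseteq> A\<close>.  Having the same type
  over \<open>B\<close> and every \<open>B\<close>-conjugate of \<open>\<alpha>\<close> is a \<open>B\<close>-invariant equivalence relation, and \<open>Lt(b/A) = Lt(a/A)\<close>
  finishes the proof once it has boundedly many classes, that is, once \<open>t(b/M)\<close> has boundedly many
  \<open>B\<close>-conjugates.  As \<open>b\<close> does not Lascar split over a finite \<open>A0 \<subseteq> B\<close>, a conjugate is determined by its
  type over representatives of the Lascar types over \<open>A0\<close>.

  Lascar types of \<open>M'\<close> are defined by relations with fewer than \<open>|M'|\<close> classes, and \<open>|M'|\<close> need not be
  inaccessible.  An invariant relation with at least \<open>\<delta>\<close> classes has, however, \<open>|M'|\<close> many: by the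
  Erdos--Rado theorem its classes contain a template of indiscernibles, which is stretched to length
  \<open>|M'|\<close>.  Hence there are fewer than \<open>\<delta>\<close> Lascar types over \<open>A0\<close>.
\<close>

(* With nlists_def unfolded these conditional rules make the simplifier loop. *)
declare nlistsE_length [simp del] nlistsE_set [simp del]

text \<open>The obstacle is that three ambients interact: \<open>b\<close> lives in M', \<alpha> in
  Meq, and independence is tested by automorphisms of Meq, which do not act on \<open>b\<close>. The
  link is the group \<open>\<G>\<close> of automorphisms of M' that preserve M setwise. Every
  automorphism of M extends to one of them, each of them acts on Meq by taking images of classes
  (\<open>hat\<close>), and stabilising t(b/M) becomes a property of its elements. In the other
  direction, any small part of M' can be moved into M over a small part of M, so types computed in
  M' are realised by tuples of M.

  Apart from the bound on the classes of a single invariant relation, the counting rests on one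
  fact: over a finite set there are only countably many Galois types, because a countable model
  containing it is s-saturated. Invariant relations, conjugates of t(b/M) and classes of the final
  equivalence relation are coded by sets of such types or by functions from small sets into them.
  The counts must stay below \<delta>, not merely below |M'|, because powers are taken and
  representatives must be fixed while tuples are moved into M.\<close>

section \<open>Sets of size below an inaccessible cardinal\<close>

lemma lists_eq_UN_nlists: "lists A = (\<Union>n. nlists n A)"
  unfolding nlists_def lists_eq_set by blast

text \<open>Stated for an arbitrary infinite cardinal: the stretched model needs it for the size of
  \<open>'u\<close>, which is not assumed inaccessible.\<close>

lemma card_of_lists_Cinfinite_bound:
  assumes "|A| \<le>o r" "Cinfinite r"
  shows "|lists A| \<le>o r"
proof -
  have n: "|nlists n A| \<le>o r" for n
  proof (induction n)
    case 0
    show ?case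
      using assms(2) by (auto simp: cinfinite_def intro!: Card_order_singl_ordLeq)
  next
    case (Suc n)
    have "|nlists (Suc n) A| \<le>o |A \<times> nlists n A|"
      by (rule surj_imp_ordLeq[of _ "\<lambda>(x, y). x # y"]) (auto simp: nlists_Suc)
    also have "|A \<times> nlists n A| \<le>o r"
      using assms Suc cprod_cinfinite_bound[of "|A|" r "|nlists n A|"] by (simp add: cprod_def Field_card_of card_of_card_order_on)
    finally show ?case .
  qed
  have "|\<Union>n\<in>UNIV. nlists n A| \<le>o r"
    using n assms(2) by (intro UNION_Cinfinite_bound)
      (auto simp: cinfinite_def infinite_iff_card_of_nat card_of_Field_ordIso
        intro: ordLeq_ordIso_trans)
  then show ?thesis by (simp add: lists_eq_UN_nlists)
qed

locale inaccessible =
  fixes \<delta> :: "'u rel"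
  assumes inacc: "strongly_inaccessible \<delta>"
begin

text \<open>Polymorphic on purpose: sets of classes, types, relations and functions are all measured
  against a cardinal that lives on \<open>'u\<close>.\<close>

definition small :: "'a set \<Rightarrow> bool" where
  "small Y \<longleftrightarrow> |Y| <o \<delta>"

lemma Card_order_delta: "Card_order \<delta>"
  using inacc by (simp add: strongly_inaccessible_def)

lemma cinfinite_delta: "cinfinite \<delta>"
  using inacc natLeq_ordLeq_cinfinite[of natLeq]
  by (meson strongly_inaccessible_def cinfinite_mono ordLess_imp_ordLeq natLeq_cinfinite)

lemma Cinfinite_delta: "Cinfinite \<delta>"
  using Card_order_delta cinfinite_delta by simp

lemma stable_delta: "stable \<delta>"
  using inacc Card_order_delta cinfinite_delta regularCard_stable
  unfolding strongly_inaccessible_def cinfinite_def by blast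

lemma small_ordLeq: "|A| \<le>o |B| \<Longrightarrow> small B \<Longrightarrow> small A"
  unfolding small_def by (rule ordLeq_ordLess_trans)

lemma small_mono: "A \<subseteq> B \<Longrightarrow> small B \<Longrightarrow> small A"
  by (rule small_ordLeq[OF card_of_mono1])

lemma small_image: "small A \<Longrightarrow> small (f ` A)"
  by (rule small_ordLeq[OF card_of_image])

lemma small_inj: "inj_on f A \<Longrightarrow> f ` A \<subseteq> B \<Longrightarrow> small B \<Longrightarrow> small A"
  using small_ordLeq card_of_ordLeq by blast

lemma small_countable: "countable A \<Longrightarrow> small A"
proof -
  assume "countable A"
  then have "|A| \<le>o |UNIV :: nat set|"
    by (meson card_of_ordLeq countableE subset_UNIV)
  then have "|A| \<le>o natLeq"
    using card_of_nat ordLeq_ordIso_trans by blast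
  then show ?thesis
    using inacc ordLeq_ordLess_trans unfolding small_def strongly_inaccessible_def by blast
qed

lemma small_finite: "finite A \<Longrightarrow> small A"
  by (simp add: small_countable countable_finite)

lemma small_UN: "small I \<Longrightarrow> (\<And>i. i \<in> I \<Longrightarrow> small (A i)) \<Longrightarrow> small (\<Union>i\<in>I. A i)"
  using stable_UNION[OF stable_delta] unfolding small_def by blast

lemma small_Un: "small A \<Longrightarrow> small B \<Longrightarrow> small (A \<union> B)"
  unfolding small_def by (rule Un_Cinfinite_bound_strict) (auto simp: Cinfinite_delta)

lemma small_Times: "small A \<Longrightarrow> small B \<Longrightarrow> small (A \<times> B)"
proof -
  assume A: "small A" and B: "small B"
  have "A \<times> B = (\<Union>a\<in>A. (\<lambda>b. (a, b)) ` B)" by auto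
  show ?thesis
    unfolding \<open>A \<times> B = _\<close> by (intro small_UN A small_image B)
qed

text \<open>Inaccessibility of \<delta> speaks of sets over \<open>'u\<close> only; a copy inside
  the field of \<delta> transfers it to sets over other types.\<close>

lemma small_iso:
  assumes "small A"
  obtains B :: "'u set" where "|A| =o |B|" "small B"
proof -
  have "|A| <o \<delta>" using assms by (simp add: small_def)
  then obtain B where "B \<subseteq> Field \<delta>" "|A| =o |B|"
    using internalize_card_of_ordLeq[of A \<delta>] Card_order_delta
    by (metis card_of_Field_ordIso internalize_card_of_ordLeq2 ordIso_symmetric ordLess_imp_ordLeq ordLeq_ordIso_trans)
  then show ?thesis
    using that small_ordLeq assms ordIso_iff_ordLeq by blast
qed

lemma small_Pow: "small A \<Longrightarrow> small (Pow A)"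
proof -
  assume A: "small A"
  obtain B :: "'u set" where B: "|A| =o |B|" "small B" using small_iso[OF A] .
  have "small (Pow B)"
    using B(2) inacc unfolding small_def strongly_inaccessible_def by blast
  moreover obtain f where "bij_betw f A B" using B(1) card_of_ordIso by blast
  then have "inj_on ((`) f) (Pow A)" "(`) f ` Pow A \<subseteq> Pow B"
    by (auto simp: bij_betw_def inj_on_image_Pow)
  ultimately show ?thesis using small_inj by blast
qed

lemma small_lists: "small A \<Longrightarrow> small (lists A)"
proof -
  assume A: "small A"
  have n: "small (nlists n A)" for n
  proof (induction n)
    case (Suc n)
    show ?case
      unfolding nlists_Suc by (intro small_UN A small_image Suc)
  qed (simp add: small_finite)
  show ?thesis
    unfolding lists_eq_UN_nlists by (rule small_UN[OF small_countable n]) simp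
qed

text \<open>Later counting arguments send objects to functions on a small set of tests with few
  values each; graphs bound the number of such functions.\<close>

lemma small_PiE:
  assumes "small I" "\<And>i. i \<in> I \<Longrightarrow> small (B i)"
  shows "small (PiE I B)"
proof (rule small_inj)
  let ?g = "\<lambda>f. {(i, f i) |i. i \<in> I}"
  show "inj_on ?g (PiE I B)"
  proof (rule inj_onI)
    fix f g assume fg: "f \<in> PiE I B" "g \<in> PiE I B" and eq: "?g f = ?g g"
    have "f i = g i" if "i \<in> I" for i
      using eq that by blast
    then show "f = g" by (rule PiE_ext[OF fg])
  qed
  show "?g ` PiE I B \<subseteq> Pow (I \<times> (\<Union>i\<in>I. B i))" by auto
  show "small (Pow (I \<times> (\<Union>i\<in>I. B i)))"
    using assms by (intro small_Pow small_Times small_UN)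
qed

lemma not_small_ordLeq: "\<not> small A \<Longrightarrow> \<delta> \<le>o |A|"
  unfolding small_def using Card_order_delta card_of_Well_order not_ordLess_iff_ordLeq
  by (metis card_order_on_well_order_on)

lemma not_small_ordLess: "\<not> small A \<Longrightarrow> small B \<Longrightarrow> |B| <o |A|"
  using not_small_ordLeq ordLess_ordLeq_trans unfolding small_def by blast

end

section \<open>A partition theorem\<close>

text \<open>A copy of an arbitrary type whose class instance is some chosen well-order. It makes
  \<open><\<close> and \<open>LEAST\<close> available on sets of tuples or points without ordering
  the original type.\<close>

typedef 'a wo = "UNIV :: 'a set"
  by simp

instantiation wo :: (type) wellorder
begin

definition less_eq_wo :: "'a wo \<Rightarrow> 'a wo \<Rightarrow> bool" where
  "x \<le> y \<longleftrightarrow> (Rep_wo x, Rep_wo y) \<in> (SOME r. well_order_on UNIV r)"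

definition less_wo :: "'a wo \<Rightarrow> 'a wo \<Rightarrow> bool" where
  "(x :: 'a wo) < y \<longleftrightarrow> x \<le> y \<and> \<not> y \<le> x"

instance
proof
  define r :: "'a rel" where "r = (SOME r. well_order_on UNIV r)"
  have r: "well_order_on UNIV r"
    unfolding r_def using well_order_on by (rule someI_ex)
  then have "refl r" "Relation.trans r" "antisym r" "Relation.total r"
    by (auto simp: well_order_on_def linear_order_on_def partial_order_on_def preorder_on_def)
  then have refl: "(a, a) \<in> r" and trans: "(a, b) \<in> r \<Longrightarrow> (b, c) \<in> r \<Longrightarrow> (a, c) \<in> r"
    and anti: "(a, b) \<in> r \<Longrightarrow> (b, a) \<in> r \<Longrightarrow> a = b" and total: "(a, b) \<in> r \<or> (b, a) \<in> r" for a b c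
    unfolding refl_on_def trans_def antisym_def total_on_def by (blast, meson, meson, metis UNIV_I)
  have wf: "wf (r - Id)" using r by (simp add: well_order_on_def)
  note le = less_eq_wo_def[folded r_def]
  fix x y z :: "'a wo"
  show "(x < y) = (x \<le> y \<and> \<not> y \<le> x)" by (simp add: less_wo_def)
  show "x \<le> x" by (simp add: le refl)
  show "x \<le> y \<Longrightarrow> y \<le> z \<Longrightarrow> x \<le> z" unfolding le by (rule trans)
  show "x \<le> y \<Longrightarrow> y \<le> x \<Longrightarrow> x = y" unfolding le using anti Rep_wo_inject by blast
  show "x \<le> y \<or> y \<le> x" unfolding le by (rule total)
  fix P :: "'a wo \<Rightarrow> bool" and a :: "'a wo"
  assume step: "\<And>x. (\<And>y. y < x \<Longrightarrow> P y) \<Longrightarrow> P x"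
  have "P (Abs_wo u)" for u
  proof (induction u rule: wf_induct_rule[OF wf])
    case (1 u)
    show ?case
    proof (rule step)
      fix y assume "y < Abs_wo u"
      then have "(Rep_wo y, u) \<in> r - Id"
        unfolding less_wo_def le by (auto simp: Abs_wo_inverse refl)
      from 1[OF this] show "P y" by (simp add: Rep_wo_inverse)
    qed
  qed
  from this[of "Rep_wo a"] show "P a" by (simp add: Rep_wo_inverse)
qed

end

text \<open>Besides existence, uniqueness matters: it identifies a sequence built from
  \<open>y\<close> with the one rebuilt from its colour pattern.\<close>

lemma wellorder_recursion:
  fixes \<Phi> :: "('i::wellorder \<Rightarrow> 'x) \<Rightarrow> 'i \<Rightarrow> 'x"
  assumes "\<And>x x' i. (\<And>j. j < i \<Longrightarrow> x j = x' j) \<Longrightarrow> \<Phi> x i = \<Phi> x' i"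
  shows "\<exists>!x. \<forall>i. x i = \<Phi> x i"
proof -
  let ?x = "wfrec {(i, j). i < j} \<Phi>"
  have "adm_wf {(i, j). i < j} \<Phi>"
    using assms unfolding adm_wf_def by blast
  then have "\<forall>i. ?x i = \<Phi> ?x i"
    using wfrec_fixpoint[OF wf] by metis
  moreover have "x = x'" if "\<forall>i. x i = \<Phi> x i" "\<forall>i. x' i = \<Phi> x' i" for x x'
  proof
    show "x i = x' i" for i
    proof (induction i rule: less_induct)
      case (less i)
      then show ?case using that assms[of i x x'] by simp
    qed
  qed
  ultimately show ?thesis by blast
qed

text \<open>Increasing lists stand for m-element subsets, so that a colouring of finite subsets is a
  function on lists.\<close>

definition incr :: "nat \<Rightarrow> 'x::linorder set \<Rightarrow> 'x list set" where
  "incr m S = {l. sorted_wrt (<) l \<and> length l = m \<and> set l \<subseteq> S}"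

lemma incr_mono: "S \<subseteq> T \<Longrightarrow> incr m S \<subseteq> incr m T"
  unfolding incr_def by blast

text \<open>
  Each \<open>y \<in> X\<close> generates a sequence in \<open>X\<close> whose next member is the least element that has
  the same colours as \<open>y\<close> over the previous ones.  If it avoids \<open>y\<close> it is end-homogeneous;
  if it reaches \<open>y\<close>, then \<open>y\<close> can be recovered from an index and the colouring \<open>G\<close>
  induced on the indices, which can happen only for few \<open>y\<close>.
\<close>

lemma end_homogeneous:
  fixes f :: "'x::wellorder list \<Rightarrow> 'c" and \<kappa> :: "'i::wellorder set"
  assumes C: "\<And>l. f l \<in> C"
    and big: "\<not> |X| \<le>o |\<kappa> \<times> PiE (lists \<kappa>) (\<lambda>_. C)|"
  shows "\<exists>H y. H \<subseteq> X \<and> |\<kappa>| \<le>o |H| \<and>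
    (\<forall>l\<in>incr m H. \<forall>z\<in>H. (\<forall>w\<in>set l. w < z) \<longrightarrow> f (l @ [z]) = f (l @ [y]))"
proof -
  \<comment> \<open>\<open>z\<close> is admissible as the \<open>i\<close>-th term: it lies above
    the earlier terms and extends them with the colours prescribed by \<open>G\<close>, a colouring
    of increasing lists of indices.\<close>
  define ok where "ok G x i z \<longleftrightarrow> z \<in> X \<and> (\<forall>j\<in>\<kappa>. j < i \<longrightarrow> x j < z) \<and>
    (\<forall>l\<in>incr m (\<kappa> \<inter> {..<i}). f (map x l @ [z]) = G l)"
    for G :: "'i list \<Rightarrow> 'c" and x i z
  have ok_cong: "ok G x i = ok G' x' i"
    if "\<And>j. j < i \<Longrightarrow> x j = x' j" "\<And>l. l \<in> incr m (\<kappa> \<inter> {..<i}) \<Longrightarrow> G l = G' l" for x x' i G G'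
  proof -
    have "f (map x l @ [z]) = f (map x' l @ [z])" if "l \<in> incr m (\<kappa> \<inter> {..<i})" for l z
      using that \<open>\<And>j. j < i \<Longrightarrow> x j = x' j\<close> unfolding incr_def
      by (intro arg_cong[of _ _ f]) auto
    then show ?thesis
      unfolding ok_def by (intro ext conj_cong refl ball_cong) (auto simp: that)
  qed
  define seq where "seq G = (THE x. \<forall>i. x i = (LEAST z. ok G x i z))" for G
  have seq_unique: "\<exists>!x. \<forall>i. x i = (LEAST z. ok G x i z)" for G
    by (rule wellorder_recursion) (simp cong: ok_cong)
  \<comment> \<open>Here the prescribed colours are those of \<open>y\<close> over the sequence that
    is being built, hence a second recursion.\<close>
  have "\<exists>x. \<forall>i. x i = (LEAST z. ok (\<lambda>l. f (map x l @ [y])) x i z)" for y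
  proof -
    have "ok (\<lambda>l. f (map x l @ [y])) x i = ok (\<lambda>l. f (map x' l @ [y])) x' i"
      if "\<And>j. j < i \<Longrightarrow> x j = x' j" for x x' i
    proof (rule ok_cong)
      show "f (map x l @ [y]) = f (map x' l @ [y])" if "l \<in> incr m (\<kappa> \<inter> {..<i})" for l
        using that \<open>\<And>j. j < i \<Longrightarrow> x j = x' j\<close> unfolding incr_def
        by (intro arg_cong[of _ _ f]) auto
    qed (rule that)
    then have "\<exists>!x. \<forall>i. x i = (LEAST z. ok (\<lambda>l. f (map x l @ [y])) x i z)"
      by (intro wellorder_recursion arg_cong[of _ _ Least]) blast
    then show ?thesis by (rule ex1_implies_ex)
  qed
  then obtain x where x: "\<And>y i. x y i = (LEAST z. ok (\<lambda>l. f (map (x y) l @ [y])) (x y) i z)"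
    by metis
  have "\<exists>y\<in>X. y \<notin> x y ` \<kappa>"
  proof (rule ccontr)
    assume "\<not> ?thesis"
    then have hit: "\<And>y. y \<in> X \<Longrightarrow> y \<in> x y ` \<kappa>" by blast
    let ?P = "PiE (lists \<kappa>) (\<lambda>_. C)"
    have "X \<subseteq> (\<lambda>(i, G). seq G i) ` (\<kappa> \<times> ?P)"
    proof
      fix y assume "y \<in> X"
      then obtain i where i: "i \<in> \<kappa>" "x y i = y" using hit by force
      \<comment> \<open>Restriction puts the pattern into the set of functions that is counted;
        \<open>ok\<close> consults it only on increasing lists from \<kappa>.\<close>
      let ?G = "restrict (\<lambda>l. f (map (x y) l @ [y])) (lists \<kappa>)"
      have "ok (\<lambda>l. f (map (x y) l @ [y])) (x y) i = ok ?G (x y) i" for i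
        by (rule ok_cong) (auto simp: incr_def)
      then have "\<forall>i. x y i = (LEAST z. ok ?G (x y) i z)" using x by metis
      then have "seq ?G = x y"
        unfolding seq_def using seq_unique by (intro the1_equality) auto
      moreover have "?G \<in> ?P" using C by auto
      ultimately show "y \<in> (\<lambda>(i, G). seq G i) ` (\<kappa> \<times> ?P)"
        using i by (intro image_eqI[of _ _ "(i, ?G)"]) auto
    qed
    then show False using big card_of_image card_of_mono1 ordLeq_transitive by blast
  qed
  then obtain y where y: "y \<in> X" "y \<notin> x y ` \<kappa>" by blast
  let ?G = "\<lambda>l. f (map (x y) l @ [y])"
  have step: "ok ?G (x y) i (x y i) \<and> x y i < y" if "i \<in> \<kappa>" for i
    using that
  proof (induction i rule: less_induct)
    case (less i)
    \<comment> \<open>\<open>y\<close> itself is always admissible, so the least admissible element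
      exists and is at most \<open>y\<close>; equality is excluded by the choice of
      \<open>y\<close>.\<close>
    then have "ok ?G (x y) i y" using y by (simp add: ok_def)
    then have "ok ?G (x y) i (x y i)" "x y i \<le> y"
      using LeastI[of "ok ?G (x y) i" y] Least_le[of "ok ?G (x y) i" y] unfolding x[of y i, symmetric]
      by simp_all
    then show ?case using y less.prems by (metis imageI order_le_less)
  qed
  have mono: "x y i < x y j" if "i \<in> \<kappa>" "j \<in> \<kappa>" "i < j" for i j
    using step[OF that(2)] that unfolding ok_def by blast
  have mono_iff: "x y i < x y j \<longleftrightarrow> i < j" if "i \<in> \<kappa>" "j \<in> \<kappa>" for i j
    using mono that by (metis less_asym less_irrefl linorder_neqE)
  have inj: "inj_on (x y) \<kappa>"
    using mono_iff by (metis inj_onI less_irrefl linorder_neqE)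
  have "f (l @ [z]) = f (l @ [y])"
    if l: "l \<in> incr m (x y ` \<kappa>)" and z: "z \<in> x y ` \<kappa>" and lz: "\<forall>w\<in>set l. w < z" for l z
  proof -
    from l have "set l \<subseteq> x y ` \<kappa>" by (simp add: incr_def)
    then obtain l' where l': "l = map (x y) l'" "set l' \<subseteq> \<kappa>"
      by (metis (mono_tags, lifting) lists_eq_set lists_image mem_Collect_eq imageE)
    obtain i where i: "i \<in> \<kappa>" "z = x y i" using z by blast
    have "sorted_wrt (\<lambda>i j. x y i < x y j) l'"
      using l by (simp add: incr_def l' sorted_wrt_map)
    then have "sorted_wrt (<) l'"
      by (rule sorted_wrt_mono_rel[rotated]) (use l' mono_iff in blast)
    moreover have "set l' \<subseteq> \<kappa> \<inter> {..<i}"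
      using lz l' i mono_iff by auto
    ultimately have "l' \<in> incr m (\<kappa> \<inter> {..<i})"
      using l by (simp add: incr_def l')
    then show ?thesis using step[OF i(1)] unfolding ok_def l' i by blast
  qed
  moreover have "x y ` \<kappa> \<subseteq> X" using step unfolding ok_def by blast
  moreover have "|\<kappa>| \<le>o |x y ` \<kappa>|" using inj card_of_ordLeq by blast
  ultimately show ?thesis by blast
qed

section \<open>Erdos--Rado and templates of indiscernibles\<close>

context inaccessible
begin

lemma small_iso_wo:
  assumes "small A"
  obtains B :: "'u wo set" where "|A| \<le>o |B|" "small B"
proof -
  obtain B :: "'u set" where B: "|A| =o |B|" "small B" using small_iso[OF assms] .
  have "|B| \<le>o |Abs_wo ` B|"
    by (rule card_of_ordLeqI[of Abs_wo]) (auto simp: inj_on_def Abs_wo_inject)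
  then show ?thesis
    using that[of "Abs_wo ` B"] B small_image ordIso_ordLeq_trans by blast
qed

text \<open>Induction on the length of tuples: on an end-homogeneous set, colouring (m+1)-lists
  amounts to colouring m-lists \<open>l\<close> by \<open>f (l @ [y])\<close>. The bound \<kappa> is
  fixed before \<open>X\<close> and \<open>f\<close>, a uniformity on which the refinement of
  families relies.\<close>

lemma erdos_rado:
  assumes "small C" "small (\<nu> :: 'u wo set)"
  shows "\<exists>\<kappa> :: 'u wo set. small \<kappa> \<and> (\<forall>X :: 'x::wellorder set. \<forall>f. |\<kappa>| \<le>o |X| \<longrightarrow> (\<forall>l. f l \<in> C) \<longrightarrow>
    (\<exists>H\<subseteq>X. |\<nu>| \<le>o |H| \<and> (\<exists>c\<in>C. \<forall>l\<in>incr m H. f l = c)))"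
proof (induction m)
  case 0
  show ?case
    by (intro exI[of _ \<nu>]) (auto simp: assms incr_def)
next
  case (Suc m)
  then obtain \<kappa> :: "'u wo set" where \<kappa>: "small \<kappa>"
    and IH: "\<And>(X :: 'x set) f. |\<kappa>| \<le>o |X| \<Longrightarrow> (\<And>l. f l \<in> C) \<Longrightarrow>
      \<exists>H\<subseteq>X. |\<nu>| \<le>o |H| \<and> (\<exists>c\<in>C. \<forall>l\<in>incr m H. f l = c)" by blast
  let ?Y = "\<kappa> \<times> PiE (lists \<kappa>) (\<lambda>_. C)"
  \<comment> \<open>One power set beyond the bound in \<open>end_homogeneous\<close>: by Cantor,
    sets of size at least \<kappa>' exceed that bound.\<close>
  have "small (Pow ?Y)"
    using \<kappa> assms(1) by (intro small_Pow small_Times small_PiE small_lists)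
  then obtain \<kappa>' :: "'u wo set" where \<kappa>': "|Pow ?Y| \<le>o |\<kappa>'|" "small \<kappa>'"
    using small_iso_wo by blast
  have "\<exists>H\<subseteq>X. |\<nu>| \<le>o |H| \<and> (\<exists>c\<in>C. \<forall>l\<in>incr (Suc m) H. f l = c)"
    if X: "|\<kappa>'| \<le>o |X|" and f: "\<And>l. f l \<in> C" for X :: "'x set" and f
  proof -
    have "\<not> |X| \<le>o |?Y|"
      using X \<kappa>'(1) card_of_Pow[of ?Y] by (meson not_ordLess_ordLeq ordLeq_transitive)
    from end_homogeneous[of f C X \<kappa> m, OF f this]
    obtain H' y where H': "H' \<subseteq> X" "|\<kappa>| \<le>o |H'|"
      and eh: "\<forall>l\<in>incr m H'. \<forall>z\<in>H'. (\<forall>w\<in>set l. w < z) \<longrightarrow> f (l @ [z]) = f (l @ [y])"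
      by (elim exE conjE)
    obtain H c where H: "H \<subseteq> H'" "|\<nu>| \<le>o |H|" "c \<in> C" "\<And>l. l \<in> incr m H \<Longrightarrow> f (l @ [y]) = c"
      using IH[OF H'(2), of "\<lambda>l. f (l @ [y])"] f by blast
    have "f l = c" if "l \<in> incr (Suc m) H" for l
    proof -
      from that obtain l' z where l: "l = l' @ [z]"
        by (cases l rule: rev_cases) (auto simp: incr_def)
      with that have "l' \<in> incr m H" "z \<in> H" "\<forall>w\<in>set l'. w < z"
        by (auto simp: incr_def sorted_wrt_append)
      then show ?thesis using eh H incr_mono[OF H(1)] l by (metis subsetD)
    qed
    then show ?thesis
      using H H' by (intro exI[of _ H] conjI bexI[of _ c]) auto
  qed
  then show ?case using \<kappa>'(2) by blast
qed

text \<open>No single set need be homogeneous for tuples of all lengths. The construction therefore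
  carries a family with members at least as large as any given small set, and passes to subsets once
  per length.\<close>

definition big :: "'x set set \<Rightarrow> bool" where
  "big \<F> \<longleftrightarrow> (\<forall>\<nu> :: 'u wo set. small \<nu> \<longrightarrow> (\<exists>H\<in>\<F>. |\<nu>| \<le>o |H| ))"

text \<open>If every colour failed at some small size \<open>\<nu> c\<close>, the union of these
  sets would be small, as there are few colours; Erdos--Rado at that size yields a homogeneous
  subset whose colour cannot have failed.\<close>

lemma big_refine:
  fixes \<F> :: "'x::wellorder set set"
  assumes "big \<F>" "small C" "\<And>l. f l \<in> C"
  shows "\<exists>c. big {H. (\<exists>H0\<in>\<F>. H \<subseteq> H0) \<and> (\<forall>l\<in>incr m H. f l = c)}"
proof (rule ccontr)
  assume "\<not> ?thesis"
  then have neg: "\<not> big {H. (\<exists>H0\<in>\<F>. H \<subseteq> H0) \<and> (\<forall>l\<in>incr m H. f l = c)}" for c by simp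
  have "\<forall>c. \<exists>\<nu> :: 'u wo set. small \<nu> \<and>
      (\<forall>H. (\<exists>H0\<in>\<F>. H \<subseteq> H0) \<longrightarrow> (\<forall>l\<in>incr m H. f l = c) \<longrightarrow> \<not> |\<nu>| \<le>o |H| )"
  proof
    fix c
    have "\<exists>\<nu> :: 'u wo set. \<not> (small \<nu> \<longrightarrow>
        (\<exists>H\<in>{H. (\<exists>H0\<in>\<F>. H \<subseteq> H0) \<and> (\<forall>l\<in>incr m H. f l = c)}. |\<nu>| \<le>o |H| ))"
      using neg[of c] unfolding big_def not_all .
    then obtain \<nu> :: "'u wo set" where "small \<nu>"
      "\<not> (\<exists>H\<in>{H. (\<exists>H0\<in>\<F>. H \<subseteq> H0) \<and> (\<forall>l\<in>incr m H. f l = c)}. |\<nu>| \<le>o |H| )"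
      by blast
    then show "\<exists>\<nu> :: 'u wo set. small \<nu> \<and>
      (\<forall>H. (\<exists>H0\<in>\<F>. H \<subseteq> H0) \<longrightarrow> (\<forall>l\<in>incr m H. f l = c) \<longrightarrow> \<not> |\<nu>| \<le>o |H| )"
      by (intro exI[of _ \<nu>]) blast
  qed
  then obtain \<nu> :: "_ \<Rightarrow> 'u wo set" where \<nu>: "\<And>c. small (\<nu> c)"
    "\<And>c H. \<exists>H0\<in>\<F>. H \<subseteq> H0 \<Longrightarrow> \<forall>l\<in>incr m H. f l = c \<Longrightarrow> \<not> |\<nu> c| \<le>o |H|" by metis
  define \<Lambda> where "\<Lambda> = (\<Union>c\<in>C. \<nu> c)"
  have "small \<Lambda>" unfolding \<Lambda>_def by (rule small_UN[OF assms(2) \<nu>(1)])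
  from erdos_rado[OF assms(2) this, of m]
  obtain \<kappa> :: "'u wo set" where \<kappa>: "small \<kappa>" and
    er: "\<And>(X :: 'x set). |\<kappa>| \<le>o |X| \<Longrightarrow> \<exists>H\<subseteq>X. |\<Lambda>| \<le>o |H| \<and> (\<exists>c\<in>C. \<forall>l\<in>incr m H. f l = c)"
    using assms(3) by blast
  obtain H0 where "H0 \<in> \<F>" "|\<kappa>| \<le>o |H0|" using \<kappa> assms(1) unfolding big_def by blast
  with er obtain H c where H: "H \<subseteq> H0" "|\<Lambda>| \<le>o |H|" "c \<in> C" "\<forall>l\<in>incr m H. f l = c" by blast
  then have "|\<nu> c| \<le>o |H|"
    unfolding \<Lambda>_def using ordLeq_transitive card_of_mono1[of "\<nu> c" "\<Union>c\<in>C. \<nu> c"] by blast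
  then show False using \<nu>(2)[of H c] H \<open>H0 \<in> \<F>\<close> by blast
qed

text \<open>The families \<open>F n\<close> are refined once per length, so that n-tuples from
  members of \<open>F (Suc n)\<close> share one colour \<open>c n\<close>. Any increasing m-tuple of
  a member of \<open>F (Suc m)\<close> then serves as \<open>h m\<close>; tuples \<open>h m\<close>
  for different \<open>m\<close> need not extend one another.\<close>

lemma template_wellorder:
  fixes X :: "'x::wellorder set"
  assumes "\<not> small X" "small C" "\<And>l. f l \<in> C"
  shows "\<exists>h. \<forall>m. h m \<in> incr m X \<and>
    (\<forall>ps. ps \<in> incr (length ps) {..<m} \<longrightarrow> f (map ((!) (h m)) ps) = f (h (length ps)))"
proof -
  have X: "big (Pow X)"
    unfolding big_def using assms(1) not_small_ordLess ordLess_imp_ordLeq by blast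
  have "\<exists>F. \<forall>n. (big (F n) \<and> F n \<subseteq> Pow X) \<and>
      (\<exists>c. \<forall>H\<in>F (Suc n). (\<exists>H0\<in>F n. H \<subseteq> H0) \<and> (\<forall>l\<in>incr n H. f l = c))"
  proof (rule dependent_nat_choice)
    fix \<F> :: "'x set set" and n
    assume \<F>: "big \<F> \<and> \<F> \<subseteq> Pow X"
    from big_refine[of \<F> C f n] assms \<F>
    obtain c where "big {H. (\<exists>H0\<in>\<F>. H \<subseteq> H0) \<and> (\<forall>l\<in>incr n H. f l = c)}" by blast
    then show "\<exists>\<F>'. (big \<F>' \<and> \<F>' \<subseteq> Pow X) \<and>
        (\<exists>c. \<forall>H\<in>\<F>'. (\<exists>H0\<in>\<F>. H \<subseteq> H0) \<and> (\<forall>l\<in>incr n H. f l = c))"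
      using \<F> by (intro exI[of _ "{H. (\<exists>H0\<in>\<F>. H \<subseteq> H0) \<and> (\<forall>l\<in>incr n H. f l = c)}"]) blast
  qed (use X in blast)
  then obtain F c where F: "\<And>n. big (F n)" "\<And>n. F n \<subseteq> Pow X"
    "\<And>n H. H \<in> F (Suc n) \<Longrightarrow> \<exists>H0\<in>F n. H \<subseteq> H0"
    "\<And>n H l. H \<in> F (Suc n) \<Longrightarrow> l \<in> incr n H \<Longrightarrow> f l = c n" by metis
  have down: "\<exists>H0\<in>F (Suc j). H \<subseteq> H0" if "H \<in> F (Suc n)" "j \<le> n" for H n j
    using that
  proof (induction n arbitrary: H)
    case (Suc n)
    show ?case
    proof (cases "j = Suc n")
      case False
      obtain H1 where "H1 \<in> F (Suc n)" "H \<subseteq> H1" using F(3)[OF Suc.prems(1)] by blast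
      with Suc.IH[of H1] Suc.prems False show ?thesis by (meson le_SucE subset_trans)
    qed (use Suc.prems in blast)
  qed auto
  obtain N :: "'u wo set" where N: "|UNIV :: nat set| \<le>o |N|" "small N"
    using small_iso_wo[OF small_countable[of "UNIV :: nat set"]] by auto
  have "\<exists>H l. H \<in> F (Suc m) \<and> l \<in> incr m H" for m
  proof -
    obtain H where H: "H \<in> F (Suc m)" "|N| \<le>o |H|" using F(1) N(2) unfolding big_def by blast
    then have "infinite H"
      using N(1) infinite_iff_card_of_nat ordLeq_transitive by blast
    then obtain T where "finite T" "card T = m" "T \<subseteq> H"
      using infinite_arbitrarily_large by blast
    then have "sorted_list_of_set T \<in> incr m H"
      by (simp add: incr_def)
    then show ?thesis using H by blast
  qed
  then obtain H h where h: "\<And>m. H m \<in> F (Suc m)" "\<And>m. h m \<in> incr m (H m)" by metis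
  have "f (map ((!) (h m)) ps) = f (h (length ps))" if ps: "ps \<in> incr (length ps) {..<m}" for m ps
  proof -
    have hm: "sorted_wrt (<) (h m)" "length (h m) = m" "set (h m) \<subseteq> H m"
      using h(2)[of m] by (auto simp: incr_def)
    have "sorted_wrt (<) ps" "set ps \<subseteq> {..<m}" using ps by (auto simp: incr_def)
    have "sorted_wrt (<) (map ((!) (h m)) ps)"
      unfolding sorted_wrt_map
    proof (rule sorted_wrt_mono_rel[rotated, OF \<open>sorted_wrt (<) ps\<close>])
      fix i j assume "i \<in> set ps" "j \<in> set ps" "i < j"
      then show "h m ! i < h m ! j"
        using sorted_wrt_nth_less[OF hm(1)] hm(2) \<open>set ps \<subseteq> {..<m}\<close> by auto
    qed
    then have "map ((!) (h m)) ps \<in> incr (length ps) (H m)"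
      using hm ps by (force simp: incr_def)
    moreover have "length ps \<le> m"
      using ps card_mono[of "{..<m}" "set ps"] strict_sorted_iff
      by (metis (mono_tags, lifting) card_lessThan distinct_card finite_lessThan incr_def mem_Collect_eq)
    then obtain H0 where "H0 \<in> F (Suc (length ps))" "H m \<subseteq> H0"
      using down[OF h(1)] by blast
    ultimately have "f (map ((!) (h m)) ps) = c (length ps)"
      using F(4) incr_mono by blast
    then show ?thesis using F(4)[OF h(1) h(2)] by simp
  qed
  moreover have "h m \<in> incr m X" for m
    using h[of m] F(2)[of "Suc m"] incr_mono[of "H m" X m] by blast
  ultimately show ?thesis by (intro exI[of _ h] allI conjI impI)
qed

text \<open>The order on \<open>X\<close> is auxiliary; all that is kept of it is that the entries
  of \<open>h m\<close> are distinct.\<close>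

lemma template:
  fixes X :: "'x set"
  assumes "\<not> small X" "small C" "\<And>l. f l \<in> C"
  shows "\<exists>h. \<forall>m. set (h m) \<subseteq> X \<and> length (h m) = m \<and> distinct (h m) \<and>
    (\<forall>ps. ps \<in> incr (length ps) {..<m} \<longrightarrow> f (map ((!) (h m)) ps) = f (h (length ps)))"
proof -
  have "\<not> small (Abs_wo ` X)"
    using assms(1) small_inj[of Abs_wo X "Abs_wo ` X"] by (auto simp: inj_on_def Abs_wo_inject)
  from template_wellorder[OF this assms(2), of "\<lambda>l. f (map Rep_wo l)", OF assms(3)]
  obtain h where h: "\<And>m. h m \<in> incr m (Abs_wo ` X)" and
    f: "\<And>m ps. ps \<in> incr (length ps) {..<m} \<Longrightarrow>
      f (map Rep_wo (map ((!) (h m)) ps)) = f (map Rep_wo (h (length ps)))" by blast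
  have hm: "length (h m) = m" "set (h m) \<subseteq> Abs_wo ` X" "distinct (h m)" for m
    using h[of m] by (auto simp: incr_def strict_sorted_iff)
  show ?thesis
  proof (intro exI[of _ "\<lambda>m. map Rep_wo (h m)"] allI conjI impI)
    fix m
    show "set (map Rep_wo (h m)) \<subseteq> X" using hm(2)[of m] by (auto simp: Abs_wo_inverse)
    show "length (map Rep_wo (h m)) = m" using hm by simp
    show "distinct (map Rep_wo (h m))"
      using hm by (simp add: distinct_map inj_on_def Rep_wo_inject)
    fix ps assume ps: "ps \<in> incr (length ps) {..<m}"
    then have "map ((!) (map Rep_wo (h m))) ps = map Rep_wo (map ((!) (h m)) ps)"
      using hm by (auto simp: incr_def)
    then show "f (map ((!) (map Rep_wo (h m))) ps) = f (map Rep_wo (h (length ps)))"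
      using f[OF ps] by (simp only:)
  qed
qed

end

section \<open>Structures and isomorphisms\<close>

lemma fdom_mono: "X \<subseteq> Y \<Longrightarrow> fdom L X \<subseteq> fdom L Y"
  using nlists_mono unfolding fdom_def by blast

lemma rdom_mono: "X \<subseteq> Y \<Longrightarrow> rdom L X r \<subseteq> rdom L Y r"
  unfolding rdom_def nlists_def by auto

lemma fdom_image: "(f, xs) \<in> fdom L X \<Longrightarrow> (f, map h xs) \<in> fdom L (h ` X)"
  by (auto simp: fdom_def nlists_def)

lemma fdom_imageE:
  assumes "(f, ys) \<in> fdom L (h ` X)"
  obtains xs where "(f, xs) \<in> fdom L X" "ys = map h xs"
proof -
  have "ys \<in> lists (h ` X)" using assms by (auto simp: fdom_def nlists_def)
  then obtain xs where "xs \<in> lists X" "ys = map h xs" unfolding lists_image by blast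
  then show ?thesis using assms that by (auto simp: fdom_def nlists_def)
qed

lemma rdom_image: "xs \<in> rdom L X r \<Longrightarrow> map h xs \<in> rdom L (h ` X) r"
  by (auto simp: rdom_def nlists_def split: if_splits)

lemma rdom_imageE:
  assumes "ys \<in> rdom L (h ` X) r"
  obtains xs where "xs \<in> rdom L X r" "ys = map h xs"
proof -
  have "ys \<in> lists (h ` X)" using assms by (auto simp: rdom_def nlists_def split: if_splits)
  then obtain xs where "xs \<in> lists X" "ys = map h xs" unfolding lists_image by blast
  then show ?thesis using assms that by (auto simp: rdom_def nlists_def split: if_splits)
qed

lemma fdom_set: "(f, xs) \<in> fdom L X \<Longrightarrow> set xs \<subseteq> X"
  by (auto simp: fdom_def nlists_def)

lemma rdom_set: "xs \<in> rdom L X r \<Longrightarrow> set xs \<subseteq> X"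
  by (auto simp: rdom_def nlists_def split: if_splits)

lemma univ_restr [simp]: "univ (restr L A X) = X"
  by (simp add: restr_def)

lemma fint_restr: "(f, xs) \<in> fdom L X \<Longrightarrow> fint (restr L A X) f xs = fint A f xs"
  by (simp add: restr_def)

lemma rint_restr: "rint (restr L A X) r = rint A r \<inter> rdom L X r"
  by (simp add: restr_def)

lemma restr_restr: "Y \<subseteq> X \<Longrightarrow> restr L (restr L A X) Y = restr L A Y"
  using fdom_mono[of Y X L] rdom_mono[of Y X L] by (auto simp: restr_def intro!: ext)

lemma is_struct_fint: "is_struct L A \<Longrightarrow> (f, xs) \<in> fdom L (univ A) \<Longrightarrow> fint A f xs \<in> univ A"
  by (simp add: is_struct_def)

lemma is_struct_rint: "is_struct L A \<Longrightarrow> rint A r \<subseteq> rdom L (univ A) r"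
  by (simp add: is_struct_def)

lemma is_struct_eqI:
  assumes "is_struct L A" "is_struct L B" "univ A = univ B"
    and "\<And>f xs. (f, xs) \<in> fdom L (univ A) \<Longrightarrow> fint A f xs = fint B f xs"
    and "\<And>r xs. xs \<in> rdom L (univ A) r \<Longrightarrow> xs \<in> rint A r \<longleftrightarrow> xs \<in> rint B r"
  shows "A = B"
proof -
  have "fint A f xs = fint B f xs" for f xs
    using assms by (cases "(f, xs) \<in> fdom L (univ A)") (auto simp: is_struct_def)
  moreover have "rint A r = rint B r" for r
    using assms(5) is_struct_rint[OF assms(1), of r] is_struct_rint[OF assms(2), of r] assms(3) by auto
  ultimately show ?thesis
    using assms(3) by (intro struct.equality ext) auto
qed

lemma restr_univ: "is_struct L A \<Longrightarrow> restr L A (univ A) = A"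
  by (rule is_struct_eqI[of L]) (auto simp: is_struct_def restr_def)

lemma is_struct_restr_iff:
  assumes "is_struct L A" "X \<subseteq> univ A"
  shows "is_struct L (restr L A X) \<longleftrightarrow> (\<forall>f xs. (f, xs) \<in> fdom L X \<longrightarrow> fint A f xs \<in> X)"
  using assms by (auto simp: is_struct_def restr_def)

lemma iso_bij: "iso L h A B \<Longrightarrow> bij_betw h (univ A) (univ B)"
  by (simp add: iso_def)

lemma iso_image: "iso L h A B \<Longrightarrow> h ` univ A = univ B"
  by (simp add: iso_def bij_betw_def)

lemma iso_inj: "iso L h A B \<Longrightarrow> inj_on h (univ A)"
  by (simp add: iso_def bij_betw_def)

lemma iso_cong:
  assumes "iso L h A B" "\<And>x. x \<in> univ A \<Longrightarrow> h x = h' x" "is_struct L A"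
  shows "iso L h' A B"
proof -
  have *: "map h xs = map h' xs" if "set xs \<subseteq> univ A" for xs
    using assms(2) that by auto
  show ?thesis
    unfolding iso_def
  proof (intro conjI allI impI ballI)
    show "bij_betw h' (univ A) (univ B)"
      using iso_bij[OF assms(1)] bij_betw_cong assms(2) by blast
    show "h' (fint A f xs) = fint B f (map h' xs)" if "(f, xs) \<in> fdom L (univ A)" for f xs
      using that assms(1) *[OF fdom_set[OF that]] assms(2)[OF is_struct_fint[OF assms(3) that]]
      unfolding iso_def by metis
    show "xs \<in> rint A r \<longleftrightarrow> map h' xs \<in> rint B r" if "xs \<in> rdom L (univ A) r" for r xs
      using that assms(1) *[OF rdom_set[OF that]] unfolding iso_def by metis
  qed
qed

lemma iso_id: "iso L id A A"
  by (simp add: iso_def)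

lemma iso_comp:
  assumes "iso L h A B" "iso L g B C"
  shows "iso L (g \<circ> h) A C"
  unfolding iso_def
proof (intro conjI allI impI ballI)
  show "bij_betw (g \<circ> h) (univ A) (univ C)"
    using assms bij_betw_trans iso_bij by blast
next
  fix f xs assume "(f, xs) \<in> fdom L (univ A)"
  then show "(g \<circ> h) (fint A f xs) = fint C f (map (g \<circ> h) xs)"
    using assms fdom_image[of f xs L "univ A" h] iso_image[OF assms(1)] by (simp add: iso_def)
next
  fix r xs assume "xs \<in> rdom L (univ A) r"
  then show "xs \<in> rint A r \<longleftrightarrow> map (g \<circ> h) xs \<in> rint C r"
    using assms rdom_image[of xs L "univ A" r h] iso_image[OF assms(1)] by (simp add: iso_def)
qed

lemma map_inv_into:
  assumes "inj_on h X" "set xs \<subseteq> X"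
  shows "map (inv_into X h) (map h xs) = xs"
  unfolding map_map by (rule map_idI) (use assms in auto)

lemma iso_inv:
  assumes "iso L h A B" "is_struct L A"
  shows "iso L (inv_into (univ A) h) B A"
  unfolding iso_def
proof (intro conjI allI impI ballI)
  let ?k = "inv_into (univ A) h"
  note inj = iso_inj[OF assms(1)]
  show "bij_betw ?k (univ B) (univ A)"
    using assms by (intro bij_betw_inv_into iso_bij)
  have k: "map ?k (map h xs) = xs" if "set xs \<subseteq> univ A" for xs
    using that inj by (rule map_inv_into[rotated])
  fix f ys assume "(f, ys) \<in> fdom L (univ B)"
  then obtain xs where xs: "(f, xs) \<in> fdom L (univ A)" "ys = map h xs"
    using iso_image[OF assms(1)] fdom_imageE by metis
  then have "fint B f ys = h (fint A f xs)" using assms(1) by (simp add: iso_def)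
  then show "?k (fint B f ys) = fint A f (map ?k ys)"
    using k[OF fdom_set[OF xs(1)]] xs inj is_struct_fint[OF assms(2) xs(1)] by simp
next
  let ?k = "inv_into (univ A) h"
  note inj = iso_inj[OF assms(1)]
  have k: "map ?k (map h xs) = xs" if "set xs \<subseteq> univ A" for xs
    using that inj by (rule map_inv_into[rotated])
  fix r ys assume "ys \<in> rdom L (univ B) r"
  then obtain xs where xs: "xs \<in> rdom L (univ A) r" "ys = map h xs"
    using iso_image[OF assms(1)] rdom_imageE by metis
  then show "ys \<in> rint B r \<longleftrightarrow> map ?k ys \<in> rint A r"
    using assms(1) k[OF rdom_set[OF xs(1)]] by (simp add: iso_def)
qed

lemma iso_restr:
  assumes "iso L h A B" "is_struct L A" "is_struct L B" "Y \<subseteq> univ A" "is_struct L (restr L A Y)"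
  shows "iso L h (restr L A Y) (restr L B (h ` Y))" "is_struct L (restr L B (h ` Y))"
proof -
  have Y: "(f, xs) \<in> fdom L Y \<Longrightarrow> fint A f xs \<in> Y" for f xs
    using assms is_struct_restr_iff by blast
  have f: "h (fint A f xs) = fint B f (map h xs)" if "(f, xs) \<in> fdom L Y" for f xs
    using that assms(1) fdom_mono[OF assms(4)] by (auto simp: iso_def)
  have r: "xs \<in> rint A r \<longleftrightarrow> map h xs \<in> rint B r" if "xs \<in> rdom L Y r" for r xs
    using that assms(1) subsetD[OF rdom_mono[OF assms(4)] that] by (simp add: iso_def)
  have sub: "h ` Y \<subseteq> univ B" using iso_image[OF assms(1)] assms(4) by blast
  show "iso L h (restr L A Y) (restr L B (h ` Y))"
    unfolding iso_def
  proof (intro conjI allI impI ballI)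
    show "bij_betw h (univ (restr L A Y)) (univ (restr L B (h ` Y)))"
      using iso_inj[OF assms(1)] assms(4) by (auto simp: bij_betw_def inj_on_subset)
  qed (use r in \<open>auto simp: fint_restr rint_restr f fdom_image rdom_image\<close>)
  show "is_struct L (restr L B (h ` Y))"
    unfolding is_struct_restr_iff[OF assms(3) sub]
  proof (intro allI impI)
    fix f ys assume "(f, ys) \<in> fdom L (h ` Y)"
    then obtain xs where "(f, xs) \<in> fdom L Y" "ys = map h xs" by (rule fdom_imageE)
    then show "fint B f ys \<in> h ` Y" using f[of f xs] Y by (metis imageI)
  qed
qed

text \<open>Serves to recognise one stretched model as the restriction of another.\<close>

lemma iso_target_unique:
  assumes "iso L h A B" "iso L h A B'" "is_struct L B" "is_struct L B'"
  shows "B = B'"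
proof (rule is_struct_eqI[OF assms(3,4)])
  show "univ B = univ B'" using iso_image assms by metis
  fix f ys assume "(f, ys) \<in> fdom L (univ B)"
  then obtain xs where "(f, xs) \<in> fdom L (univ A)" "ys = map h xs"
    using iso_image[OF assms(1)] fdom_imageE by metis
  then show "fint B f ys = fint B' f ys" using assms unfolding iso_def by metis
next
  fix r ys assume "ys \<in> rdom L (univ B) r"
  then obtain xs where "xs \<in> rdom L (univ A) r" "ys = map h xs"
    using iso_image[OF assms(1)] rdom_imageE by metis
  then show "ys \<in> rint B r \<longleftrightarrow> ys \<in> rint B' r" using assms unfolding iso_def by metis
qed

text \<open>Transport of structure along an injection. Countable models are renamed by it so that
  they fit together by inclusions.\<close>

definition push :: "('f, 'r) lang \<Rightarrow> ('u \<Rightarrow> 'u) \<Rightarrow> ('u, 'f, 'r) struct \<Rightarrow> ('u, 'f, 'r) struct" where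
  "push L h A =
     \<lparr>univ = h ` univ A,
      fint = (\<lambda>f ys. if (f, ys) \<in> fdom L (h ` univ A)
               then h (fint A f (map (inv_into (univ A) h) ys)) else undefined),
      rint = (\<lambda>r. map h ` rint A r)\<rparr>"

lemma univ_push [simp]: "univ (push L h A) = h ` univ A"
  by (simp add: push_def)

lemma push_iso:
  assumes "is_struct L A" "inj_on h (univ A)"
  shows "is_struct L (push L h A)" "iso L h A (push L h A)"
proof -
  have k: "map (inv_into (univ A) h) (map h xs) = xs" if "set xs \<subseteq> univ A" for xs
    using that assms(2) by (rule map_inv_into[rotated])
  have f: "fint (push L h A) f (map h xs) = h (fint A f xs)" if "(f, xs) \<in> fdom L (univ A)" for f xs
    unfolding push_def using fdom_image[OF that, of h] by (simp only: k[OF fdom_set[OF that]] struct.simps if_True)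
  show "is_struct L (push L h A)"
    unfolding is_struct_def
  proof (intro conjI allI impI)
    fix g ys assume "(g, ys) \<in> fdom L (univ (push L h A))"
    then obtain xs where xs: "(g, xs) \<in> fdom L (univ A)" "ys = map h xs"
      unfolding univ_push by (rule fdom_imageE)
    then show "fint (push L h A) g ys \<in> univ (push L h A)"
      using f is_struct_fint[OF assms(1)] by simp
  next
    fix r show "rint (push L h A) r \<subseteq> rdom L (univ (push L h A)) r"
      using is_struct_rint[OF assms(1)] rdom_image by (force simp: push_def)
  qed (simp add: push_def)
  show "iso L h A (push L h A)"
    unfolding iso_def
  proof (intro conjI allI impI ballI)
    show "bij_betw h (univ A) (univ (push L h A))" using assms(2) by (simp add: bij_betw_def)
    fix r xs assume xs: "xs \<in> rdom L (univ A) r"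
    have "xs \<in> rint A r" if "map h xs = map h ys" "ys \<in> rint A r" for ys
    proof -
      have "set ys \<subseteq> univ A" using rdom_set[OF subsetD[OF is_struct_rint[OF assms(1)] that(2)]] .
      then show ?thesis using k that rdom_set[OF xs] by metis
    qed
    then show "xs \<in> rint A r \<longleftrightarrow> map h xs \<in> rint (push L h A) r"
      by (auto simp: push_def)
  qed (simp add: f)
qed

section \<open>Abstract elementary classes\<close>

locale aec_class =
  fixes K :: "('u, 'f, 'r) aec"
  assumes aec: "AEC_LS_omega K"
begin

abbreviation L where "L \<equiv> lang K"

text \<open>\<open>is_model\<close> without its bound on the size, so that M itself counts as a
  model inside M'.\<close>

definition model_in :: "('u, 'f, 'r) struct \<Rightarrow> 'u set \<Rightarrow> bool" where
  "model_in N Y \<longleftrightarrow> Y \<subseteq> univ N \<and> le K (restr L N Y) N"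

lemma aec_axioms:
  "\<forall>A\<in>mods K. is_struct L A"
  "\<forall>A B. le K A B \<longrightarrow> A \<in> mods K \<and> B \<in> mods K"
  "\<forall>A\<in>mods K. \<forall>B h. is_struct L B \<and> iso L h A B \<longrightarrow> B \<in> mods K"
  "\<forall>A B A' B' h. le K A B \<and> is_struct L A' \<and> is_struct L B' \<and>
     iso L h B B' \<and> substruct L A' B' \<and> univ A' = h ` univ A \<longrightarrow> le K A' B'"
  "\<forall>A B. le K A B \<longrightarrow> substruct L A B"
  "\<forall>A\<in>mods K. le K A A"
  "\<forall>A B C. le K A B \<and> le K B C \<longrightarrow> le K A C"
  "\<forall>C. is_chain K C \<longrightarrow>
     chain_union L C \<in> mods K \<and> (\<forall>A\<in>C. le K A (chain_union L C)) \<and>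
     (\<forall>B. (\<forall>A\<in>C. le K A B) \<longrightarrow> le K (chain_union L C) B)"
  "\<forall>A B C. le K A C \<and> le K B C \<and> substruct L A B \<longrightarrow> le K A B"
  "LS_property K natLeq"
  using aec unfolding AEC_LS_omega_def by - (elim conjE, assumption)+

lemma mods_struct: "A \<in> mods K \<Longrightarrow> is_struct L A"
  using aec_axioms(1) by blast

lemma le_mods: "le K A B \<Longrightarrow> A \<in> mods K \<and> B \<in> mods K"
  using aec_axioms(2) by blast

lemma iso_mods: "A \<in> mods K \<Longrightarrow> is_struct L B \<Longrightarrow> iso L h A B \<Longrightarrow> B \<in> mods K"
  using aec_axioms(3) by blast

lemma le_iso:
  "le K A B \<Longrightarrow> is_struct L A' \<Longrightarrow> is_struct L B' \<Longrightarrow> iso L h B B' \<Longrightarrow> substruct L A' B' \<Longrightarrow>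
    univ A' = h ` univ A \<Longrightarrow> le K A' B'"
  using aec_axioms(4) by blast

lemma le_substruct: "le K A B \<Longrightarrow> substruct L A B"
  using aec_axioms(5) by blast

lemma le_refl: "A \<in> mods K \<Longrightarrow> le K A A"
  using aec_axioms(6) by blast

lemma le_trans: "le K A B \<Longrightarrow> le K B C \<Longrightarrow> le K A C"
  using aec_axioms(7) by blast

lemma chain_mods: "is_chain K C \<Longrightarrow> chain_union L C \<in> mods K"
  and chain_upper: "is_chain K C \<Longrightarrow> A \<in> C \<Longrightarrow> le K A (chain_union L C)"
  and chain_least: "is_chain K C \<Longrightarrow> (\<And>A. A \<in> C \<Longrightarrow> le K A B) \<Longrightarrow> le K (chain_union L C) B"
  using aec_axioms(8) by blast+

lemma le_coherent: "le K A C \<Longrightarrow> le K B C \<Longrightarrow> substruct L A B \<Longrightarrow> le K A B"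
  using aec_axioms(9) by blast

lemmas LS = aec_axioms(10)

lemma le_univ: "le K A B \<Longrightarrow> univ A \<subseteq> univ B"
  and le_restr: "le K A B \<Longrightarrow> A = restr L B (univ A)"
  using le_substruct unfolding substruct_def by blast+

lemma le_model_in: "le K A B \<Longrightarrow> model_in B (univ A)"
  using le_univ le_restr unfolding model_in_def by metis

lemma model_in_subset: "model_in N Y \<Longrightarrow> Y \<subseteq> univ N"
  by (simp add: model_in_def)

lemma model_in_le: "model_in N Y \<Longrightarrow> le K (restr L N Y) N"
  by (simp add: model_in_def)

lemma model_in_mods: "model_in N Y \<Longrightarrow> restr L N Y \<in> mods K \<and> N \<in> mods K"
  using le_mods model_in_le by blast

lemma model_in_refl: "N \<in> mods K \<Longrightarrow> model_in N (univ N)"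
  using le_model_in le_refl by blast

lemma restr_substruct:
  assumes "is_struct L (restr L N Y)" "is_struct L (restr L N Z)" "Y \<subseteq> Z"
  shows "substruct L (restr L N Y) (restr L N Z)"
  using assms by (simp add: substruct_def restr_restr)

lemma model_in_coherent:
  assumes "model_in N Y" "model_in N Z" "Y \<subseteq> Z"
  shows "le K (restr L N Y) (restr L N Z)"
  using assms model_in_mods[OF assms(1)] model_in_mods[OF assms(2)]
  by (intro le_coherent[OF model_in_le model_in_le] restr_substruct mods_struct) simp_all

lemma model_in_restr:
  assumes "model_in N Y" "model_in N Z" "Y \<subseteq> Z"
  shows "model_in (restr L N Z) Y"
  using model_in_coherent[OF assms] assms by (simp add: model_in_def restr_restr)

lemma le_model_in_trans:
  assumes "le K A B" "model_in A Y"
  shows "model_in B Y" "restr L B Y = restr L A Y"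
proof -
  show *: "restr L B Y = restr L A Y"
    using le_restr[OF assms(1)] model_in_subset[OF assms(2)] restr_restr by metis
  show "model_in B Y"
    using assms le_trans le_univ[OF assms(1)] unfolding model_in_def * by blast
qed

lemma le_model_in_back:
  assumes "le K A B" "model_in B Y" "Y \<subseteq> univ A"
  shows "model_in A Y"
  using model_in_restr[OF assms(2) le_model_in[OF assms(1)] assms(3)] le_restr[OF assms(1)] by simp

lemma elem_emb_iff:
  "elem_emb K h A B \<longleftrightarrow> model_in B (h ` univ A) \<and> iso L h A (restr L B (h ` univ A))"
  by (auto simp: elem_emb_def model_in_def)

text \<open>Closure of the strong submodel relation under isomorphism places the image of
  \<open>Y\<close> in the image of \<open>A\<close>; transitivity carries it on to
  \<open>B\<close>.\<close>

lemma elem_emb_model_in: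
  assumes "elem_emb K h A B" "model_in A Y"
  shows "model_in B (h ` Y)" "iso L h (restr L A Y) (restr L B (h ` Y))"
    "elem_emb K h (restr L A Y) B"
proof -
  let ?R = "restr L B (h ` univ A)"
  have R: "model_in B (h ` univ A)" "iso L h A ?R" "is_struct L ?R"
    using assms(1) elem_emb_iff model_in_mods mods_struct by blast+
  have A: "is_struct L A" "is_struct L (restr L A Y)" "Y \<subseteq> univ A"
    using assms(2) model_in_mods mods_struct model_in_subset by blast+
  note i = iso_restr[OF R(2) A(1) R(3) A(3) A(2)]
  have eq: "restr L ?R (h ` Y) = restr L B (h ` Y)" using A(3) by (simp add: image_mono restr_restr)
  have sub: "substruct L (restr L B (h ` Y)) ?R"
    using i(2) R(3) A(3) unfolding eq by (intro restr_substruct) auto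
  have "le K (restr L B (h ` Y)) ?R"
    by (rule le_iso[OF model_in_le[OF assms(2)] _ R(3) R(2) sub]) (use i(2) eq in auto)
  then show *: "model_in B (h ` Y)"
    using R(1) le_trans A(3) unfolding model_in_def by blast
  show "iso L h (restr L A Y) (restr L B (h ` Y))" using i(1) eq by simp
  then show "elem_emb K h (restr L A Y) B" using * by (simp add: elem_emb_iff)
qed

lemma elem_emb_comp:
  assumes "elem_emb K h A B" "elem_emb K g B C"
  shows "elem_emb K (g \<circ> h) A C"
proof -
  have h: "model_in B (h ` univ A)" "iso L h A (restr L B (h ` univ A))"
    using assms(1) elem_emb_iff by blast+
  note g = elem_emb_model_in[OF assms(2) h(1)]
  show ?thesis
    using g iso_comp[OF h(2) g(2)] by (simp add: elem_emb_iff image_comp)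
qed

lemma elem_emb_inclusion: "model_in N Y \<Longrightarrow> elem_emb K id (restr L N Y) N"
  by (simp add: elem_emb_iff iso_id)

lemma le_elem_emb: "le K A B \<Longrightarrow> elem_emb K id A B"
  using elem_emb_inclusion[OF le_model_in[of A B]] le_restr[of A B] by simp

lemma elem_emb_into:
  assumes "elem_emb K h A B" "model_in B Y" "h ` univ A \<subseteq> Y"
  shows "elem_emb K h A (restr L B Y)"
  using assms model_in_restr[of B "h ` univ A" Y] by (simp add: elem_emb_iff restr_restr)

lemma iso_elem_emb: "iso L h A B \<Longrightarrow> B \<in> mods K \<Longrightarrow> elem_emb K h A B"
  by (simp add: elem_emb_iff iso_image model_in_refl restr_univ mods_struct)

lemma autos_elem_emb: "N \<in> mods K \<Longrightarrow> h \<in> autos L N \<Longrightarrow> elem_emb K h N N"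
  by (simp add: autos_def iso_elem_emb)

lemma elem_emb_inv:
  assumes "elem_emb K h A B" "A \<in> mods K"
  shows "elem_emb K (inv_into (univ A) h) (restr L B (h ` univ A)) A"
  using assms by (intro iso_elem_emb iso_inv mods_struct) (simp_all add: elem_emb_iff)

lemma LS_model:
  assumes "N \<in> mods K" "X \<subseteq> univ N" "|X| \<le>o r" "Cinfinite r"
  obtains Y where "X \<subseteq> Y" "model_in N Y" "|Y| \<le>o r"
proof -
  obtain B where B: "le K B N" "X \<subseteq> univ B" "|univ B| \<le>o |X| +c natLeq"
    using LS assms(1,2) unfolding LS_property_def by blast
  have "|X| +c natLeq \<le>o r"
    using assms natLeq_ordLeq_cinfinite natLeq_Card_order card_of_Card_order
    by (intro csum_cinfinite_bound) auto
  then have "|univ B| \<le>o r" using B(3) ordLeq_transitive by blast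
  then show ?thesis using that B le_model_in by blast
qed

lemma countable_model:
  assumes "N \<in> mods K" "X \<subseteq> univ N" "countable X"
  obtains Y where "X \<subseteq> Y" "model_in N Y" "countable Y"
proof -
  have "|X| \<le>o natLeq"
    using assms(3) card_of_nat by (meson card_of_ordLeq countableE ordLeq_ordIso_trans subset_UNIV)
  then obtain Y where Y: "X \<subseteq> Y" "model_in N Y" "|Y| \<le>o natLeq"
    using LS_model[OF assms(1,2) _ natLeq_Cinfinite] by blast
  then have "countable Y"
    using card_of_nat countable_def
    by (meson card_of_ordLeq ordIso_symmetric ordLeq_ordIso_trans)
  then show ?thesis using that Y by blast
qed

lemma fsyms_countable: "countable (fsyms L)" and rsyms_countable: "countable (rsyms L)"
proof -
  have *: "countable X" if "|X| \<le>o natLeq" for X :: "'z set"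
    using that card_of_nat countable_def
    by (meson card_of_ordLeq ordIso_symmetric ordLeq_ordIso_trans)
  show "countable (fsyms L)" "countable (rsyms L)"
    using LS * unfolding LS_property_def by blast+
qed

end

section \<open>Saturation from homogeneity and universality\<close>

locale homogeneous_model = aec_class +
  fixes N :: "('a, 'b, 'c) struct" and \<kappa> :: "'a rel"
  assumes N: "N \<in> mods K"
    and homogeneous: "model_homogeneous K \<kappa> N"
    and universal: "universal K \<kappa> N"
begin

lemma is_model_iff: "is_model K N \<kappa> X \<longleftrightarrow> model_in N X \<and> |X| <o \<kappa>"
  by (auto simp: is_model_def model_in_def)

lemma extend_to_auto:
  assumes "is_model K N \<kappa> X" "elem_emb K h (restr L N X) N"
  shows "\<exists>g\<in>autos L N. \<forall>x\<in>X. g x = h x"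
proof -
  have "|h ` X| <o \<kappa>"
    by (rule ordLeq_ordLess_trans[OF card_of_image]) (use assms in \<open>simp add: is_model_iff\<close>)
  then have "is_model K N \<kappa> (h ` X)"
    using assms by (simp add: is_model_iff elem_emb_iff)
  moreover have "iso L h (restr L N X) (restr L N (h ` X))"
    using assms by (simp add: elem_emb_iff)
  ultimately show ?thesis
    using homogeneous assms(1) unfolding model_homogeneous_def by blast
qed

lemma auto_inv:
  assumes "g \<in> autos L N"
  shows "inv_into (univ N) g \<in> autos L N"
  using assms iso_inv mods_struct[OF N] by (simp add: autos_def)

text \<open>Universality embeds \<open>Q\<close> without regard to \<open>X\<close>; homogeneity
  provides an automorphism that agrees with this embedding on \<open>X\<close>, and its inverse
  corrects the embedding.\<close>

lemma embed_over:
  assumes "Q \<in> mods K" "|univ Q| <o \<kappa>" "is_model K N \<kappa> X" "elem_emb K f (restr L N X) Q"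
  shows "\<exists>h. elem_emb K h Q N \<and> (\<forall>x\<in>X. h (f x) = x)"
proof -
  obtain h where h: "elem_emb K h Q N" using universal assms(1,2) by (auto simp: universal_def)
  obtain g where g: "g \<in> autos L N" "\<And>x. x \<in> X \<Longrightarrow> g x = h (f x)"
    using extend_to_auto[OF assms(3) elem_emb_comp[OF assms(4) h]] by auto
  let ?k = "inv_into (univ N) g"
  have "elem_emb K (?k \<circ> h) Q N"
    using elem_emb_comp[OF h autos_elem_emb[OF N auto_inv[OF g(1)]]] .
  moreover have "?k (h (f x)) = x" if "x \<in> X" for x
  proof -
    have "inj_on g (univ N)" "x \<in> univ N"
      using g(1) assms(3) that by (auto simp: autos_def iso_def bij_betw_def is_model_def)
    then show ?thesis using g(2)[OF that] inv_into_f_f by metis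
  qed
  ultimately show ?thesis by (intro exI[of _ "?k \<circ> h"]) simp
qed

end

section \<open>Directed unions\<close>

text \<open>With all models given as subsets of one structure, the chain axioms become statements
  about unions of sets.\<close>

lemma chain_union_restr:
  assumes "is_struct L U" "\<Y> \<noteq> {}" "\<And>Y Z. Y \<in> \<Y> \<Longrightarrow> Z \<in> \<Y> \<Longrightarrow> Y \<subseteq> Z \<or> Z \<subseteq> Y"
  shows "chain_union L (restr L U ` \<Y>) = restr L U (\<Union>\<Y>)"
proof -
  have fin: "\<exists>Y\<in>\<Y>. set xs \<subseteq> Y" if "set xs \<subseteq> \<Union>\<Y>" for xs
    using that
  proof (induction xs)
    case (Cons x xs)
    then obtain Y Z where "Y \<in> \<Y>" "set xs \<subseteq> Y" "Z \<in> \<Y>" "x \<in> Z" by auto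
    then show ?case using assms(3)[of Y Z] by auto
  qed (use assms(2) in auto)
  have f: "(\<exists>Y\<in>\<Y>. (f, xs) \<in> fdom L Y) \<longleftrightarrow> (f, xs) \<in> fdom L (\<Union>\<Y>)" for f xs
  proof
    assume "(f, xs) \<in> fdom L (\<Union>\<Y>)"
    moreover from fin[OF fdom_set[OF this]] obtain Y where "Y \<in> \<Y>" "set xs \<subseteq> Y" by blast
    ultimately show "\<exists>Y\<in>\<Y>. (f, xs) \<in> fdom L Y" by (auto simp: fdom_def nlists_def)
  next
    assume "\<exists>Y\<in>\<Y>. (f, xs) \<in> fdom L Y"
    then obtain Y where "Y \<in> \<Y>" "(f, xs) \<in> fdom L Y" by blast
    then show "(f, xs) \<in> fdom L (\<Union>\<Y>)" using fdom_mono[of Y "\<Union>\<Y>" L] by auto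
  qed
  have r: "(\<exists>Y\<in>\<Y>. xs \<in> rdom L Y r) \<longleftrightarrow> xs \<in> rdom L (\<Union>\<Y>) r" for r xs
  proof
    assume "xs \<in> rdom L (\<Union>\<Y>) r"
    moreover from fin[OF rdom_set[OF this]] obtain Y where "Y \<in> \<Y>" "set xs \<subseteq> Y" by blast
    ultimately show "\<exists>Y\<in>\<Y>. xs \<in> rdom L Y r"
      by (auto simp: rdom_def nlists_def split: if_splits)
  next
    assume "\<exists>Y\<in>\<Y>. xs \<in> rdom L Y r"
    then obtain Y where "Y \<in> \<Y>" "xs \<in> rdom L Y r" by blast
    then show "xs \<in> rdom L (\<Union>\<Y>) r" using rdom_mono[of Y "\<Union>\<Y>" L r] by auto
  qed
  have the: "(THE y. \<exists>Y\<in>\<Y>. (f, xs) \<in> fdom L Y \<and> y = fint (restr L U Y) f xs) = fint U f xs"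
    if "(f, xs) \<in> fdom L (\<Union>\<Y>)" for f xs
  proof (rule the_equality)
    from iffD2[OF f that] obtain Y where "Y \<in> \<Y>" "(f, xs) \<in> fdom L Y" by blast
    then show "\<exists>Y\<in>\<Y>. (f, xs) \<in> fdom L Y \<and> fint U f xs = fint (restr L U Y) f xs"
      using fint_restr[of f xs L Y U] by metis
  next
    fix y assume "\<exists>Y\<in>\<Y>. (f, xs) \<in> fdom L Y \<and> y = fint (restr L U Y) f xs"
    then show "y = fint U f xs" using fint_restr by metis
  qed
  show ?thesis
  proof (rule struct.equality)
    show "univ (chain_union L (restr L U ` \<Y>)) = univ (restr L U (\<Union>\<Y>))"
      by (simp add: chain_union_def)
    show "fint (chain_union L (restr L U ` \<Y>)) = fint (restr L U (\<Union>\<Y>))"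
      using the by (intro ext) (simp add: chain_union_def restr_def f)
    show "rint (chain_union L (restr L U ` \<Y>)) = rint (restr L U (\<Union>\<Y>))"
      using r by (intro ext) (auto simp: chain_union_def restr_def)
  qed simp
qed

lemma underS_bound_finite:
  assumes "Card_order r" "infinite (Field r)" "finite s" "s \<subseteq> Field r"
  shows "\<exists>i\<in>Field r. s \<subseteq> underS r i"
  using assms(3,4)
proof (induction s)
  case empty
  then show ?case using assms(2) by (metis empty_subsetI finite.emptyI ex_in_conv)
next
  case (insert a s)
  then obtain i where i: "i \<in> Field r" "s \<subseteq> underS r i" by blast
  have lo: "Linear_order r"
    using assms(1) card_order_on_well_order_on well_order_on_def by blast
  obtain m where m: "m \<in> Field r" "(i, m) \<in> r" "(a, m) \<in> r"
    using lo i(1) insert.prems unfolding linear_order_on_def total_on_def partial_order_on_def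
      preorder_on_def refl_on_def
    by (metis insert_subset)
  obtain b where b: "b \<in> Field r" "m \<noteq> b" "(m, b) \<in> r"
    using infinite_Card_order_limit[OF assms(1,2) m(1)] by blast
  have "trans r" "antisym r"
    using lo by (auto simp: linear_order_on_def partial_order_on_def preorder_on_def)
  then have "x \<in> underS r b" if "(x, m) \<in> r" for x
    using that b unfolding underS_def trans_def antisym_def by blast
  then have "insert a s \<subseteq> underS r b"
    using i(2) m \<open>trans r\<close> unfolding underS_def trans_def by blast
  then show ?case using b(1) by blast
qed

context aec_class
begin

text \<open>The axioms speak of chains only. An infinite \<open>J\<close> is the union of its
  initial segments in a well-order of type |J|, all of smaller size, so induction on |J| reduces
  directed unions to chains. Comparison with all \<open>J' \<subseteq> J\<close> is part of the
  induction since it is what makes the segments a chain.\<close>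

lemma directed_union:
  fixes Y :: "'i set \<Rightarrow> 'u set"
  assumes U: "is_struct L U"
    and mods: "\<And>s. finite s \<Longrightarrow> s \<subseteq> I \<Longrightarrow> restr L U (Y s) \<in> mods K"
    and le: "\<And>s t. finite t \<Longrightarrow> t \<subseteq> I \<Longrightarrow> s \<subseteq> t \<Longrightarrow> le K (restr L U (Y s)) (restr L U (Y t))"
    and J: "J \<subseteq> I"
  defines "YY \<equiv> \<lambda>J. \<Union>(Y ` {s. finite s \<and> s \<subseteq> J})"
  shows "restr L U (YY J) \<in> mods K \<and> (\<forall>J'\<subseteq>J. le K (restr L U (YY J')) (restr L U (YY J)))"
  using J
proof (induction J rule: wf_induct_rule[OF wf_inv_image[OF wf_ordLess, of card_of]])
  case (1 J)
  have IH: "restr L U (YY J1) \<in> mods K \<and> (\<forall>J'\<subseteq>J1. le K (restr L U (YY J')) (restr L U (YY J1)))"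
    if "|J1| <o |J|" "J1 \<subseteq> J" for J1
    using 1 that by (auto simp: inv_image_def)
  have mono: "Y s \<subseteq> Y t" if "finite t" "t \<subseteq> I" "s \<subseteq> t" for s t
    using le_univ[OF le[OF that]] by simp
  show ?case
  proof (cases "finite J")
    case True
    have "YY s = Y s" if "s \<subseteq> J" for s
    proof -
      have "finite s" using that True finite_subset by blast
      then show ?thesis using mono[of s] that 1(2) unfolding YY_def by auto
    qed
    then show ?thesis using mods[OF True 1(2)] le[OF True 1(2)] by auto
  next
    case False
    let ?r = "|J|"
    have r: "Card_order ?r" "Field ?r = J" "Well_order ?r"
      by (simp_all only: card_of_card_order_on card_of_well_order_on Field_card_of)
    have small: "|J' \<inter> underS ?r i| <o |J|" if "i \<in> J" for J' i
      using card_of_underS[OF r(1), of i] that r(2) card_of_mono1[of "J' \<inter> underS ?r i" "underS ?r i"]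
        ordLeq_ordLess_trans by blast
    have sub: "underS ?r i \<subseteq> J" for i
      using r(2) by (auto simp: underS_def Field_def)
    have incl: "underS ?r i \<subseteq> underS ?r j" if "(i, j) \<in> ?r" for i j
      using that r(3) unfolding well_order_on_def linear_order_on_def partial_order_on_def
        preorder_on_def trans_def antisym_def underS_def by blast
    \<comment> \<open>Segments of \<open>J'\<close> are cut by the order of \<open>J\<close>, which
      makes the chains for \<open>J'\<close> and \<open>J\<close> comparable term by term.\<close>
    define Z where "Z J' i = J' \<inter> underS ?r i" for J' i
    have Z_le: "le K (restr L U (YY (Z J' i))) (restr L U (YY (Z J'' j)))"
      if "i \<in> J" "j \<in> J" "(i, j) \<in> ?r" "J' \<subseteq> J''" for i j J' J''
    proof -
      have "Z J' i \<subseteq> Z J'' j" using incl that unfolding Z_def by blast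
      moreover have "Z J'' j \<subseteq> J" using sub unfolding Z_def by blast
      ultimately show ?thesis using IH[of "Z J'' j"] small[OF that(2)] unfolding Z_def by blast
    qed
    have tot: "(i, j) \<in> ?r \<or> (j, i) \<in> ?r" if "i \<in> J" "j \<in> J" for i j
      using r(2,3) that unfolding well_order_on_def linear_order_on_def total_on_def
        partial_order_on_def preorder_on_def refl_on_def by metis
    have J_ne: "J \<noteq> {}" using False by auto
    have chain: "is_chain K ((\<lambda>i. restr L U (YY (Z J' i))) ` J)" for J'
      unfolding is_chain_def
    proof (intro conjI allI impI)
      show "(\<lambda>i. restr L U (YY (Z J' i))) ` J \<noteq> {}" using J_ne by simp
      show "(\<lambda>i. restr L U (YY (Z J' i))) ` J \<subseteq> mods K"
      proof (rule image_subsetI)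
        fix i assume "i \<in> J"
        then show "restr L U (YY (Z J' i)) \<in> mods K"
          using IH[of "Z J' i"] small[of i J'] sub[of i] unfolding Z_def by auto
      qed
      fix S assume S: "S \<subseteq> (\<lambda>i. restr L U (YY (Z J' i))) ` J" "S \<noteq> {}"
      let ?T = "{i \<in> J. restr L U (YY (Z J' i)) \<in> S}"
      have "?T \<noteq> {}" "?T \<subseteq> Field ?r" using S r(2) by auto
      then obtain i0 where i0: "i0 \<in> ?T" "\<And>i. i \<in> ?T \<Longrightarrow> (i0, i) \<in> ?r"
        using r(3) by (metis (no_types, lifting) wo_rel.minim_in wo_rel.minim_least wo_rel.intro)
      have "le K (restr L U (YY (Z J' i0))) x" if "x \<in> S" for x
      proof -
        obtain i where "i \<in> ?T" "x = restr L U (YY (Z J' i))" using S(1) \<open>x \<in> S\<close> by blast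
        then show ?thesis using Z_le[of i0 i J' J'] i0 by auto
      qed
      then show "\<exists>m\<in>S. \<forall>x\<in>S. le K m x" using i0(1) by blast
    qed
    have union: "chain_union L ((\<lambda>i. restr L U (YY (Z J' i))) ` J) = restr L U (YY J')" if "J' \<subseteq> J" for J'
    proof -
      have "Y1 \<subseteq> Y2 \<or> Y2 \<subseteq> Y1" if Y12: "Y1 \<in> (\<lambda>i. YY (Z J' i)) ` J" "Y2 \<in> (\<lambda>i. YY (Z J' i)) ` J" for Y1 Y2
      proof -
        obtain i j where ij: "i \<in> J" "j \<in> J" "Y1 = YY (Z J' i)" "Y2 = YY (Z J' j)" using Y12 by blast
        then show ?thesis
          using tot[of i j] le_univ[OF Z_le[of i j J' J']] le_univ[OF Z_le[of j i J' J']] by auto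
      qed
      moreover have "(\<Union>i\<in>J. YY (Z J' i)) = YY J'"
      proof
        show "(\<Union>i\<in>J. YY (Z J' i)) \<subseteq> YY J'" unfolding YY_def Z_def by blast
        show "YY J' \<subseteq> (\<Union>i\<in>J. YY (Z J' i))"
        proof
          fix x assume "x \<in> YY J'"
          then obtain s where s: "finite s" "s \<subseteq> J'" "x \<in> Y s" unfolding YY_def by blast
          then obtain i where "i \<in> J" "s \<subseteq> underS ?r i"
            using underS_bound_finite[OF r(1), of s] False r(2) \<open>J' \<subseteq> J\<close> by auto
          then show "x \<in> (\<Union>i\<in>J. YY (Z J' i))" using s unfolding YY_def Z_def by blast
        qed
      qed
      ultimately show ?thesis
        using chain_union_restr[OF U, of "(\<lambda>i. YY (Z J' i)) ` J"] J_ne by (simp add: image_image)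
    qed
    have "restr L U (YY J) \<in> mods K"
      using chain_mods[OF chain[of J]] union[of J] by simp
    moreover have "le K (restr L U (YY J')) (restr L U (YY J))" if "J' \<subseteq> J" for J'
    proof -
      have "le K (restr L U (YY (Z J' i))) (restr L U (YY J))" if "i \<in> J" for i
      proof -
        have "(i, i) \<in> ?r" using tot[OF that that] by simp
        then have "le K (restr L U (YY (Z J' i))) (restr L U (YY (Z J i)))"
          using Z_le[OF that that _ \<open>J' \<subseteq> J\<close>] by simp
        moreover have "le K (restr L U (YY (Z J i))) (restr L U (YY J))"
          using chain_upper[OF chain[of J], of "restr L U (YY (Z J i))"] union[of J] that by auto
        ultimately show ?thesis by (rule le_trans)
      qed
      then show ?thesis
        using chain_least[OF chain[of J'], of "restr L U (YY J)"] union[OF that] by auto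
    qed
    ultimately show ?thesis by blast
  qed
qed

text \<open>A function value is read off at any stage that contains the arguments; two stages agree
  because both lie in the stage of the union of their indices.\<close>

lemma directed_struct:
  fixes W :: "'i set \<Rightarrow> ('u, 'f, 'r) struct"
  assumes sub: "\<And>s t. finite t \<Longrightarrow> t \<subseteq> I \<Longrightarrow> s \<subseteq> t \<Longrightarrow> substruct L (W s) (W t)"
  shows "\<exists>U. is_struct L U \<and> univ U = (\<Union>s\<in>{s. finite s \<and> s \<subseteq> I}. univ (W s)) \<and>
    (\<forall>s. finite s \<and> s \<subseteq> I \<longrightarrow> W s = restr L U (univ (W s)))"
proof -
  let ?F = "{s. finite s \<and> s \<subseteq> I}"
  let ?V = "\<Union>s\<in>?F. univ (W s)"
  let ?P = "\<lambda>f xs u. u \<in> ?F \<and> (f, xs) \<in> fdom L (univ (W u))"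
  define U where "U = \<lparr>univ = ?V,
     fint = (\<lambda>f xs. if \<exists>u. ?P f xs u then fint (W (SOME u. ?P f xs u)) f xs else undefined),
     rint = (\<lambda>r. \<Union>s\<in>?F. rint (W s) r)\<rparr>"
  have struct: "is_struct L (W s)" if "s \<in> ?F" for s
    using sub[of s s] that by (auto simp: substruct_def)
  have W: "univ (W s) \<subseteq> univ (W t)" "W s = restr L (W t) (univ (W s))" if "t \<in> ?F" "s \<subseteq> t" for s t
    using sub[of t s] that unfolding substruct_def by blast+
  have fin: "\<exists>s\<in>?F. set xs \<subseteq> univ (W s)" if "set xs \<subseteq> ?V" for xs
    using that
  proof (induction xs)
    case (Cons x xs)
    then obtain s t where "s \<in> ?F" "set xs \<subseteq> univ (W s)" "t \<in> ?F" "x \<in> univ (W t)" by auto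
    moreover from this have "s \<union> t \<in> ?F" by auto
    ultimately show ?case using W(1)[of "s \<union> t" s] W(1)[of "s \<union> t" t] by (intro bexI[of _ "s \<union> t"]) auto
  qed auto
  have fint_eq: "fint (W s) f xs = fint (W t) f xs"
    if "s \<in> ?F" "t \<in> ?F" "(f, xs) \<in> fdom L (univ (W s))" "(f, xs) \<in> fdom L (univ (W t))" for s t f xs
  proof -
    have "s \<union> t \<in> ?F" using that by auto
    then have "W s = restr L (W (s \<union> t)) (univ (W s))" "W t = restr L (W (s \<union> t)) (univ (W t))"
      using W(2) by auto
    then show ?thesis using that(3,4) fint_restr by metis
  qed
  have fint_U: "fint U f xs = fint (W s) f xs" if "s \<in> ?F" "(f, xs) \<in> fdom L (univ (W s))" for s f xs
  proof -
    have "?P f xs (SOME u. ?P f xs u)" by (rule someI[of _ s]) (use that in blast)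
    moreover from this have "\<exists>u. ?P f xs u" by (rule exI)
    then have "fint U f xs = fint (W (SOME u. ?P f xs u)) f xs"
      by (simp only: U_def struct.simps if_True)
    ultimately show ?thesis using fint_eq[of "SOME u. ?P f xs u" s f xs] that by simp
  qed
  have fdom_V: "\<exists>s. ?P f xs s" if "(f, xs) \<in> fdom L ?V" for f xs
    using fin[OF fdom_set[OF that]] that by (auto simp: fdom_def nlists_def)
  have U: "is_struct L U"
    unfolding is_struct_def
  proof (intro conjI allI impI)
    fix f xs assume "(f, xs) \<in> fdom L (univ U)"
    then have "(f, xs) \<in> fdom L ?V" by (simp only: U_def struct.simps)
    then obtain s where s: "?P f xs s" using fdom_V by blast
    then show "fint U f xs \<in> univ U"
      using fint_U[of s f xs] is_struct_fint[OF struct, of s f xs] unfolding U_def by auto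
  next
    fix f xs assume no: "(f, xs) \<notin> fdom L (univ U)"
    have "\<not> (\<exists>u. ?P f xs u)"
    proof
      assume "\<exists>u. ?P f xs u"
      then obtain u where u: "?P f xs u" by blast
      then have "univ (W u) \<subseteq> univ U" unfolding U_def by auto
      then show False using fdom_mono[of "univ (W u)" "univ U" L] u no by auto
    qed
    then show "fint U f xs = undefined" by (simp only: U_def struct.simps if_False)
  next
    fix r
    have "rint (W s) r \<subseteq> rdom L (univ U) r" if "s \<in> ?F" for s
    proof -
      have sub: "univ (W s) \<subseteq> univ U" using that unfolding U_def by auto
      show ?thesis using is_struct_rint[OF struct[OF that], of r] rdom_mono[OF sub, of L r] by (rule subset_trans)
    qed
    then show "rint U r \<subseteq> rdom L (univ U) r" unfolding U_def by auto
  qed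
  have "W s = restr L U (univ (W s))" if s: "s \<in> ?F" for s
  proof (rule is_struct_eqI[OF struct[OF s]])
    have "univ (W s) \<subseteq> univ U" using s unfolding U_def by auto
    then show "is_struct L (restr L U (univ (W s)))"
      using is_struct_fint[OF struct[OF s]] fint_U[OF s] by (simp add: is_struct_restr_iff[OF U])
    show "fint (W s) f xs = fint (restr L U (univ (W s))) f xs" if "(f, xs) \<in> fdom L (univ (W s))" for f xs
      using fint_U[OF s that] that by (simp add: fint_restr)
    show "xs \<in> rint (W s) r \<longleftrightarrow> xs \<in> rint (restr L U (univ (W s))) r" if xs: "xs \<in> rdom L (univ (W s)) r" for r xs
    proof -
      have "xs \<in> rint (W s) r" if "xs \<in> rint (W t) r" "t \<in> ?F" for t
      proof -
        have st: "s \<union> t \<in> ?F" using s that by auto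
        have "rint (W t) r = rint (W (s \<union> t)) r \<inter> rdom L (univ (W t)) r"
          using W(2)[OF st, of t] rint_restr by (metis Un_upper2)
        moreover have "rint (W s) r = rint (W (s \<union> t)) r \<inter> rdom L (univ (W s)) r"
          using W(2)[OF st, of s] rint_restr by (metis Un_upper1)
        ultimately show ?thesis using that xs by blast
      qed
      then show ?thesis using s xs by (auto simp: rint_restr U_def)
    qed
  qed simp
  then show ?thesis using U by (intro exI[of _ U]) (auto simp: U_def)
qed

lemma directed_colimit:
  fixes W :: "'i set \<Rightarrow> ('u, 'f, 'r) struct"
  assumes le: "\<And>s t. finite t \<Longrightarrow> t \<subseteq> I \<Longrightarrow> s \<subseteq> t \<Longrightarrow> le K (W s) (W t)"
  shows "\<exists>U\<in>mods K. \<forall>s. finite s \<and> s \<subseteq> I \<longrightarrow> le K (W s) U"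
proof -
  have "\<exists>U. is_struct L U \<and> univ U = (\<Union>s\<in>{s. finite s \<and> s \<subseteq> I}. univ (W s)) \<and>
      (\<forall>s. finite s \<and> s \<subseteq> I \<longrightarrow> W s = restr L U (univ (W s)))"
    by (rule directed_struct) (rule le_substruct[OF le])
  then obtain U where U: "is_struct L U" "univ U = (\<Union>s\<in>{s. finite s \<and> s \<subseteq> I}. univ (W s))"
    and W: "\<And>s. finite s \<Longrightarrow> s \<subseteq> I \<Longrightarrow> W s = restr L U (univ (W s))"
    by metis
  have sub: "le K (restr L U (univ (W s))) (restr L U (univ (W t)))" if "finite t" "t \<subseteq> I" "s \<subseteq> t" for s t
    using le[OF that] W[of s] W[of t] that finite_subset[OF that(3)] by auto
  have mods: "restr L U (univ (W s)) \<in> mods K" if "finite s" "s \<subseteq> I" for s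
    using sub[OF that] le_mods by blast
  have eq: "restr L U (\<Union>s\<in>{s. finite s \<and> s \<subseteq> I}. univ (W s)) = U"
    using restr_univ[OF U(1)] U(2) by simp
  have fin: "(\<Union>t\<in>{t. finite t \<and> t \<subseteq> s}. univ (W t)) = univ (W s)" if "finite s" "s \<subseteq> I" for s
    using le_univ[OF le[OF that]] that by auto
  have "restr L U (\<Union>s\<in>{s. finite s \<and> s \<subseteq> I}. univ (W s)) \<in> mods K \<and>
    (\<forall>J'\<subseteq>I. le K (restr L U (\<Union>s\<in>{s. finite s \<and> s \<subseteq> J'}. univ (W s)))
      (restr L U (\<Union>s\<in>{s. finite s \<and> s \<subseteq> I}. univ (W s))))"
    by (rule directed_union[where Y = "\<lambda>s. univ (W s)", OF U(1) mods sub]) auto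
  then have U': "U \<in> mods K"
    "\<And>J'. J' \<subseteq> I \<Longrightarrow> le K (restr L U (\<Union>s\<in>{s. finite s \<and> s \<subseteq> J'}. univ (W s))) U"
    unfolding eq by blast+
  have "le K (W s) U" if "finite s" "s \<subseteq> I" for s
    using U'(2)[OF that(2)] W[OF that] unfolding fin[OF that] by simp
  then show ?thesis using U'(1) by blast
qed

end

section \<open>Stretching indiscernible systems\<close>

lemma sorted_list_of_set_rank:
  assumes "finite (u :: 'i::linorder set)" "i \<in> u"
  shows "sorted_list_of_set u ! card {j\<in>u. j < i} = i" "card {j\<in>u. j < i} < card u"
proof -
  let ?l = "sorted_list_of_set u"
  obtain k where k: "k < length ?l" "?l ! k = i"
    using assms by (metis in_set_conv_nth set_sorted_list_of_set)
  have lt: "?l ! a < ?l ! b \<longleftrightarrow> a < b" if "a < length ?l" "b < length ?l" for a b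
    using that sorted_wrt_nth_less[of "(<)" ?l] strict_sorted_list_of_set[of u]
    by (metis linorder_neqE_nat order_less_asym)
  have "{j\<in>u. j < i} = (!) ?l ` {..<k}"
  proof
    show "{j\<in>u. j < i} \<subseteq> (!) ?l ` {..<k}"
    proof
      fix j assume j: "j \<in> {j\<in>u. j < i}"
      then obtain a where "a < length ?l" "?l ! a = j"
        using assms by (metis (no_types, lifting) in_set_conv_nth mem_Collect_eq set_sorted_list_of_set)
      then show "j \<in> (!) ?l ` {..<k}" using j k lt by blast
    qed
    show "(!) ?l ` {..<k} \<subseteq> {j\<in>u. j < i}"
    proof
      fix j assume "j \<in> (!) ?l ` {..<k}"
      then obtain a where a: "a < k" "j = ?l ! a" by blast
      then have "j \<in> u" using k(1) assms(1) by (metis nth_mem order_less_trans set_sorted_list_of_set)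
      then show "j \<in> {j\<in>u. j < i}" using a k lt by auto
    qed
  qed
  moreover have "inj_on ((!) ?l) {..<k}"
    using k(1) by (intro inj_on_nth) auto
  ultimately have "card {j\<in>u. j < i} = k" by (simp add: card_image)
  then show "?l ! card {j\<in>u. j < i} = i" "card {j\<in>u. j < i} < card u" using k by auto
qed

text \<open>The positions of the elements of \<open>t\<close> within \<open>v\<close>. Only through
  these positions does the index order enter the stretched model.\<close>

definition rk :: "'i::linorder set \<Rightarrow> 'i set \<Rightarrow> nat list" where
  "rk v t = map (\<lambda>i. card {j\<in>v. j < i}) (sorted_list_of_set t)"

lemma length_rk [simp]: "length (rk v t) = card t"
  by (simp add: rk_def)

lemma rk_incr:
  assumes "finite v" "t \<subseteq> v"
  shows "rk v t \<in> incr (card t) {..<card v}"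
proof -
  have t: "finite t" using assms finite_subset by blast
  have "card {k\<in>v. k < i} < card {k\<in>v. k < j}" if "i \<in> t" "j \<in> t" "i < j" for i j
    using that assms by (intro psubset_card_mono) auto
  then have "sorted_wrt (<) (rk v t)"
    unfolding rk_def sorted_wrt_map
    by (intro sorted_wrt_mono_rel[OF _ strict_sorted_list_of_set[of t]]) (auto simp: t)
  moreover have "set (rk v t) \<subseteq> {..<card v}"
    using sorted_list_of_set_rank(2)[OF assms(1)] assms(2) t by (auto simp: rk_def)
  ultimately show ?thesis by (simp add: incr_def)
qed

text \<open>Functoriality of positions, to which coherence of the stretched system reduces.\<close>

lemma rk_comp:
  assumes "finite v" "u \<subseteq> v" "t \<subseteq> u"
  shows "map ((!) (rk v u)) (rk u t) = rk v t"
proof -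
  have fin: "finite u" using assms(1,2) by (rule rev_finite_subset)
  then have fint: "finite t" using assms(3) by (rule rev_finite_subset)
  have "rk v u ! card {j\<in>u. j < i} = card {j\<in>v. j < i}" if "i \<in> t" for i
    using sorted_list_of_set_rank[OF fin, of i] that assms(3) by (auto simp: rk_def)
  then show ?thesis
    unfolding rk_def[of u t] rk_def[of v t] map_map comp_def
    by (intro map_cong refl) (simp add: fint)
qed

lemma rk_self:
  assumes "finite u"
  shows "rk u u = [0..<card u]"
proof (rule nth_equalityI)
  fix k assume "k < length (rk u u)"
  have "sorted_wrt (<) (rk u u)" "set (rk u u) \<subseteq> {..<card u}"
    using rk_incr[OF assms subset_refl] by (auto simp: incr_def)
  moreover have "set (rk u u) = {..<card u}"
  proof (rule card_subset_eq)
    have "distinct (rk u u)" using \<open>sorted_wrt (<) (rk u u)\<close> strict_sorted_iff by blast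
    then show "card (set (rk u u)) = card {..<card u}" by (simp add: distinct_card)
  qed (use calculation in auto)
  ultimately have "rk u u = sorted_list_of_set {..<card u}"
    using sorted_list_of_set.idem_if_sorted_distinct strict_sorted_iff by metis
  then show "rk u u ! k = [0..<card u] ! k"
    by (simp add: lessThan_atLeast0)
qed simp

text \<open>The quantifier-free diagrams along two enumerations agree. A function value is recorded
  by its index \<open>k\<close>, so that over a countable language all diagrams are subsets of one
  countable set.\<close>

lemma iso_of_enumerations:
  fixes e e' :: "nat \<Rightarrow> 'u"
  assumes A: "is_struct L (restr L N (range e))" and A': "is_struct L (restr L N' (range e'))"
    and eq: "\<And>k j. e k = e j \<longleftrightarrow> e' k = e' j"
    and f: "\<And>f ks k. f \<in> fsyms L \<Longrightarrow> length ks = farity L f \<Longrightarrow>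
      fint N f (map e ks) = e k \<longleftrightarrow> fint N' f (map e' ks) = e' k"
    and r: "\<And>r ks. r \<in> rsyms L \<Longrightarrow> map e ks \<in> rint N r \<longleftrightarrow> map e' ks \<in> rint N' r"
    and \<theta>: "\<And>k. \<theta> (e k) = e' k"
  shows "iso L \<theta> (restr L N (range e)) (restr L N' (range e'))"
proof -
  have ks: "\<exists>ks. xs = map e ks" if "set xs \<subseteq> range e" for xs
    using that by (metis (mono_tags, lifting) imageE lists_UNIV lists_eq_set lists_image mem_Collect_eq)
  have m: "map \<theta> (map e ks) = map e' ks" for ks by (simp add: \<theta>)
  show ?thesis
    unfolding iso_def univ_restr
  proof (intro conjI allI impI ballI)
    show "bij_betw \<theta> (range e) (range e')"
      using eq by (auto simp: bij_betw_def inj_on_def image_image \<theta>)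
  next
    fix g xs assume xs: "(g, xs) \<in> fdom L (range e)"
    then obtain ks where ks': "xs = map e ks" using ks fdom_set by metis
    have "fint (restr L N (range e)) g xs \<in> range e" using is_struct_fint[OF A] xs by simp
    then obtain k where "fint N g xs = e k" using xs by (auto simp: fint_restr)
    moreover have "(g, map e' ks) \<in> fdom L (range e')" "g \<in> fsyms L" "length ks = farity L g"
      using xs unfolding ks' by (auto simp: fdom_def nlists_def)
    ultimately show "\<theta> (fint (restr L N (range e)) g xs) = fint (restr L N' (range e')) g (map \<theta> xs)"
      using f[of g ks k] xs unfolding ks' m by (simp add: fint_restr \<theta>)
  next
    fix q xs assume xs: "xs \<in> rdom L (range e) q"
    then obtain ks where ks': "xs = map e ks" using ks rdom_set by metis
    have "map e' ks \<in> rdom L (range e') q" "q \<in> rsyms L"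
      using xs unfolding ks' by (auto simp: rdom_def nlists_def split: if_splits)
    then show "xs \<in> rint (restr L N (range e)) q \<longleftrightarrow> map \<theta> xs \<in> rint (restr L N' (range e')) q"
      using r[of q ks] xs unfolding ks' m by (simp add: rint_restr)
  qed
qed

text \<open>Structures live on \<open>'u\<close>, so classes of names must become points of
  \<open>'u\<close>: a representative is chosen in each class and injected.\<close>

lemma quotient_names:
  assumes "|T| \<le>o |UNIV :: 'u set|"
    and refl: "\<And>x. x \<in> T \<Longrightarrow> R x x"
    and sym: "\<And>x y. x \<in> T \<Longrightarrow> y \<in> T \<Longrightarrow> R x y \<Longrightarrow> R y x"
    and trans: "\<And>x y z. x \<in> T \<Longrightarrow> y \<in> T \<Longrightarrow> z \<in> T \<Longrightarrow> R x y \<Longrightarrow> R y z \<Longrightarrow> R x z"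
  shows "\<exists>pt :: _ \<Rightarrow> 'u. \<forall>x\<in>T. \<forall>y\<in>T. pt x = pt y \<longleftrightarrow> R x y"
proof -
  obtain \<iota> :: "_ \<Rightarrow> 'u" where \<iota>: "inj_on \<iota> T" using assms(1) unfolding card_of_ordLeq[symmetric] by blast
  let ?rep = "\<lambda>x. SOME y. y \<in> T \<and> R x y"
  have rep: "?rep x \<in> T \<and> R x (?rep x)" if "x \<in> T" for x
    by (rule someI[of _ x]) (use that refl in blast)
  have "?rep x = ?rep y \<longleftrightarrow> R x y" if "x \<in> T" "y \<in> T" for x y
  proof
    assume "?rep x = ?rep y"
    then show "R x y" using rep[OF that(1)] rep[OF that(2)] trans[of x "?rep x" y] sym that by metis
  next
    assume "R x y"
    then have "z \<in> T \<and> R x z \<longleftrightarrow> z \<in> T \<and> R y z" for z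
      using that trans sym by blast
    then show "?rep x = ?rep y" by (intro arg_cong[of _ _ Eps] ext)
  qed
  then show ?thesis
    using inj_on_eq_iff[OF \<iota>] rep by (intro exI[of _ "\<lambda>x. \<iota> (?rep x)"] ballI) (simp only:)
qed

context aec_class
begin

text \<open>A substitute for Skolem hulls: recursion on the cardinality of \<open>s\<close> closes
  off the parameters together with the models already chosen for all \<open>s - {x}\<close>, which
  makes the choice monotone.\<close>

lemma countable_model_system:
  assumes N: "N \<in> mods K" and p: "p \<subseteq> univ N" "countable p" and X: "\<And>x. x \<in> X \<Longrightarrow> set x \<subseteq> univ N"
  shows "\<exists>Nm. \<forall>s. finite s \<and> s \<subseteq> X \<longrightarrow>
    model_in N (Nm s) \<and> countable (Nm s) \<and> p \<union> \<Union>(set ` s) \<subseteq> Nm s \<and> (\<forall>s'\<subseteq>s. Nm s' \<subseteq> Nm s)"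
proof -
  have "\<exists>Y. Z \<subseteq> Y \<and> model_in N Y \<and> countable Y" if "Z \<subseteq> univ N" "countable Z" for Z
    using countable_model[OF N that] by metis
  then obtain cl where cl: "\<And>Z. Z \<subseteq> univ N \<Longrightarrow> countable Z \<Longrightarrow> Z \<subseteq> cl Z \<and> model_in N (cl Z) \<and> countable (cl Z)"
    by metis
  let ?P = "\<lambda>s. p \<union> \<Union>(set ` s)"
  define Nk where "Nk = rec_nat (\<lambda>s. cl (?P s)) (\<lambda>_ F s. cl (?P s \<union> (\<Union>x\<in>s. F (s - {x}))))"
  have Nk_0: "Nk 0 s = cl (?P s)" and Nk_Suc: "Nk (Suc k) s = cl (?P s \<union> (\<Union>x\<in>s. Nk k (s - {x})))" for k s
    by (simp_all add: Nk_def)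
  define Nm where "Nm s = Nk (card s) s" for s
  have P: "?P s \<subseteq> univ N" "countable (?P s)" if "finite s" "s \<subseteq> X" for s
    using that p X by (auto intro: countable_finite)
  have Nk: "model_in N (Nk k s) \<and> countable (Nk k s) \<and> ?P s \<subseteq> Nk k s" if "finite s" "s \<subseteq> X" for k s
    using that
  proof (induction k arbitrary: s)
    case 0
    then show ?case using cl[OF P[OF 0]] by (simp add: Nk_0)
  next
    case (Suc k)
    have IH: "model_in N (Nk k (s - {x})) \<and> countable (Nk k (s - {x}))" for x
      using Suc.IH[of "s - {x}"] Suc.prems by blast
    have "?P s \<union> (\<Union>x\<in>s. Nk k (s - {x})) \<subseteq> univ N" "countable (?P s \<union> (\<Union>x\<in>s. Nk k (s - {x})))"
      using IH model_in_subset P[OF Suc.prems] countable_finite[OF Suc.prems(1)] by blast+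
    from cl[OF this] show ?case unfolding Nk_Suc by blast
  qed
  have step: "Nm (s - {x}) \<subseteq> Nm s" if s: "finite s" "s \<subseteq> X" "x \<in> s" for s x
  proof -
    obtain k where k: "card s = Suc k" using card.remove[OF s(1,3)] by blast
    then have Nm_eq: "Nm (s - {x}) = Nk k (s - {x})" using that by (simp add: Nm_def)
    have sub: "?P s \<union> (\<Union>x\<in>s. Nk k (s - {x})) \<subseteq> univ N" "countable (?P s \<union> (\<Union>x\<in>s. Nk k (s - {x})))"
    proof -
      have *: "model_in N (Nk k (s - {x}))" "countable (Nk k (s - {x}))" for x
        using Nk[of "s - {x}" k] s by auto
      then have "(\<Union>x\<in>s. Nk k (s - {x})) \<subseteq> univ N" using model_in_subset by blast
      then show "?P s \<union> (\<Union>x\<in>s. Nk k (s - {x})) \<subseteq> univ N" using P(1)[OF s(1,2)] by simp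
      show "countable (?P s \<union> (\<Union>x\<in>s. Nk k (s - {x})))"
        using * P(2)[OF s(1,2)] countable_finite[OF s(1)] by simp
    qed
    have "Nk k (s - {x}) \<subseteq> Nm s"
      using cl[OF sub] s(3) unfolding Nm_def k Nk_Suc by blast
    then show ?thesis by (simp only: Nm_eq)
  qed
  have mono: "Nm s \<subseteq> Nm (s \<union> t)" if "finite t" "finite s" "s \<union> t \<subseteq> X" for s t
    using that
  proof (induction t)
    case (insert x t)
    show ?case
    proof (cases "x \<in> s \<union> t")
      case True
      then have "s \<union> insert x t = s \<union> t" by blast
      then show ?thesis using insert by simp
    next
      case False
      then have "(s \<union> insert x t) - {x} = s \<union> t" by blast
      then show ?thesis
        using step[of "s \<union> insert x t" x] insert by auto
    qed
  qed simp
  have "Nm s' \<subseteq> Nm s" if "finite s" "s \<subseteq> X" "s' \<subseteq> s" for s s'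
  proof -
    have "s = s' \<union> (s - s')" using that by blast
    then show ?thesis using mono[of "s - s'" s'] that finite_subset by (metis finite_Diff)
  qed
  then show ?thesis using Nk unfolding Nm_def[symmetric] by (intro exI[of _ Nm]) (auto simp: Nm_def)
qed

end

locale inaccessible_class = aec_class K + inaccessible \<delta>
  for K :: "('u, 'f, 'r) aec" and \<delta> :: "'u rel"
begin

text \<open>
  An Ehrenfeucht--Mostowski construction.  The points of the model \<open>U\<close> are named by pairs
  \<open>(t, k)\<close>, the \<open>k\<close>-th element of the countable model attached to a finite \<open>t \<subseteq> I\<close>; their
  relations are read off the template \<open>h\<close>, in which all sublists of equal length look alike.
\<close>

lemma EM_model:
  fixes I :: "'i::linorder set" and X :: "'u list set"
  assumes N: "N \<in> mods K" and inf: "\<forall>A\<in>mods K. infinite (univ A)"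
    and I: "infinite I" "|I| \<le>o |UNIV :: 'u set|"
    and p: "set p \<subseteq> univ N" and X: "X \<subseteq> nlists n (univ N)" "\<not> small X"
  shows "\<exists>C0 U g0 y. model_in N C0 \<and> countable C0 \<and> set p \<subseteq> C0 \<and> U \<in> mods K \<and>
    elem_emb K g0 (restr L N C0) U \<and>
    (\<forall>i\<in>I. \<forall>j\<in>I. i < j \<longrightarrow> (\<exists>C \<psi> x1 x2. model_in N C \<and> countable C \<and> C0 \<subseteq> C \<and>
      elem_emb K \<psi> (restr L N C) U \<and> (\<forall>c\<in>C0. \<psi> c = g0 c) \<and> x1 \<in> X \<and> x2 \<in> X \<and> x1 \<noteq> x2 \<and>
      set x1 \<subseteq> C \<and> set x2 \<subseteq> C \<and> map \<psi> x1 = y i \<and> map \<psi> x2 = y j))"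
proof -
  have "\<exists>Nm. \<forall>s. finite s \<and> s \<subseteq> X \<longrightarrow>
    model_in N (Nm s) \<and> countable (Nm s) \<and> set p \<union> \<Union>(set ` s) \<subseteq> Nm s \<and> (\<forall>s'\<subseteq>s. Nm s' \<subseteq> Nm s)"
    using p X by (intro countable_model_system N) (auto simp: nlists_def intro: countable_finite)
  then obtain Nm where *: "\<forall>s. finite s \<and> s \<subseteq> X \<longrightarrow>
    model_in N (Nm s) \<and> countable (Nm s) \<and> set p \<union> \<Union>(set ` s) \<subseteq> Nm s \<and> (\<forall>s'\<subseteq>s. Nm s' \<subseteq> Nm s)"
    by (rule exE)
  have Nm: "\<And>s. finite s \<Longrightarrow> s \<subseteq> X \<Longrightarrow> model_in N (Nm s)"
    "\<And>s. finite s \<Longrightarrow> s \<subseteq> X \<Longrightarrow> countable (Nm s)"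
    "\<And>s. finite s \<Longrightarrow> s \<subseteq> X \<Longrightarrow> set p \<union> \<Union>(set ` s) \<subseteq> Nm s"
    "\<And>s s'. finite s \<Longrightarrow> s \<subseteq> X \<Longrightarrow> s' \<subseteq> s \<Longrightarrow> Nm s' \<subseteq> Nm s"
    using * by simp_all
  \<comment> \<open>Entries of the tuples in \<open>l\<close> occupy positions determined by lengths
    alone, so a position names corresponding points for different \<open>l\<close>; the later
    positions run through the whole countable model.\<close>
  define e where "e l k = (if k < length (p @ concat l) then (p @ concat l) ! k
    else from_nat_into (Nm (set l)) (k - length (p @ concat l)))" for l k
  have range_e: "range (e l) = Nm (set l)" if "set l \<subseteq> X" for l
  proof -
    have "infinite (univ (restr L N (Nm (set l))))"
      using Nm(1)[of "set l"] that model_in_mods inf by blast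
    then have "Nm (set l) \<noteq> {}" by auto
    then have r: "range (from_nat_into (Nm (set l))) = Nm (set l)"
      using Nm(2)[of "set l"] that by (intro range_from_nat_into) auto
    have "set (p @ concat l) \<subseteq> Nm (set l)" using Nm(3)[of "set l"] that by auto
    then have "e l k \<in> Nm (set l)" for k
      using r nth_mem[of k "p @ concat l"] unfolding e_def by (metis range_eqI subsetD)
    moreover have "x \<in> range (e l)" if x: "x \<in> Nm (set l)" for x
    proof -
      obtain k where "x = from_nat_into (Nm (set l)) k" using x r by blast
      then have "x = e l (k + length (p @ concat l))" unfolding e_def by simp
      then show ?thesis by blast
    qed
    ultimately show ?thesis by blast
  qed
  \<comment> \<open>\<open>F\<close> and \<open>R\<close> form the quantifier-free diagram of the
    attached model, and \<open>Q\<close> records how the models of sublists sit inside it. There are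
    few such colours because the language is countable.\<close>
  define F where "F l = {(f, ks, k). f \<in> fsyms L \<and> length ks = farity L f \<and> fint N f (map (e l) ks) = e l k}" for l
  define R where "R l = {(r, ks). r \<in> rsyms L \<and> map (e l) ks \<in> rint N r}" for l
  define Q where "Q l = {(ps, k, j). ps \<in> incr (length ps) {..<length l} \<and> e (map ((!) l) ps) k = e l j}" for l
  define col where "col l = (F l, R l, Q l)" for l
  let ?C = "Pow (fsyms L \<times> (UNIV :: (nat list \<times> nat) set)) \<times> Pow (rsyms L \<times> (UNIV :: nat list set)) \<times>
    (UNIV :: (nat list \<times> nat \<times> nat) set set)"
  have "small ?C"
    unfolding Pow_UNIV[symmetric]
    by (intro small_Times small_Pow small_countable countable_SIGMA fsyms_countable rsyms_countable) auto
  moreover have "col l \<in> ?C" for l unfolding col_def F_def R_def by auto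
  ultimately obtain h where h: "\<And>m. set (h m) \<subseteq> X" "\<And>m. length (h m) = m" "\<And>m. distinct (h m)"
    and col_h: "\<And>m ps. ps \<in> incr (length ps) {..<m} \<Longrightarrow> col (map ((!) (h m)) ps) = col (h (length ps))"
    using template[OF X(2), of ?C col] by metis
  \<comment> \<open>\<open>g v t\<close> plays the part of \<open>t\<close> once the points of
    \<open>v\<close> are represented, in order, by the entries of \<open>h (card v)\<close>. By
    indiscernibility its colour depends on \<open>card t\<close> alone.\<close>
  define g where "g v t = map ((!) (h (card v))) (rk v t)" for v t :: "'i set"
  have g_len [simp]: "length (g v t) = card t" for v t by (simp add: g_def)
  have g_comp: "map ((!) (g v u)) (rk u t) = g v t" if "finite v" "u \<subseteq> v" "t \<subseteq> u" for v u t
  proof -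
    have "set (rk u t) \<subseteq> {..<card u}"
      using rk_incr[of u t] that finite_subset[OF that(2,1)] by (auto simp: incr_def)
    then have "map ((!) (g v u)) (rk u t) = map ((!) (h (card v))) (map ((!) (rk v u)) (rk u t))"
      by (auto simp: g_def)
    then show ?thesis unfolding rk_comp[OF that] by (simp add: g_def)
  qed
  have g_self: "g u u = h (card u)" if "finite u" for u
    using h(2)[of "card u"] map_nth[of "h (card u)"] by (simp add: g_def rk_self[OF that])
  have g_col: "col (g v t) = col (h (card t))" if "finite v" "t \<subseteq> v" for v t
    using col_h[of "rk v t" "card v"] rk_incr[OF that] by (simp add: g_def)
  have g_set: "set (g v t) \<subseteq> set (g v u)" if "finite v" "u \<subseteq> v" "t \<subseteq> u" for v u t
  proof -
    have "set (rk u t) \<subseteq> {..<card u}"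
      using rk_incr[of u t] that finite_subset[OF that(2,1)] by (auto simp: incr_def)
    then have "set (map ((!) (g v u)) (rk u t)) \<subseteq> set (g v u)" by auto
    then show ?thesis by (simp only: g_comp[OF that])
  qed
  have g_X: "set (g v t) \<subseteq> X" if "finite v" "t \<subseteq> v" for v t
    using g_set[OF that(1) subset_refl that(2)] h(1) unfolding g_self[OF that(1)] by blast
  have range_g: "range (e (g v t)) = Nm (set (g v t))" if "finite v" "t \<subseteq> v" for v t
    by (rule range_e[OF g_X[OF that]])
  \<comment> \<open>Identifications inside the model of \<open>u\<close> are coded by
    \<open>Q\<close>, hence are the same whether \<open>u\<close> is represented by itself or as a
    part of \<open>v\<close>.\<close>
  have star: "e (g v t) k = e (g v u) j \<longleftrightarrow> e (g u t) k = e (g u u) j"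
    if "finite v" "u \<subseteq> v" "t \<subseteq> u" for v u t k j
  proof -
    have u: "finite u" using finite_subset[OF that(2,1)] .
    have ps: "rk u t \<in> incr (length (rk u t)) {..<card u}" using rk_incr[OF u that(3)] by simp
    have "Q (g v u) = Q (g u u)"
      using g_col[OF that(1,2)] g_col[OF u subset_refl] by (simp add: col_def)
    moreover have "(rk u t, k, j) \<in> Q (g v u) \<longleftrightarrow> e (g v t) k = e (g v u) j"
      using ps g_comp[OF that] by (simp add: Q_def)
    moreover have "(rk u t, k, j) \<in> Q (g u u) \<longleftrightarrow> e (g u t) k = e (g u u) j"
      using ps g_comp[OF u subset_refl that(3)] by (simp add: Q_def)
    ultimately show ?thesis by blast
  qed
  have into: "\<exists>j. e (g v t) k = e (g v u) j" if "finite v" "u \<subseteq> v" "t \<subseteq> u" for v u t k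
  proof -
    have "Nm (set (g v t)) \<subseteq> Nm (set (g v u))"
      using Nm(4)[OF _ g_X[OF that(1,2)] g_set[OF that]] by simp
    then show ?thesis using range_g[OF that(1,2)] range_g[of v t] that by blast
  qed
  have coh: "e (g v t) k = e (g v t') k' \<longleftrightarrow> e (g u t) k = e (g u t') k'"
    if c: "finite v" "u \<subseteq> v" "t \<subseteq> u" "t' \<subseteq> u" for v u t t' k k'
  proof -
    obtain j where j: "e (g v t) k = e (g v u) j" using into[OF c(1-3)] by blast
    then have j': "e (g u t) k = e (g u u) j" using star[OF c(1-3)] by blast
    show ?thesis unfolding j j' using star[OF c(1,2,4), of k' j] by metis
  qed
  define T where "T = {(t, k :: nat). finite t \<and> t \<subseteq> I}"
  \<comment> \<open>Names are compared within the least index set containing both; by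
    \<open>coh\<close> every larger finite set gives the same answer.\<close>
  define Eq where "Eq = (\<lambda>(t, k) (t', k'). e (g (t \<union> t') t) k = e (g (t \<union> t') t') k')"
  have Eq_iff: "Eq (t, k) (t', k') \<longleftrightarrow> e (g u t) k = e (g u t') k'"
    if "finite u" "t \<subseteq> u" "t' \<subseteq> u" for u t t' k k'
    using coh[of u "t \<union> t'" t t'] that unfolding Eq_def by auto
  have "|T| \<le>o |UNIV :: 'u set|"
  proof -
    have U: "Cinfinite |UNIV :: 'u set|"
      using I card_of_ordLeq_infinite by (auto simp: cinfinite_def Field_card_of card_of_card_order_on)
    have "T \<subseteq> (\<lambda>(l, k). (set l, k)) ` (lists I \<times> UNIV)"
    proof
      fix x assume "x \<in> T"
      then obtain t k where x: "x = (t, k)" "finite t" "t \<subseteq> I" unfolding T_def by auto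
      then obtain l where "set l = t" using finite_list by blast
      then show "x \<in> (\<lambda>(l, k). (set l, k)) ` (lists I \<times> UNIV)"
        using x by (intro image_eqI[of _ _ "(l, k)"]) auto
    qed
    then have "|T| \<le>o |lists I \<times> (UNIV :: nat set)|"
      by (rule ordLeq_transitive[OF card_of_mono1 card_of_image])
    also have "|lists I \<times> (UNIV :: nat set)| \<le>o |UNIV :: 'u set|"
    proof -
      have "|UNIV :: nat set| \<le>o |UNIV :: 'u set|"
        using U by (simp add: cinfinite_def Field_card_of infinite_iff_card_of_nat)
      then show ?thesis
        using cprod_cinfinite_bound[OF card_of_lists_Cinfinite_bound[OF I(2) U] _ _ _ U, of "|UNIV :: nat set|"]
        by (simp add: cprod_def Field_card_of card_of_card_order_on)
    qed
    finally show ?thesis .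
  qed
  then have "\<exists>pt :: 'i set \<times> nat \<Rightarrow> 'u. \<forall>x\<in>T. \<forall>y\<in>T. pt x = pt y \<longleftrightarrow> Eq x y"
  proof (rule quotient_names)
    fix x y z assume xyz: "x \<in> T" "y \<in> T" "z \<in> T" "Eq x y" "Eq y z"
    obtain t1 k1 t2 k2 t3 k3 where *: "x = (t1, k1)" "y = (t2, k2)" "z = (t3, k3)" by (metis prod.exhaust)
    define v where "v = t1 \<union> t2 \<union> t3"
    have v: "finite v" "t1 \<subseteq> v" "t2 \<subseteq> v" "t3 \<subseteq> v" using xyz unfolding T_def * v_def by auto
    show "Eq x z"
      using xyz(4,5) unfolding * Eq_iff[OF v(1,2,3)] Eq_iff[OF v(1,3,4)] Eq_iff[OF v(1,2,4)]
      by (rule trans)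
  qed (auto simp: Eq_def Un_commute)
  then obtain pt :: "'i set \<times> nat \<Rightarrow> 'u" where pt: "\<And>x y. x \<in> T \<Longrightarrow> y \<in> T \<Longrightarrow> pt x = pt y \<longleftrightarrow> Eq x y"
    by metis
  have pt_iff: "pt (t, k) = pt (t', k') \<longleftrightarrow> e (g u t) k = e (g u t') k'"
    if "finite u" "u \<subseteq> I" "t \<subseteq> u" "t' \<subseteq> u" for u t t' k k'
    using pt[of "(t, k)" "(t', k')"] Eq_iff[OF that(1,3,4)] that finite_subset[OF _ that(1)]
    unfolding T_def by auto
  define B where "B u = restr L N (Nm (set (h (card u))))" for u :: "'i set"
  have B: "model_in N (Nm (set (h m)))" "countable (Nm (set (h m)))" for m
    using Nm(1,2)[of "set (h m)"] h(1) by auto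
  have B_mods: "B u \<in> mods K" for u using B model_in_mods unfolding B_def by blast
  have univ_B: "univ (B u) = range (e (g u u))" if "finite u" for u
    using range_e[OF h(1)] by (simp add: B_def g_self[OF that])
  define \<psi> where "\<psi> u x = pt (u, SOME k. e (g u u) k = x)" for u x
  have \<psi>_sub: "\<psi> u (e (g u t) k) = pt (t, k)" if c: "finite u" "u \<subseteq> I" "t \<subseteq> u" for u t k
  proof -
    obtain j where j: "e (g u u) j = e (g u t) k" using into[OF c(1) subset_refl c(3)] by metis
    then have "e (g u u) (SOME j. e (g u u) j = e (g u t) k) = e (g u t) k" by (rule someI)
    then show ?thesis
      using pt_iff[OF that(1,2) subset_refl that(3)] unfolding \<psi>_def by blast
  qed
  have inj_\<psi>: "inj_on (\<psi> u) (univ (B u))" if "finite u" "u \<subseteq> I" for u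
    unfolding univ_B[OF that(1)]
    using \<psi>_sub[OF that subset_refl] pt_iff[OF that subset_refl subset_refl] by (auto simp: inj_on_def)
  define W where "W u = push L (\<psi> u) (B u)" for u
  have W: "is_struct L (W u)" "iso L (\<psi> u) (B u) (W u)" if "finite u" "u \<subseteq> I" for u
    unfolding W_def using push_iso[OF mods_struct[OF B_mods] inj_\<psi>[OF that]] by auto
  have W_mods: "W u \<in> mods K" if "finite u" "u \<subseteq> I" for u
    using iso_mods[OF B_mods W[OF that]] .
  have le_W: "le K (W t) (W u)" if u: "finite u" "u \<subseteq> I" and tu: "t \<subseteq> u" for t u
  proof -
    have t: "finite t" "t \<subseteq> I" using u tu finite_subset by auto
    let ?A = "restr L N (Nm (set (g u t)))"
    have A: "model_in N (Nm (set (g u t)))" using Nm(1)[OF _ g_X[OF u(1) tu]] by simp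
    have sub: "Nm (set (g u t)) \<subseteq> Nm (set (h (card u)))"
      using Nm(4)[OF _ _ g_set[OF u(1) subset_refl tu]] h(1) by (simp add: g_self[OF u(1)])
    \<comment> \<open>\<open>?A\<close> is the model attached to the part of
      \<open>h (card u)\<close> that represents \<open>t\<close>. Equal colours make \<theta> an
      isomorphism onto \<open>B t\<close> that preserves names, so \<open>W t\<close> is the image
      of \<open>?A\<close> under \<open>\<psi> u\<close>.\<close>
    define \<theta> where "\<theta> x = e (g t t) (SOME k. e (g u t) k = x)" for x
    have eq: "e (g u t) k = e (g u t) j \<longleftrightarrow> e (g t t) k = e (g t t) j" for k j
      using star[OF u(1) tu subset_refl] .
    have \<theta>: "\<theta> (e (g u t) k) = e (g t t) k" for k
    proof -
      have "e (g u t) (SOME j. e (g u t) j = e (g u t) k) = e (g u t) k" by (rule someI) (rule refl)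
      then show ?thesis unfolding \<theta>_def using eq by blast
    qed
    have c: "F (g u t) = F (g t t)" "R (g u t) = R (g t t)"
      using g_col[OF u(1) tu] g_col[OF t(1) subset_refl] by (simp_all add: col_def)
    have "iso L \<theta> (restr L N (range (e (g u t)))) (restr L N (range (e (g t t))))"
    proof (rule iso_of_enumerations)
      show "is_struct L (restr L N (range (e (g u t))))"
        using A model_in_mods mods_struct unfolding range_g[OF u(1) tu] by blast
      show "is_struct L (restr L N (range (e (g t t))))"
        using mods_struct[OF B_mods[of t]] range_g[OF t(1) subset_refl] by (simp add: B_def g_self[OF t(1)])
      show "fint N f (map (e (g u t)) ks) = e (g u t) k \<longleftrightarrow> fint N f (map (e (g t t)) ks) = e (g t t) k"
        if "f \<in> fsyms L" "length ks = farity L f" for f ks k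
      proof -
        have "(f, ks, k) \<in> F (g u t) \<longleftrightarrow> (f, ks, k) \<in> F (g t t)" using c by simp
        then show ?thesis using that by (simp add: F_def)
      qed
      show "map (e (g u t)) ks \<in> rint N r \<longleftrightarrow> map (e (g t t)) ks \<in> rint N r" if "r \<in> rsyms L" for r ks
      proof -
        have "(r, ks) \<in> R (g u t) \<longleftrightarrow> (r, ks) \<in> R (g t t)" using c by simp
        then show ?thesis using that by (simp add: R_def)
      qed
    qed (use eq \<theta> in auto)
    then have "iso L \<theta> ?A (B t)"
      using range_g[OF u(1) tu] range_g[OF t(1) subset_refl] by (simp add: B_def g_self[OF t(1)])
    from iso_comp[OF this W(2)[OF t]] have "iso L (\<psi> t \<circ> \<theta>) ?A (W t)" .
    moreover have "(\<psi> t \<circ> \<theta>) x = \<psi> u x" if x: "x \<in> univ ?A" for x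
    proof -
      obtain k where "x = e (g u t) k" using x range_g[OF u(1) tu] by auto
      then show ?thesis using \<theta> \<psi>_sub[OF u tu] \<psi>_sub[OF t subset_refl] by simp
    qed
    ultimately have i1: "iso L (\<psi> u) ?A (W t)"
      using mods_struct[OF conjunct1[OF model_in_mods[OF A]]] by (rule iso_cong)
    have A_B: "restr L (B u) (Nm (set (g u t))) = ?A" unfolding B_def by (rule restr_restr[OF sub])
    have i2: "iso L (\<psi> u) ?A (restr L (W u) (\<psi> u ` Nm (set (g u t))))"
      "is_struct L (restr L (W u) (\<psi> u ` Nm (set (g u t))))"
      using iso_restr[OF W(2)[OF u] mods_struct[OF B_mods] W(1)[OF u], of "Nm (set (g u t))"]
        sub mods_struct[OF conjunct1[OF model_in_mods[OF A]]] unfolding A_B by (auto simp: B_def)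
    have W_t: "W t = restr L (W u) (\<psi> u ` Nm (set (g u t)))"
      by (rule iso_target_unique[OF i1 i2(1) W(1)[OF t] i2(2)])
    have uW: "univ (W t) = \<psi> u ` Nm (set (g u t))" by (subst W_t) simp
    have "\<psi> u ` Nm (set (g u t)) \<subseteq> univ (W u)" using sub by (auto simp: W_def B_def)
    then have "substruct L (W t) (W u)"
      unfolding substruct_def using W(1)[OF t] W(1)[OF u] W_t uW by simp
    \<comment> \<open>Strongness need not be coded in the colours: both models are strong in
      \<open>N\<close>, so coherence applies.\<close>
    moreover have "le K ?A (B u)" unfolding B_def by (rule model_in_coherent[OF A B(1) sub])
    ultimately show ?thesis
      using le_iso[of ?A "B u" "W t" "W u" "\<psi> u"] W(1)[OF t] W[OF u] uW by simp
  qed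
  obtain U where U: "U \<in> mods K" "\<And>u. finite u \<Longrightarrow> u \<subseteq> I \<Longrightarrow> le K (W u) U"
    using directed_colimit[of I W, OF le_W] by blast
  have emb: "elem_emb K (\<psi> u) (B u) U" if "finite u" "u \<subseteq> I" for u
    using elem_emb_comp[OF iso_elem_emb[OF W(2)[OF that] W_mods[OF that]] le_elem_emb[OF U(2)[OF that]]]
    by simp
  let ?C0 = "Nm (set (h 0))"
  \<comment> \<open>The names of the entries of the tuple placed at \<open>i\<close>; they follow
    the \<open>length p\<close> positions taken by \<open>p\<close>.\<close>
  let ?y = "\<lambda>i. map (\<lambda>k. pt ({i}, k)) [length p..<length p + n]"
  have main: "\<exists>C \<psi>' x1 x2. model_in N C \<and> countable C \<and> ?C0 \<subseteq> C \<and>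
      elem_emb K \<psi>' (restr L N C) U \<and> (\<forall>c\<in>?C0. \<psi>' c = \<psi> {} c) \<and> x1 \<in> X \<and> x2 \<in> X \<and> x1 \<noteq> x2 \<and>
      set x1 \<subseteq> C \<and> set x2 \<subseteq> C \<and> map \<psi>' x1 = ?y i \<and> map \<psi>' x2 = ?y j"
    if ij: "i \<in> I" "j \<in> I" "i < j" for i j
  proof -
    \<comment> \<open>One model and one pair of tuples, the entries of \<open>h 2\<close>, represent
      all pairs \<open>i < j\<close>; only the embedding depends on the pair.\<close>
    let ?u = "{i, j}"
    have u: "finite ?u" "?u \<subseteq> I" "card ?u = 2" using ij by auto
    have sorted: "sorted_list_of_set ?u = [i, j]" using ij(3) by auto
    have g0: "g v {} = []" for v by (simp add: g_def rk_def)
    have "{k \<in> ?u. k < i} = {}" "{k \<in> ?u. k < j} = {i}" using ij(3) by auto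
    then have rk: "rk ?u {i} = [0]" "rk ?u {j} = [1]" by (simp_all add: rk_def)
    have g1: "g ?u {i} = [h 2 ! 0]" "g ?u {j} = [h 2 ! 1]"
      unfolding g_def rk u(3) by simp_all
    have x: "h 2 ! 0 \<in> X" "h 2 ! 1 \<in> X" "h 2 ! 0 \<noteq> h 2 ! 1"
      using h(1)[of 2] h(2)[of 2] h(3)[of 2] nth_mem[of _ "h 2"] by (auto simp: nth_eq_iff_index_eq)
    have len: "length (h 2 ! 0) = n" "length (h 2 ! 1) = n" using x X(1) by (auto simp: nlists_def)
    have "map (\<psi> ?u) z = map (\<lambda>k. pt (t, k)) [length p..<length p + n]"
      if "g ?u t = [z]" "length z = n" "t \<subseteq> ?u" for t z
    proof (rule nth_equalityI)
      fix q assume "q < length (map (\<psi> ?u) z)"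
      then have "z ! q = e (g ?u t) (length p + q)" using that by (simp add: e_def nth_append)
      then show "map (\<psi> ?u) z ! q = map (\<lambda>k. pt (t, k)) [length p..<length p + n] ! q"
        using \<psi>_sub[OF u(1,2) that(3)] \<open>q < _\<close> that(2) by simp
    qed (simp add: that)
    then have y: "map (\<psi> ?u) (h 2 ! 0) = ?y i" "map (\<psi> ?u) (h 2 ! 1) = ?y j"
      using g1 len by auto
    have "set (h 2 ! q) \<subseteq> Nm (set (h 2))" if "q < 2" for q
      using Nm(3)[of "set (h 2)"] h(1)[of 2] h(2)[of 2] that nth_mem[of q "h 2"] by force
    then have sets: "set (h 2 ! 0) \<subseteq> Nm (set (h 2))" "set (h 2 ! 1) \<subseteq> Nm (set (h 2))" by auto
    have h0: "h 0 = []" using h(2)[of 0] by simp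
    have "?C0 \<subseteq> Nm (set (h 2))" using Nm(4)[of "set (h 2)" "set (h 0)"] h0 h(1) by simp
    moreover have "\<forall>c\<in>?C0. \<psi> ?u c = \<psi> {} c"
    proof
      fix c assume "c \<in> ?C0"
      then obtain k where "c = e [] k" using range_e[of "[]"] h0 by auto
      then show "\<psi> ?u c = \<psi> {} c"
        using \<psi>_sub[OF u(1,2), of "{}" k] \<psi>_sub[of "{}" "{}" k] by (simp add: g0)
    qed
    moreover have "elem_emb K (\<psi> ?u) (restr L N (Nm (set (h 2)))) U"
      using emb[OF u(1,2)] by (simp only: B_def u(3))
    ultimately show ?thesis
      using B[of 2] x sets y by (intro exI[of _ "Nm (set (h 2))"] exI[of _ "\<psi> ?u"] exI[of _ "h 2 ! 0"]
        exI[of _ "h 2 ! 1"] conjI)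
  qed
  have pC: "set p \<subseteq> ?C0" using Nm(3)[of "set (h 0)"] h(1) by simp
  have g0: "elem_emb K (\<psi> {}) (restr L N ?C0) U" using emb[of "{}"] by (simp add: B_def)
  show ?thesis
  proof (rule exI[of _ ?C0], rule exI[of _ U], rule exI[of _ "\<psi> {}"], rule exI[of _ ?y], intro conjI)
    show "model_in N ?C0" "countable ?C0" by (rule B)+
    show "set p \<subseteq> ?C0" by (rule pC)
    show "U \<in> mods K" by (rule U(1))
    show "elem_emb K (\<psi> {}) (restr L N ?C0) U" by (rule g0)
  qed (intro ballI impI, rule main)
qed

end

section \<open>Invariant equivalence relations with few classes\<close>

locale large_model = homogeneous_model K N "|univ N|" + inaccessible_class K \<delta>
  for K :: "('u, 'f, 'r) aec" and N :: "('u, 'f, 'r) struct" and \<delta> :: "'u rel" +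
  assumes AP: "AP K"
    and inf_mods: "\<forall>A\<in>mods K. infinite (univ A)"
begin

text \<open>
  Too many classes on \<open>N\<close> would produce, by stretching, \<open>|N|\<close> many inequivalent tuples \<open>y i\<close>
  in some model \<open>D\<close> extending \<open>N\<close>.  As \<open>N\<close> realises types over small models, each \<open>y i\<close> is
  equivalent to a representative \<open>m i\<close> from \<open>N\<close>, and two indices must share it.
\<close>

lemma few_classes:
  assumes E: "E \<in> inv_equivs (monster_ambient K |univ N| N) n A0"
    and A0: "finite A0" "A0 \<subseteq> univ N"
  shows "small (nlists n (univ N) // E)"
proof (rule ccontr)
  let ?Q = "nlists n (univ N) // E"
  let ?S = "monster_ambient K |univ N| N"
  assume many: "\<not> small ?Q"
  have equiv: "equiv (nlists n (univ N)) E" and few: "|?Q| <o |univ N|"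
    and invar: "\<And>f x y. f \<in> autos L N \<Longrightarrow> \<forall>a\<in>A0. f a = a \<Longrightarrow> (x, y) \<in> E \<Longrightarrow> (map f x, map f y) \<in> E"
    using E unfolding inv_equivs_def monster_ambient_def fixing_def by auto
  define X where "X = (\<lambda>q. SOME x. x \<in> q) ` ?Q"
  have rep: "(SOME x. x \<in> q) \<in> q" if "q \<in> ?Q" for q
    using in_quotient_imp_non_empty[OF equiv that] by (simp add: some_in_eq)
  have X_sub: "X \<subseteq> nlists n (univ N)"
    using rep in_quotient_imp_subset[OF equiv] unfolding X_def by blast
  have Q_X: "?Q = (\<lambda>x. E `` {x}) ` X"
  proof -
    have "E `` {SOME x. x \<in> q} = q" if "q \<in> ?Q" for q
      using rep[OF that] that equiv by (metis Image_singleton_iff equiv_class_eq quotientE)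
    then show ?thesis unfolding X_def image_image by simp
  qed
  have X_inj: "x = x'" if xx: "x \<in> X" "x' \<in> X" "(x, x') \<in> E" for x x'
  proof -
    obtain q q' where q: "q \<in> ?Q" "q' \<in> ?Q" "x = (SOME x. x \<in> q)" "x' = (SOME x. x \<in> q')"
      using xx(1,2) unfolding X_def by blast
    then have "x \<in> q" "x' \<in> q'" using rep by auto
    then have "q = q'" using quotient_eq_iff[OF equiv q(1,2)] xx(3) by blast
    then show ?thesis using q by simp
  qed
  have X_rep: "\<exists>m\<in>X. (z, m) \<in> E" if "z \<in> nlists n (univ N)" for z
  proof -
    have "E `` {z} \<in> (\<lambda>x. E `` {x}) ` X" using quotientI[OF that, of E] Q_X by simp
    then obtain m where m: "E `` {z} = E `` {m}" "m \<in> X" by (rule imageE)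
    then have "(z, m) \<in> E" using X_sub by (intro eq_equiv_class[OF _ equiv]) auto
    then show ?thesis using m(2) by blast
  qed
  have X_many: "\<not> small X" using many small_image unfolding Q_X by blast
  then have "infinite X" using small_finite by blast
  then have r: "Cinfinite |X|" by (simp add: cinfinite_def Field_card_of card_of_card_order_on)
  have X_few: "|X| <o |univ N|"
    unfolding X_def by (rule ordLeq_ordLess_trans[OF card_of_image few])
  have inf_N: "infinite (univ N)" using inf_mods N by blast
  \<comment> \<open>As many indices as \<open>N\<close> has points, hence more than there are
    classes: this forces the collision \<open>m i = m j\<close> below.\<close>
  define I where "I = Abs_wo ` univ N"
  have "inj_on Abs_wo (univ N)" by (simp add: inj_on_def Abs_wo_inject)
  then have I_card: "|I| =o |univ N|"
    unfolding I_def using card_of_ordIso inj_on_imp_bij_betw ordIso_symmetric by blast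
  then have I: "infinite I" "|I| \<le>o |UNIV :: 'u set|"
    using inf_N card_of_ordIso_finite ordIso_ordLeq_trans[OF I_card card_of_mono1[OF subset_UNIV]] by blast+
  obtain p where p: "set p = A0" using A0(1) finite_list by blast
  have "\<exists>C0 U g0 y. model_in N C0 \<and> countable C0 \<and> set p \<subseteq> C0 \<and> U \<in> mods K \<and>
    elem_emb K g0 (restr L N C0) U \<and>
    (\<forall>i\<in>I. \<forall>j\<in>I. i < j \<longrightarrow> (\<exists>C \<psi> x1 x2. model_in N C \<and> countable C \<and> C0 \<subseteq> C \<and>
      elem_emb K \<psi> (restr L N C) U \<and> (\<forall>c\<in>C0. \<psi> c = g0 c) \<and> x1 \<in> X \<and> x2 \<in> X \<and> x1 \<noteq> x2 \<and>
      set x1 \<subseteq> C \<and> set x2 \<subseteq> C \<and> map \<psi> x1 = y i \<and> map \<psi> x2 = y j))"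
    by (rule EM_model[OF N inf_mods I _ X_sub X_many]) (use A0 p in auto)
  then obtain C0 U g0 y where C0: "model_in N C0" "countable C0" "A0 \<subseteq> C0"
    and U: "U \<in> mods K" "elem_emb K g0 (restr L N C0) U"
    and EM: "\<forall>i\<in>I. \<forall>j\<in>I. i < j \<longrightarrow> (\<exists>C \<psi> x1 x2. model_in N C \<and> countable C \<and> C0 \<subseteq> C \<and>
      elem_emb K \<psi> (restr L N C) U \<and> (\<forall>c\<in>C0. \<psi> c = g0 c) \<and> x1 \<in> X \<and> x2 \<in> X \<and> x1 \<noteq> x2 \<and>
      set x1 \<subseteq> C \<and> set x2 \<subseteq> C \<and> map \<psi> x1 = y i \<and> map \<psi> x2 = y j)"
    unfolding p by (elim exE conjE)
  \<comment> \<open>Amalgamation over \<open>C0\<close> identifies the two copies of the parameters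
    \<open>A0\<close> and brings the new tuples together with the old representatives.\<close>
  have "\<exists>D\<in>mods K. \<exists>f' g'. elem_emb K f' N D \<and> elem_emb K g' U D \<and>
      (\<forall>x\<in>univ (restr L N C0). f' (id x) = g' (g0 x))"
    using AP model_in_mods[OF C0(1)] N U elem_emb_inclusion[OF C0(1)] unfolding AP_def by blast
  then obtain D f' g' where D: "D \<in> mods K" "elem_emb K f' N D" "elem_emb K g' U D"
    "\<And>x. x \<in> C0 \<Longrightarrow> f' x = g' (g0 x)" by auto
  have countable_le: "|Z| \<le>o |X|" if "countable Z" for Z :: "'u set"
  proof -
    have "|Z| \<le>o natLeq"
      using that card_of_nat by (meson card_of_ordLeq countableE ordLeq_ordIso_trans subset_UNIV)
    moreover have "natLeq \<le>o |X|" using \<open>infinite X\<close> infinite_iff_natLeq_ordLeq by blast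
    ultimately show ?thesis by (rule ordLeq_transitive)
  qed
  have "|\<Union>x\<in>X. set x| \<le>o |X|"
    by (rule UNION_Cinfinite_bound[OF _ _ r])
      (auto simp: card_of_refl ordIso_imp_ordLeq intro!: countable_le countable_finite)
  then have "|(\<Union>x\<in>X. set x) \<union> C0| \<le>o |X|" by (rule Un_Cinfinite_bound[OF _ countable_le[OF C0(2)] r])
  moreover have "(\<Union>x\<in>X. set x) \<union> C0 \<subseteq> univ N"
    using X_sub model_in_subset[OF C0(1)] by (auto simp: nlists_def)
  \<comment> \<open>A model of size below |N| that contains the parameters and all class
    representatives, so automorphisms fixing it fix every \<open>m i\<close>.\<close>
  ultimately obtain M1 where M1: "(\<Union>x\<in>X. set x) \<union> C0 \<subseteq> M1" "model_in N M1" "|M1| \<le>o |X|"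
    using LS_model[OF N _ _ r] by blast
  have M1_model: "is_model K N |univ N| M1"
    using M1 X_few ordLeq_ordLess_trans by (auto simp: is_model_iff)
  have f'M1: "elem_emb K f' (restr L N M1) D" by (rule elem_emb_model_in(3)[OF D(2) M1(2)])
  have f'M1_sub: "f' ` M1 \<subseteq> univ D" using f'M1 model_in_subset by (auto simp: elem_emb_iff)
  have realise: "\<exists>Q \<rho>. model_in D Q \<and> |Q| \<le>o |X| \<and> f' ` M1 \<subseteq> Q \<and> Z \<subseteq> Q \<and>
      elem_emb K \<rho> (restr L D Q) N \<and> (\<forall>x\<in>M1. \<rho> (f' x) = x)"
    if Z: "Z \<subseteq> univ D" "|Z| \<le>o |X|" for Z
  proof -
    have card: "|f' ` M1 \<union> Z| \<le>o |X|"
      by (rule Un_Cinfinite_bound[OF ordLeq_transitive[OF card_of_image M1(3)] Z(2) r])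
    have "f' ` M1 \<union> Z \<subseteq> univ D" using f'M1_sub Z(1) by simp
    then obtain Q where Q: "f' ` M1 \<union> Z \<subseteq> Q" "model_in D Q" "|Q| \<le>o |X|"
      by (rule LS_model[OF D(1) _ card r])
    have emb: "elem_emb K f' (restr L N M1) (restr L D Q)"
      using Q(1) by (intro elem_emb_into[OF f'M1 Q(2)]) auto
    have "|univ (restr L D Q)| <o |univ N|" using ordLeq_ordLess_trans[OF Q(3) X_few] by simp
    from embed_over[OF conjunct1[OF model_in_mods[OF Q(2)]] this M1_model emb]
    show ?thesis using Q by blast
  qed
  have *: "length w = n \<and> set w \<subseteq> univ U"
    if emb: "elem_emb K \<psi> (restr L N C) U" and x: "set x \<subseteq> C" "x \<in> X" "map \<psi> x = w" for \<psi> C x w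
  proof -
    have "\<psi> ` C \<subseteq> univ U" using emb model_in_subset by (auto simp: elem_emb_iff)
    then have "set w \<subseteq> univ U" unfolding x(3)[symmetric] using x(1) by auto
    moreover have "length w = n" unfolding x(3)[symmetric] using x(2) X_sub by (auto simp: nlists_def)
    ultimately show ?thesis by blast
  qed
  have y_pair: "(length (y i) = n \<and> set (y i) \<subseteq> univ U) \<and> (length (y j) = n \<and> set (y j) \<subseteq> univ U)"
    if ij: "i \<in> I" "j \<in> I" "i < j" for i j
  proof -
    obtain C \<psi> x1 x2 where "elem_emb K \<psi> (restr L N C) U" "x1 \<in> X" "x2 \<in> X" "set x1 \<subseteq> C" "set x2 \<subseteq> C"
      "map \<psi> x1 = y i" "map \<psi> x2 = y j"
      using EM ij by metis
    then show ?thesis using * by blast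
  qed
  have y: "length (y i) = n \<and> set (y i) \<subseteq> univ U" if i: "i \<in> I" for i
  proof -
    have "\<exists>j\<in>I. j \<noteq> i" using I(1) by (metis finite.emptyI finite_insert finite_subset insertCI subsetI)
    then obtain j where "j \<in> I" "i < j \<or> j < i" by (metis linorder_neqE)
    then show ?thesis using y_pair i by blast
  qed
  have g'_sub: "g' ` univ U \<subseteq> univ D" using D(3) model_in_subset by (auto simp: elem_emb_iff)
  define w where "w i = map g' (y i)" for i
  have w: "length (w i) = n \<and> set (w i) \<subseteq> univ D" if "i \<in> I" for i
    using y[OF that] g'_sub by (auto simp: w_def)
  define real where "real i Q \<rho> \<longleftrightarrow> model_in D Q \<and> |Q| \<le>o |X| \<and> f' ` M1 \<subseteq> Q \<and> set (w i) \<subseteq> Q \<and>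
      elem_emb K \<rho> (restr L D Q) N \<and> (\<forall>x\<in>M1. \<rho> (f' x) = x)" for i Q \<rho>
  have "\<exists>Q \<rho>. real i Q \<rho>" if "i \<in> I" for i
    unfolding real_def using realise[OF conjunct2[OF w[OF that]] countable_le[OF countable_finite]] by simp
  then obtain Q \<rho> where "\<And>i. i \<in> I \<Longrightarrow> real i (Q i) (\<rho> i)" by metis
  then have Q: "\<And>i. i \<in> I \<Longrightarrow> model_in D (Q i)" "\<And>i. i \<in> I \<Longrightarrow> |Q i| \<le>o |X|"
    "\<And>i. i \<in> I \<Longrightarrow> f' ` M1 \<subseteq> Q i" "\<And>i. i \<in> I \<Longrightarrow> set (w i) \<subseteq> Q i"
    and \<rho>: "\<And>i. i \<in> I \<Longrightarrow> elem_emb K (\<rho> i) (restr L D (Q i)) N"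
    "\<And>i x. i \<in> I \<Longrightarrow> x \<in> M1 \<Longrightarrow> \<rho> i (f' x) = x"
    unfolding real_def by simp_all
  have z: "map (\<rho> i) (w i) \<in> nlists n (univ N)" if "i \<in> I" for i
  proof -
    have "\<rho> i ` Q i \<subseteq> univ N"
      using \<rho>(1)[OF that] model_in_subset[of N "\<rho> i ` Q i"] by (simp add: elem_emb_iff)
    then have "\<rho> i ` set (w i) \<subseteq> univ N" by (rule order_trans[OF image_mono[OF Q(4)[OF that]]])
    then show ?thesis using w[OF that] by (simp add: nlists_def)
  qed
  have "\<exists>m. \<forall>i\<in>I. m i \<in> X \<and> (map (\<rho> i) (w i), m i) \<in> E"
    by (rule bchoice) (use X_rep[OF z] in blast)
  then obtain m where m: "\<And>i. i \<in> I \<Longrightarrow> m i \<in> X" "\<And>i. i \<in> I \<Longrightarrow> (map (\<rho> i) (w i), m i) \<in> E"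
    by blast
  have "\<not> inj_on m I"
  proof
    assume "inj_on m I"
    then have "|I| \<le>o |X|" using m(1) card_of_ordLeq by blast
    then show False using I_card X_few by (meson not_ordLess_ordIso ordLeq_ordLess_trans)
  qed
  then obtain i j where ij: "i \<in> I" "j \<in> I" "i < j" "m i = m j"
    unfolding inj_on_def by (metis linorder_neqE)
  obtain C \<psi> x1 x2 where C: "model_in N C" "countable C" "C0 \<subseteq> C" "elem_emb K \<psi> (restr L N C) U"
    "\<And>c. c \<in> C0 \<Longrightarrow> \<psi> c = g0 c" and x: "x1 \<in> X" "x2 \<in> X" "x1 \<noteq> x2" "set x1 \<subseteq> C" "set x2 \<subseteq> C"
    "map \<psi> x1 = y i" "map \<psi> x2 = y j"
    using EM ij(1-3) by metis
  let ?e = "g' \<circ> \<psi>"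
  have e: "elem_emb K ?e (restr L N C) D" by (rule elem_emb_comp[OF C(4) D(3)])
  have e_sub: "?e ` C \<subseteq> univ D" using e model_in_subset by (auto simp: elem_emb_iff)
  have "|Q i \<union> Q j \<union> ?e ` C| \<le>o |X|"
    using C(2) by (intro Un_Cinfinite_bound[OF Un_Cinfinite_bound[OF Q(2)[OF ij(1)] Q(2)[OF ij(2)] r] countable_le r]) auto
  moreover have "Q i \<union> Q j \<union> ?e ` C \<subseteq> univ D"
    using model_in_subset[OF Q(1)[OF ij(1)]] model_in_subset[OF Q(1)[OF ij(2)]] e_sub by simp
  ultimately obtain Q' \<rho>' where Q': "model_in D Q'" "Q i \<union> Q j \<union> ?e ` C \<subseteq> Q'"
    and \<rho>': "elem_emb K \<rho>' (restr L D Q') N" "\<And>x. x \<in> M1 \<Longrightarrow> \<rho>' (f' x) = x"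
    using realise by metis
  \<comment> \<open>\<open>\<rho> k\<close> and \<open>\<rho>'\<close> agree over \<open>M1\<close>;
    homogeneity gives an automorphism over \<open>M1\<close> between their images of
    \<open>Q k\<close>, so \<open>w k\<close> lands in the same class under both.\<close>
  have move: "(map \<rho>' (w k), m k) \<in> E" if k: "k \<in> I" "Q k \<subseteq> Q'" for k
  proof -
    have Qk: "model_in (restr L D Q') (Q k)" using model_in_restr[OF Q(1)[OF k(1)] Q'(1) k(2)] .
    have "elem_emb K \<rho>' (restr L D (Q k)) N"
      using elem_emb_model_in(3)[OF \<rho>'(1) Qk] by (simp add: restr_restr[OF k(2)])
    moreover have "elem_emb K (inv_into (Q k) (\<rho> k)) (restr L N (\<rho> k ` Q k)) (restr L D (Q k))"
      using elem_emb_inv[OF \<rho>(1)[OF k(1)]] model_in_mods[OF Q(1)[OF k(1)]] by simp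
    ultimately have emb: "elem_emb K (\<rho>' \<circ> inv_into (Q k) (\<rho> k)) (restr L N (\<rho> k ` Q k)) N"
      by (rule elem_emb_comp[rotated])
    have inj: "inj_on (\<rho> k) (Q k)" using \<rho>(1)[OF k(1)] iso_inj unfolding elem_emb_iff by fastforce
    have "is_model K N |univ N| (\<rho> k ` Q k)"
      using \<rho>(1)[OF k(1)] ordLeq_ordLess_trans[OF ordLeq_transitive[OF card_of_image Q(2)[OF k(1)]] X_few]
      by (auto simp: is_model_iff elem_emb_iff)
    from extend_to_auto[OF this emb] obtain \<sigma> where \<sigma>: "\<sigma> \<in> autos L N"
      "\<And>q. q \<in> Q k \<Longrightarrow> \<sigma> (\<rho> k q) = \<rho>' q"
      using inj by auto
    have fixed: "\<sigma> x = x" if "x \<in> M1" for x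
    proof -
      have "f' x \<in> Q k" using Q(3)[OF k(1)] that by blast
      then show ?thesis using \<sigma>(2)[of "f' x"] \<rho>(2)[OF k(1) that] \<rho>'(2)[OF that] by simp
    qed
    have "(map \<sigma> (map (\<rho> k) (w k)), map \<sigma> (m k)) \<in> E"
      by (rule invar[OF \<sigma>(1) _ m(2)[OF k(1)]]) (use fixed C0 M1 in blast)
    moreover have "map \<sigma> (m k) = m k" using fixed M1(1) m(1)[OF k(1)] by (intro map_idI) blast
    moreover have "map \<sigma> (map (\<rho> k) (w k)) = map \<rho>' (w k)" using \<sigma>(2) Q(4)[OF k(1)] by auto
    ultimately show ?thesis by (simp only:)
  qed
  have "(map \<rho>' (w i), m i) \<in> E" "(map \<rho>' (w j), m i) \<in> E"
    using move[of i] move[of j] ij Q'(2) by auto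
  then have wE: "(map \<rho>' (w i), map \<rho>' (w j)) \<in> E"
    using equiv unfolding equiv_def by (meson symE transE)
  have "elem_emb K ?e (restr L N C) (restr L D Q')"
    using Q'(2) by (intro elem_emb_into[OF e Q'(1)]) auto
  from elem_emb_comp[OF this \<rho>'(1)] have emb: "elem_emb K (\<rho>' \<circ> ?e) (restr L N C) N" .
  \<comment> \<open>\<open>y i\<close>, \<open>y j\<close> is a copy of \<open>x1\<close>,
    \<open>x2\<close> over \<open>A0\<close>. Pulling the equivalence back along \<tau> relates two
    distinct representatives.\<close>
  have "is_model K N |univ N| C"
    using C(1) ordLeq_ordLess_trans[OF countable_le[OF C(2)] X_few] by (simp add: is_model_iff)
  from extend_to_auto[OF this emb] obtain \<tau> where \<tau>: "\<tau> \<in> autos L N"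
    "\<And>c. c \<in> C \<Longrightarrow> \<tau> c = \<rho>' (g' (\<psi> c))" by auto
  have fixed: "\<tau> a = a" if "a \<in> A0" for a
  proof -
    have "a \<in> C0" "a \<in> C" "a \<in> M1" using that C0 C(3) M1(1) by auto
    then show ?thesis using \<tau>(2)[of a] C(5)[of a] D(4)[of a] \<rho>'(2)[of a] by simp
  qed
  have "map \<tau> x1 = map \<rho>' (w i)" "map \<tau> x2 = map \<rho>' (w j)"
    using x(4,5) \<tau>(2) unfolding w_def x(6)[symmetric] x(7)[symmetric] by auto
  then have tE: "(map \<tau> x1, map \<tau> x2) \<in> E" using wE by simp
  let ?k = "inv_into (univ N) \<tau>"
  have inj: "inj_on \<tau> (univ N)" using \<tau>(1) iso_inj by (auto simp: autos_def)
  have "?k a = a" if "a \<in> A0" for a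
    using inv_into_f_f[OF inj, of a] fixed[OF that] that A0(2) by auto
  then have "(map ?k (map \<tau> x1), map ?k (map \<tau> x2)) \<in> E"
    using invar[OF auto_inv[OF \<tau>(1)] _ tE] by blast
  moreover have "set x1 \<subseteq> univ N" "set x2 \<subseteq> univ N" using x(1,2) X_sub by (auto simp: nlists_def)
  ultimately have "(x1, x2) \<in> E" by (simp only: map_inv_into[OF inj])
  then show False using X_inj x(1-3) by blast
qed

end

section \<open>Conjugacy\<close>

text \<open>Equality of Galois types as an explicit automorphism, which composes and restricts more
  easily than equality of orbits.\<close>

definition conjugate :: "('x, 'c) ambient \<Rightarrow> 'x set \<Rightarrow> 'x list \<Rightarrow> 'x list \<Rightarrow> bool" where
  "conjugate S A x y \<longleftrightarrow> (\<exists>f\<in>fixing S A. map f x = y)"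

lemma conjugate_mono: "conjugate S A x y \<Longrightarrow> B \<subseteq> A \<Longrightarrow> conjugate S B x y"
  unfolding conjugate_def fixing_def by blast

lemma conjugate_length: "conjugate S A x y \<Longrightarrow> length x = length y"
  unfolding conjugate_def by auto

lemma conjugate_map: "f \<in> aut S \<Longrightarrow> (\<And>a. a \<in> A \<Longrightarrow> f a = a) \<Longrightarrow> conjugate S A x (map f x)"
  unfolding conjugate_def fixing_def by blast

lemma conjugate_append:
  assumes "length x = length y"
  shows "conjugate S A (x @ c) (y @ c) \<longleftrightarrow> conjugate S (A \<union> set c) x y"
proof -
  have "map f (x @ c) = y @ c \<longleftrightarrow> map f x = y \<and> (\<forall>z\<in>set c. f z = z)" for f
    using assms by (auto intro: map_idI simp: map_eq_conv[of _ _ id, simplified])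
  then show ?thesis unfolding conjugate_def fixing_def by auto
qed

text \<open>Instantiated by M, M' and Meq. Inverses are required on points only, as automorphisms
  are unconstrained elsewhere.\<close>

locale ambient_group =
  fixes S :: "('x, 'c) ambient"
  assumes id_aut: "id \<in> aut S"
    and comp_aut: "f \<in> aut S \<Longrightarrow> g \<in> aut S \<Longrightarrow> f \<circ> g \<in> aut S"
    and aut_pts: "f \<in> aut S \<Longrightarrow> x \<in> pts S \<Longrightarrow> f x \<in> pts S"
    and inv_aut: "f \<in> aut S \<Longrightarrow> \<exists>g\<in>aut S. \<forall>x\<in>pts S. g (f x) = x \<and> f (g x) = x"
begin

lemma conjugate_refl: "conjugate S A x x"
  using conjugate_map[OF id_aut, of A x] by simp

lemma conjugate_trans:
  assumes "conjugate S A x y" "conjugate S A y z"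
  shows "conjugate S A x z"
proof -
  obtain f g where "f \<in> fixing S A" "g \<in> fixing S A" "map f x = y" "map g y = z"
    using assms unfolding conjugate_def by blast
  moreover from this have "g \<circ> f \<in> fixing S A" unfolding fixing_def using comp_aut by auto
  ultimately show ?thesis unfolding conjugate_def by (metis map_map)
qed

lemma conjugate_sym:
  assumes "conjugate S A x y" "x \<in> lists (pts S)" "A \<subseteq> pts S"
  shows "conjugate S A y x"
proof -
  obtain f where f: "f \<in> fixing S A" "map f x = y" using assms unfolding conjugate_def by blast
  obtain g where g: "g \<in> aut S" "\<And>x. x \<in> pts S \<Longrightarrow> g (f x) = x"
    using inv_aut f(1) unfolding fixing_def by blast
  have "map g y = x" using g(2) assms(2) unfolding f(2)[symmetric] by (auto intro: map_idI)
  moreover have "g \<in> fixing S A" using f(1) g assms(3) unfolding fixing_def by force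
  ultimately show ?thesis unfolding conjugate_def by blast
qed

lemma conjugate_lists: "conjugate S A x y \<Longrightarrow> x \<in> lists (pts S) \<Longrightarrow> y \<in> lists (pts S)"
  unfolding conjugate_def fixing_def using aut_pts by auto

lemma conjugate_transport:
  assumes "conjugate S A x y" "f \<in> aut S" "x \<in> lists (pts S)" "A \<subseteq> pts S"
  shows "conjugate S (f ` A) (map f x) (map f y)"
proof -
  obtain h where h: "h \<in> aut S" "\<And>a. a \<in> A \<Longrightarrow> h a = a" "map h x = y"
    using assms(1) unfolding conjugate_def fixing_def by blast
  obtain g where g: "g \<in> aut S" "\<And>x. x \<in> pts S \<Longrightarrow> g (f x) = x"
    using inv_aut[OF assms(2)] by blast
  have "f \<circ> h \<circ> g \<in> fixing S (f ` A)"
    using comp_aut g h assms unfolding fixing_def by (auto simp: subset_iff)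
  moreover have "map (f \<circ> h \<circ> g) (map f x) = map f y"
    using assms(3) g(2) unfolding h(3)[symmetric] by auto
  ultimately show ?thesis unfolding conjugate_def by blast
qed

lemma gtp_eq_iff:
  assumes "a \<in> lists (pts S)" "A \<subseteq> pts S"
  shows "gtp S A a = gtp S A b \<longleftrightarrow> conjugate S A a b"
proof
  have gtp: "gtp S A c = {x. conjugate S A c x}" for c
    unfolding gtp_def conjugate_def by blast
  show "conjugate S A a b" if "gtp S A a = gtp S A b"
    using that conjugate_refl unfolding gtp by blast
  show "gtp S A a = gtp S A b" if "conjugate S A a b"
    using that conjugate_trans conjugate_sym[OF that assms] unfolding gtp by blast
qed

lemma wtp_eq_iff:
  assumes "a \<in> lists (pts S)" "A \<subseteq> pts S"
  shows "wtp_eq S A a b \<longleftrightarrow> (\<forall>B\<subseteq>A. finite B \<longrightarrow> conjugate S B a b)"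
  using gtp_eq_iff[OF assms(1)] assms(2) unfolding wtp_eq_def by (meson order_trans)

end

lemma autos_id: "id \<in> autos L A"
  by (simp add: autos_def iso_id)

lemma autos_comp: "f \<in> autos L A \<Longrightarrow> g \<in> autos L A \<Longrightarrow> f \<circ> g \<in> autos L A"
  unfolding autos_def using iso_comp by blast

lemma autos_univ: "f \<in> autos L A \<Longrightarrow> x \<in> univ A \<Longrightarrow> f x \<in> univ A"
  unfolding autos_def using iso_image by blast

lemma autos_inv:
  assumes "f \<in> autos L A" "is_struct L A"
  shows "\<exists>g\<in>autos L A. \<forall>x\<in>univ A. g (f x) = x \<and> f (g x) = x"
proof
  have f: "iso L f A A" using assms(1) by (simp add: autos_def)
  show "inv_into (univ A) f \<in> autos L A" using iso_inv[OF f assms(2)] by (simp add: autos_def)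
  show "\<forall>x\<in>univ A. inv_into (univ A) f (f x) = x \<and> f (inv_into (univ A) f x) = x"
    using iso_inj[OF f] iso_image[OF f] by (auto simp: f_inv_into_f)
qed

lemma pts_monster [simp]: "pts (monster_ambient K \<kappa> N) = univ N"
  and aut_monster [simp]: "aut (monster_ambient K \<kappa> N) = autos (lang K) N"
  and bound_monster [simp]: "bound (monster_ambient K \<kappa> N) = \<kappa>"
  by (simp_all add: monster_ambient_def)

lemma (in aec_class) monster_ambient_group:
  assumes "N \<in> mods K"
  shows "ambient_group (monster_ambient K \<kappa> N)"
proof
  show "\<exists>g\<in>aut (monster_ambient K \<kappa> N). \<forall>x\<in>pts (monster_ambient K \<kappa> N). g (f x) = x \<and> f (g x) = x"
    if "f \<in> aut (monster_ambient K \<kappa> N)" for f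
    using that autos_inv[of f L N, OF _ mods_struct[OF assms]] by simp
qed (simp_all add: autos_id autos_comp autos_univ)

section \<open>The monster inside the supermonster\<close>

text \<open>M' is homogeneous and universal up to its own size, M up to \<delta>;
  \<open>small\<close> always refers to \<delta>.\<close>

locale fur = large_model K M' \<delta> + M: homogeneous_model K M \<delta>
  for K :: "('u, 'f, 'r) aec" and \<delta> :: "'u rel" and M M' :: "('u, 'f, 'r) struct" +
  assumes M_M': "le K M M'" and M_less: "|univ M| <o |univ M'|"
    and AI: "axiom_AI K \<delta> M" and large: "arbitrarily_large K"
begin

abbreviation S where "S \<equiv> monster_ambient K \<delta> M"
abbreviation S' where "S' \<equiv> monster_ambient K |univ M'| M'"

sublocale S: ambient_group S
  by (rule monster_ambient_group[OF M.N])

sublocale S': ambient_group S'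
  by (rule monster_ambient_group[OF N])

lemma M_sub: "univ M \<subseteq> univ M'"
  by (rule le_univ[OF M_M'])

lemma small_model:
  assumes "A \<in> mods K" "X \<subseteq> univ A" "small X"
  obtains Y where "X \<subseteq> Y" "model_in A Y" "small Y"
proof -
  obtain B where B: "le K B A" "X \<subseteq> univ B" "|univ B| \<le>o |X| +c natLeq"
    using LS assms(1,2) unfolding LS_property_def by blast
  have "|X| +c natLeq = |Inl ` X \<union> Inr ` (UNIV :: nat set)|"
    by (simp add: csum_def Field_card_of Field_natLeq Plus_def)
  moreover have "small (Inl ` X \<union> Inr ` (UNIV :: nat set))"
    by (intro small_Un small_image assms(3) small_countable) auto
  ultimately have "small (univ B)" using B(3) small_ordLeq by metis
  then show ?thesis using that B le_model_in by blast
qed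

text \<open>Otherwise some small model would have size at least that of the power set of M, and
  universality would embed it into M.\<close>

lemma M_not_small: "\<not> small (univ M)"
proof
  assume "small (univ M)"
  then have "small (Pow (univ M))" by (rule small_Pow)
  then obtain X :: "'u set" where X: "|Pow (univ M)| =o |X|" "small X" by (rule small_iso)
  obtain A where A: "A \<in> mods K" "|X| \<le>o |univ A|" using large unfolding arbitrarily_large_def by blast
  then obtain h where h: "inj_on h X" "h ` X \<subseteq> univ A" using card_of_ordLeq by metis
  obtain Y where Y: "h ` X \<subseteq> Y" "model_in A Y" "small Y"
    by (rule small_model[OF A(1) h(2) small_image[OF X(2)]])
  have "|univ (restr L A Y)| <o \<delta>" using Y(3) by (simp add: small_def)
  then obtain f where f: "elem_emb K f (restr L A Y) M"
    using M.universal model_in_mods[OF Y(2)] unfolding universal_def by blast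
  then have "inj_on f Y" "f ` Y \<subseteq> univ M" using iso_inj model_in_subset unfolding elem_emb_iff by fastforce+
  then have "|Y| \<le>o |univ M|" using card_of_ordLeq by blast
  moreover have "|X| \<le>o |Y|" using h(1) Y(1) card_of_ordLeq by blast
  ultimately have "|Pow (univ M)| \<le>o |univ M|"
    using X(1) ordIso_ordLeq_trans ordLeq_transitive by blast
  then show False using card_of_Pow not_ordLess_ordLeq by blast
qed

lemma small_less: "small Y \<Longrightarrow> |Y| <o |univ M'|"
  using not_small_ordLess[OF M_not_small] M_less ordLess_transitive by blast

text \<open>A small model around the set embeds into M over \<open>C\<close> by saturation of M;
  homogeneity of M' extends this embedding to an automorphism. This is how tuples of M' are replaced
  by tuples of M.\<close>

lemma move_into_M:
  assumes "X \<subseteq> univ M'" "small X" "C \<subseteq> univ M" "small C"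
  shows "\<exists>F\<in>fixing S' C. F ` X \<subseteq> univ M"
proof -
  obtain M1 where M1: "C \<subseteq> M1" "model_in M M1" "small M1"
    by (rule small_model[OF M.N assms(3,4)])
  note M1' = le_model_in_trans[OF M_M' M1(2)]
  have sub: "M1 \<union> X \<subseteq> univ M'" using model_in_subset[OF M1'(1)] assms(1) by simp
  obtain Q where Q: "M1 \<union> X \<subseteq> Q" "model_in M' Q" "small Q"
    by (rule small_model[OF N sub small_Un[OF M1(3) assms(2)]])
  have "le K (restr L M M1) (restr L M' Q)"
    using model_in_coherent[OF M1'(1) Q(2)] Q(1) unfolding M1'(2) by simp
  then have emb: "elem_emb K id (restr L M M1) (restr L M' Q)" by (rule le_elem_emb)
  have "is_model K M \<delta> M1" using M1 by (simp add: M.is_model_iff small_def)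
  moreover have "|univ (restr L M' Q)| <o \<delta>" using Q(3) by (simp add: small_def)
  ultimately obtain h where h: "elem_emb K h (restr L M' Q) M" "\<And>x. x \<in> M1 \<Longrightarrow> h x = x"
    using M.embed_over[OF conjunct1[OF model_in_mods[OF Q(2)]] _ _ emb] by auto
  have "elem_emb K h (restr L M' Q) M'" using elem_emb_comp[OF h(1) le_elem_emb[OF M_M']] by simp
  moreover have "is_model K M' |univ M'| Q" using Q small_less by (simp add: is_model_iff)
  ultimately obtain F where F: "F \<in> autos L M'" "\<And>x. x \<in> Q \<Longrightarrow> F x = h x"
    using extend_to_auto by blast
  have "h ` Q \<subseteq> univ M" using h(1) model_in_subset[of M "h ` Q"] by (simp add: elem_emb_iff)
  then have "F ` X \<subseteq> univ M" using F(2) Q(1) by (metis image_cong image_mono le_sup_iff order_trans)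
  moreover have "F x = x" if "x \<in> C" for x
  proof -
    have "x \<in> M1" "x \<in> Q" using that M1(1) Q(1) by auto
    then show ?thesis using F(2) h(2) by simp
  qed
  then have "F \<in> fixing S' C" using F(1) by (simp add: fixing_def)
  ultimately show ?thesis by blast
qed

lemma restrict_auto:
  assumes F: "F \<in> autos L M'" and Y: "Y \<subseteq> univ M" "small Y" "F ` Y \<subseteq> univ M"
  shows "\<exists>f\<in>autos L M. \<forall>y\<in>Y. f y = F y"
proof -
  obtain M1 where M1: "Y \<subseteq> M1" "model_in M M1" "small M1"
    by (rule small_model[OF M.N Y(1,2)])
  note M1' = le_model_in_trans[OF M_M' M1(2)]
  have "F ` M1 \<subseteq> univ M'" using autos_univ[OF F] model_in_subset[OF M1'(1)] by blast
  then obtain F2 where F2: "F2 \<in> fixing S' (F ` Y)" "F2 ` F ` M1 \<subseteq> univ M"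
    using move_into_M[OF _ small_image[OF M1(3)] Y(3) small_image[OF Y(2)]] by blast
  let ?G = "F2 \<circ> F"
  have "?G \<in> autos L M'" using F2(1) F autos_comp unfolding fixing_def by auto
  note G = elem_emb_model_in[OF autos_elem_emb[OF N this] M1'(1)]
  have "model_in M (?G ` M1)"
    using le_model_in_back[OF M_M' G(1)] F2(2) by (simp add: image_comp)
  note bk = this le_model_in_trans[OF M_M' this]
  have "elem_emb K ?G (restr L M M1) M"
    using bk(1) G(2)[unfolded M1'(2) bk(3)] unfolding elem_emb_iff univ_restr by (rule conjI)
  moreover have "is_model K M \<delta> M1" using M1 by (simp add: M.is_model_iff small_def)
  ultimately obtain f where f: "f \<in> autos L M" "\<And>x. x \<in> M1 \<Longrightarrow> f x = ?G x"
    using M.extend_to_auto by blast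
  then have "f y = F y" if "y \<in> Y" for y
    using that M1(1) F2(1) unfolding fixing_def by auto
  then show ?thesis using f(1) by blast
qed

text \<open>Automorphisms of M in a form that also acts on realisations of global types.\<close>

definition \<G> :: "('u \<Rightarrow> 'u) set" where
  "\<G> = {F \<in> autos L M'. F ` univ M = univ M}"

lemma G_autos: "F \<in> \<G> \<Longrightarrow> F \<in> autos L M'"
  by (simp add: \<G>_def)

lemma G_autos_M:
  assumes "F \<in> \<G>"
  shows "F \<in> autos L M"
proof -
  have "iso L F (restr L M' (univ M)) (restr L M' (F ` univ M))"
    using elem_emb_model_in(2)[OF autos_elem_emb[OF N G_autos[OF assms]] le_model_in[OF M_M']] .
  then show ?thesis using assms le_restr[OF M_M'] by (simp add: \<G>_def autos_def)
qed

lemma extend_auto_G: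
  assumes f: "f \<in> autos L M"
  obtains F where "F \<in> \<G>" "\<And>x. x \<in> univ M \<Longrightarrow> F x = f x"
proof -
  have "elem_emb K f (restr L M' (univ M)) M'"
    using elem_emb_comp[OF autos_elem_emb[OF M.N f] le_elem_emb[OF M_M']] le_restr[OF M_M'] by simp
  moreover have "is_model K M' |univ M'| (univ M)"
    using le_model_in[OF M_M'] M_less by (simp add: is_model_iff)
  ultimately obtain F where F: "F \<in> autos L M'" "\<And>x. x \<in> univ M \<Longrightarrow> F x = f x"
    using extend_to_auto by blast
  moreover have "f ` univ M = univ M" using f iso_image unfolding autos_def by blast
  ultimately show ?thesis using that[of F] by (simp add: \<G>_def)
qed

lemma G_id: "id \<in> \<G>"
  by (simp add: \<G>_def autos_id)

lemma G_comp: "F \<in> \<G> \<Longrightarrow> G \<in> \<G> \<Longrightarrow> F \<circ> G \<in> \<G>"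
  unfolding \<G>_def using autos_comp[of F L M' G] by (metis (mono_tags, lifting) image_comp mem_Collect_eq)

text \<open>A left inverse on M' only: values outside the universe are arbitrary.\<close>

definition undo :: "('u \<Rightarrow> 'u) \<Rightarrow> ('u \<Rightarrow> 'u) \<Rightarrow> bool" where
  "undo G F \<longleftrightarrow> (\<forall>x\<in>univ M'. G (F x) = x)"

lemma undoD: "undo G F \<Longrightarrow> x \<in> univ M' \<Longrightarrow> G (F x) = x"
  by (simp add: undo_def)

lemma G_inv:
  assumes "F \<in> \<G>"
  obtains G where "G \<in> \<G>" "undo G F" "undo F G"
proof -
  obtain G where G: "G \<in> autos L M'" "\<forall>x\<in>univ M'. G (F x) = x \<and> F (G x) = x"
    using autos_inv[OF G_autos[OF assms] mods_struct[OF N]] by blast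
  have F: "F ` univ M = univ M" using assms by (simp add: \<G>_def)
  have "G ` univ M = G ` F ` univ M" using F by simp
  also have "\<dots> = univ M" using G(2) M_sub by (force simp: image_image)
  finally have "G \<in> \<G>" using G(1) by (simp add: \<G>_def)
  then show ?thesis using that G(2) unfolding undo_def by blast
qed

lemma G_univ: "F \<in> \<G> \<Longrightarrow> x \<in> univ M \<Longrightarrow> F x \<in> univ M"
  unfolding \<G>_def by blast

lemma G_lists: "F \<in> \<G> \<Longrightarrow> c \<in> lists (univ M) \<Longrightarrow> map F c \<in> lists (univ M)"
  using G_univ by auto

text \<open>Conjugacy in M' between tuples of M descends to M by \<open>restrict_auto\<close> and is
  then extended to an element of \<open>\<G>\<close>.\<close>

lemma conjugate_G:
  assumes "conjugate S' A x y" "x \<in> lists (univ M)" "y \<in> lists (univ M)" "finite A" "A \<subseteq> univ M"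
  obtains H where "H \<in> \<G>" "\<forall>a\<in>A. H a = a" "map H x = y"
proof -
  obtain F where F: "F \<in> autos L M'" "\<And>a. a \<in> A \<Longrightarrow> F a = a" "map F x = y"
    using assms(1) unfolding conjugate_def fixing_def by auto
  have "F ` (A \<union> set x) \<subseteq> univ M" using F assms(3,5) by (auto simp flip: F(3))
  moreover have "A \<union> set x \<subseteq> univ M" "small (A \<union> set x)" using assms(2,4,5) by (auto intro: small_finite)
  ultimately obtain f where f: "f \<in> autos L M" "\<And>z. z \<in> A \<union> set x \<Longrightarrow> f z = F z"
    using restrict_auto[OF F(1)] by metis
  obtain H where H: "H \<in> \<G>" "\<And>z. z \<in> univ M \<Longrightarrow> H z = f z" using extend_auto_G[OF f(1)] by blast
  have Hz: "H z = F z" if "z \<in> A \<union> set x" for z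
    using that H(2)[of z] f(2)[of z] assms(2,5) by auto
  then have "map H x = y" using F(3) by (metis Un_iff map_eq_conv)
  then show ?thesis using that[OF H(1)] Hz F(2) by auto
qed

text \<open>After a move into M, each type over \<open>A\<close> is realised in one fixed countable
  model containing \<open>A\<close>, since that model is s-saturated by (AI).\<close>

lemma countable_orbits:
  assumes "finite A" "A \<subseteq> univ M"
  shows "countable (gtp S' A ` lists (univ M'))"
proof -
  obtain Y where Y: "A \<subseteq> Y" "model_in M Y" "countable Y"
    by (rule countable_model[OF M.N assms(2) countable_finite[OF assms(1)]])
  have "is_model K M \<delta> Y"
    using Y small_countable by (simp add: M.is_model_iff small_def)
  then have sat: "s_saturated S Y" using AI Y(3) unfolding axiom_AI_def by blast
  have "gtp S' A ` lists (univ M') \<subseteq> gtp S' A ` lists Y"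
  proof (rule image_subsetI)
    fix b assume b: "b \<in> lists (univ M')"
    then obtain F where F: "F \<in> fixing S' A" "F ` set b \<subseteq> univ M"
      using move_into_M[OF _ small_finite assms(2) small_finite[OF assms(1)], of "set b"] by auto
    then have Fb: "map F b \<in> lists (univ M)" by auto
    then have "\<exists>a\<in>lists Y. wtp_eq S A a (map F b)"
      using sat Y(1) assms(1) unfolding s_saturated_def pts_monster by blast
    then obtain a where a: "a \<in> lists Y" "wtp_eq S A a (map F b)" by blast
    have aM: "a \<in> lists (univ M)" using a(1) model_in_subset[OF Y(2)] by auto
    then have "conjugate S A a (map F b)"
      using a(2) S.wtp_eq_iff[of a A] assms by auto
    then obtain f where f: "f \<in> autos L M" "\<And>a. a \<in> A \<Longrightarrow> f a = a" "map f a = map F b"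
      unfolding conjugate_def fixing_def by auto
    obtain G where G: "G \<in> \<G>" "\<And>x. x \<in> univ M \<Longrightarrow> G x = f x" using extend_auto_G[OF f(1)] by blast
    have "map G a = map F b" unfolding f(3)[symmetric] using aM G(2) by auto
    then have "conjugate S' A a (map F b)"
      using conjugate_map[of G S' A a] G f(2) assms(2) G_autos by (auto simp: subset_iff)
    moreover have "conjugate S' A b (map F b)" using F(1) unfolding conjugate_def by blast
    moreover have "a \<in> lists (univ M')" "A \<subseteq> univ M'" using aM assms(2) M_sub by auto
    ultimately have "gtp S' A b = gtp S' A a"
      using b S'.gtp_eq_iff[of b A "map F b"] S'.gtp_eq_iff[of a A "map F b"] by simp
    then show "gtp S' A b \<in> gtp S' A ` lists Y" using a(1) by blast
  qed
  then show ?thesis by (rule countable_subset) (use Y(3) in simp)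
qed

lemma small_representatives:
  assumes "small (f ` X)"
  obtains R where "R \<subseteq> X" "small R" "\<forall>x\<in>X. \<exists>r\<in>R. f r = f x"
proof
  show "inv_into X f ` f ` X \<subseteq> X" by (auto intro: inv_into_into)
  show "small (inv_into X f ` f ` X)" by (rule small_image[OF assms])
  show "\<forall>x\<in>X. \<exists>r\<in>inv_into X f ` f ` X. f r = f x"
  proof
    fix x assume "x \<in> X"
    then show "\<exists>r\<in>inv_into X f ` f ` X. f r = f x"
      by (intro bexI[of _ "inv_into X f (f x)"]) (auto simp: f_inv_into_f)
  qed
qed

text \<open>An \<open>A\<close>-invariant relation is a union of orbits of concatenated pairs, hence
  is coded by a set of types over \<open>A\<close>; the fixed length \<open>n\<close> recovers the
  pair from its concatenation.\<close>

lemma small_inv_equivs: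
  assumes "finite A" "A \<subseteq> univ M"
  shows "small (inv_equivs S' n A)"
proof (rule small_inj)
  let ?o = "\<lambda>E. (\<lambda>(x, y). gtp S' A (x @ y)) ` E"
  have sub: "x \<in> lists (univ M')" "y \<in> lists (univ M')" "length x = n"
    if "E \<in> inv_equivs S' n A" "(x, y) \<in> E" for E x y
    using that unfolding inv_equivs_def equiv_def refl_on_def nlists_def
    by (auto simp: subset_iff)
  have le: "E \<subseteq> E'" if E: "E \<in> inv_equivs S' n A" "E' \<in> inv_equivs S' n A" "?o E = ?o E'" for E E'
  proof
    fix z assume "z \<in> E"
    then obtain x y where z: "z = (x, y)" "(x, y) \<in> E" by (cases z) auto
    then have "gtp S' A (x @ y) \<in> ?o E'" using E(3) by blast
    then obtain x' y' where xy': "(x', y') \<in> E'" "gtp S' A (x' @ y') = gtp S' A (x @ y)" by auto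
    then have "conjugate S' A (x' @ y') (x @ y)"
      using sub[OF E(2) xy'(1)] assms(2) M_sub S'.gtp_eq_iff[of "x' @ y'" A "x @ y"] by auto
    then obtain f where f: "f \<in> fixing S' A" "map f (x' @ y') = x @ y" unfolding conjugate_def by blast
    then have "map f x' = x" "map f y' = y" using sub(3)[OF E(2) xy'(1)] sub(3)[OF E(1) z(2)] by auto
    then show "z \<in> E'" using f(1) xy'(1) E(2) unfolding inv_equivs_def z(1) by blast
  qed
  show "inj_on ?o (inv_equivs S' n A)" using le by (intro inj_onI) blast
  show "?o ` inv_equivs S' n A \<subseteq> Pow (gtp S' A ` lists (univ M'))"
  proof (rule image_subsetI)
    fix E assume E: "E \<in> inv_equivs S' n A"
    have "gtp S' A (x @ y) \<in> gtp S' A ` lists (univ M')" if "(x, y) \<in> E" for x y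
      using sub[OF E that] by (intro imageI) auto
    then show "?o E \<in> Pow (gtp S' A ` lists (univ M'))" by auto
  qed
  show "small (Pow (gtp S' A ` lists (univ M')))"
    by (intro small_Pow small_countable countable_orbits assms)
qed

text \<open>A Lascar type over \<open>A\<close> is a choice of class for each of few relations, each
  with few classes by \<open>few_classes\<close>.\<close>

lemma Lascar_representatives:
  assumes "finite A" "A \<subseteq> univ M"
  obtains Z where "Z \<subseteq> univ M" "small Z" "\<forall>c\<in>lists (univ M). \<exists>z\<in>lists Z. Lt_eq S' A c z"
proof -
  have "\<forall>n. \<exists>R. R \<subseteq> nlists n (univ M) \<and> small R \<and> (\<forall>c\<in>nlists n (univ M). \<exists>z\<in>R. Lt_eq S' A c z)"
  proof
    fix n
    let ?J = "inv_equivs S' n A"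
    let ?f = "\<lambda>c. restrict (\<lambda>E. E `` {c}) ?J"
    have nl: "nlists n (univ M) \<subseteq> nlists n (univ M')" by (rule nlists_mono[OF M_sub])
    have "?f ` nlists n (univ M) \<subseteq> PiE ?J (\<lambda>E. nlists n (univ M') // E)"
      by (auto intro!: quotientI subsetD[OF nl])
    moreover have "small (PiE ?J (\<lambda>E. nlists n (univ M') // E))"
      using assms M_sub by (intro small_PiE small_inv_equivs few_classes[of _ n A]) auto
    ultimately have im: "small (?f ` nlists n (univ M))" by (rule small_mono)
    obtain R where R: "R \<subseteq> nlists n (univ M)" "small R"
      "\<forall>x\<in>nlists n (univ M). \<exists>r\<in>R. ?f r = ?f x" by (rule small_representatives[OF im])
    have "\<exists>z\<in>R. Lt_eq S' A c z" if c: "c \<in> nlists n (univ M)" for c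
    proof -
      obtain z where z: "z \<in> R" "?f z = ?f c" using R(3) c by blast
      have cz: "(c, z) \<in> E" if "A1 \<subseteq> A" "E \<in> inv_equivs S' n A1" for A1 E
      proof -
        \<comment> \<open>Invariance over a subset of \<open>A\<close> implies invariance over
          \<open>A\<close>, so the one family \<open>?J\<close> covers every
          \<open>A1\<close>.\<close>
        have E: "E \<in> ?J" using that unfolding inv_equivs_def fixing_def by blast
        then have "E `` {z} = E `` {c}" using fun_cong[OF z(2), of E] by simp
        moreover have "equiv (nlists n (univ M')) E" using E by (simp add: inv_equivs_def)
        ultimately show ?thesis using z(1) R(1) nl eq_equiv_class[of E c z] by blast
      qed
      have "length c = n" "length z = n" using c z(1) R(1) by (auto simp: nlists_def)
      then have "Lt_eq S' A c z" unfolding Lt_eq_def using cz by simp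
      then show ?thesis using z(1) by blast
    qed
    then show "\<exists>R. R \<subseteq> nlists n (univ M) \<and> small R \<and> (\<forall>c\<in>nlists n (univ M). \<exists>z\<in>R. Lt_eq S' A c z)"
      using R(1,2) by blast
  qed
  from choice[OF this] obtain R where
    *: "\<forall>n. R n \<subseteq> nlists n (univ M) \<and> small (R n) \<and> (\<forall>c\<in>nlists n (univ M). \<exists>z\<in>R n. Lt_eq S' A c z)"
    by (rule exE)
  then have R: "R n \<subseteq> nlists n (univ M)" "small (R n)" "\<forall>c\<in>nlists n (univ M). \<exists>z\<in>R n. Lt_eq S' A c z" for n
    by - (drule spec[of _ n], elim conjE, assumption)+
  let ?Z = "\<Union>n. \<Union>z\<in>R n. set z"
  show ?thesis
  proof (rule that[of ?Z])
    show "?Z \<subseteq> univ M" using R(1) unfolding nlists_def by blast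
    show "small ?Z"
      by (intro small_UN R(2) small_finite finite_set small_countable) simp
    show "\<forall>c\<in>lists (univ M). \<exists>z\<in>lists ?Z. Lt_eq S' A c z"
    proof
      fix c assume "c \<in> lists (univ M)"
      then have "c \<in> nlists (length c) (univ M)" by (auto simp: nlists_def)
      then obtain z where "z \<in> R (length c)" "Lt_eq S' A c z" using R(3) by blast
      then show "\<exists>z\<in>lists ?Z. Lt_eq S' A c z" by (intro bexI[of _ z]) auto
    qed
  qed
qed

end

section \<open>Stabilisers of global types\<close>

context fur
begin

text \<open>Equality of the global types t(x/M) and t(y/M); \<open>set c\<close> ranges over the
  finite subsets of M.\<close>

definition geq :: "'u list \<Rightarrow> 'u list \<Rightarrow> bool" where
  "geq x y \<longleftrightarrow> (\<forall>c\<in>lists (univ M). conjugate S' (set c) x y)"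

text \<open>The stabiliser of t(x/M); for \<open>b\<close> it turns out to be the stabiliser of
  \<alpha>.\<close>

definition St :: "'u list \<Rightarrow> ('u \<Rightarrow> 'u) set" where
  "St x = {H \<in> \<G>. geq (map H x) x}"

definition \<G>B :: "'u set \<Rightarrow> ('u \<Rightarrow> 'u) set" where
  "\<G>B B = {F \<in> \<G>. \<forall>a\<in>B. F a = a}"

lemma map_inverse:
  assumes "undo G F" "z \<in> lists (univ M')"
  shows "map G (map F z) = z"
  unfolding map_map using assms undoD[OF assms(1)] by (intro map_idI) auto

lemma G_lists': "F \<in> \<G> \<Longrightarrow> z \<in> lists (univ M') \<Longrightarrow> map F z \<in> lists (univ M')"
  using autos_univ[OF G_autos] by auto

lemma M_lists: "c \<in> lists (univ M) \<Longrightarrow> c \<in> lists (univ M')"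
  using M_sub by auto

lemma M_set: "c \<in> lists (univ M) \<Longrightarrow> set c \<subseteq> univ M'"
  using M_sub by auto

lemma geq_refl: "geq x x"
  unfolding geq_def using S'.conjugate_refl by blast

lemma geq_trans: "geq x y \<Longrightarrow> geq y z \<Longrightarrow> geq x z"
  unfolding geq_def using S'.conjugate_trans by blast

lemma geq_sym:
  assumes "geq x y" "x \<in> lists (univ M')"
  shows "geq y x"
  using assms S'.conjugate_sym[of "set _" x y] M_set unfolding geq_def pts_monster by blast

lemma geq_transport:
  assumes "geq x y" "H \<in> \<G>" "x \<in> lists (univ M')"
  shows "geq (map H x) (map H y)"
  unfolding geq_def
proof
  fix c assume c: "c \<in> lists (univ M)"
  obtain G where G: "G \<in> \<G>" "undo G H" "undo H G"
    using G_inv[OF assms(2)] .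
  have Gc: "map G c \<in> lists (univ M)" by (rule G_lists[OF G(1) c])
  then have "conjugate S' (set (map G c)) x y" using assms(1) unfolding geq_def by blast
  then have "conjugate S' (H ` set (map G c)) (map H x) (map H y)"
    by (rule S'.conjugate_transport) (use assms G_autos M_set[OF Gc] in simp_all)
  moreover have "map H (map G c) = c" using map_inverse[OF G(3) M_lists[OF c]] .
  then have "H ` set (map G c) = set c" by (metis set_map)
  ultimately show "conjugate S' (set c) (map H x) (map H y)" by simp
qed

lemma St_id: "id \<in> St x"
  by (simp add: St_def G_id geq_refl)

lemma St_comp:
  assumes "F \<in> St x" "G \<in> St x" "x \<in> lists (univ M')"
  shows "F \<circ> G \<in> St x"
proof -
  have "geq (map F (map G x)) (map F x)"
    using assms G_lists' by (intro geq_transport) (auto simp: St_def)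
  then have "geq (map F (map G x)) x" using assms(1) geq_trans by (auto simp: St_def)
  then show ?thesis using assms G_comp by (auto simp: St_def)
qed

lemma St_inverse:
  assumes "F \<in> St x" "x \<in> lists (univ M')" "G \<in> \<G>" "undo G F"
  shows "G \<in> St x"
proof -
  have F: "F \<in> \<G>" "geq (map F x) x" using assms(1) by (auto simp: St_def)
  have "geq (map G (map F x)) (map G x)"
    by (rule geq_transport[OF F(2) assms(3) G_lists'[OF F(1) assms(2)]])
  then have "geq (map G x) x" using geq_sym map_inverse[OF assms(4,2)] assms(2) by simp
  then show ?thesis using assms(3) by (simp add: St_def)
qed

lemma St_geq:
  assumes "H \<in> St x" "geq x y" "x \<in> lists (univ M')"
  shows "H \<in> St y"
proof -
  have H: "H \<in> \<G>" "geq (map H x) x" using assms(1) by (auto simp: St_def)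
  have "geq (map H x) (map H y)" by (rule geq_transport[OF assms(2) H(1) assms(3)])
  then have "geq (map H y) (map H x)" by (rule geq_sym) (rule G_lists'[OF H(1) assms(3)])
  then have "geq (map H y) y" using geq_trans[OF _ geq_trans[OF H(2) assms(2)]] by simp
  then show ?thesis using H(1) by (simp add: St_def)
qed

lemma St_conjugate:
  assumes "G \<circ> H \<circ> F \<in> St x" "x \<in> lists (univ M')" "F \<in> \<G>" "H \<in> \<G>"
    and "undo F G"
  shows "H \<in> St (map F x)"
proof -
  have GHF: "G \<circ> H \<circ> F \<in> \<G>" "geq (map (G \<circ> H \<circ> F) x) x" using assms(1) by (auto simp: St_def)
  have HFx: "map H (map F x) \<in> lists (univ M')" using assms G_lists' by blast
  have "geq (map F (map (G \<circ> H \<circ> F) x)) (map F x)"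
    by (rule geq_transport[OF GHF(2) assms(3) G_lists'[OF GHF(1) assms(2)]])
  moreover have "map (G \<circ> H \<circ> F) x = map G (map H (map F x))" by simp
  ultimately have "geq (map H (map F x)) (map F x)" by (simp only: map_inverse[OF assms(5) HFx])
  then show ?thesis using assms(4) by (simp add: St_def)
qed

lemma GB_id: "id \<in> \<G>B B"
  by (simp add: \<G>B_def G_id)

lemma GB_comp: "F \<in> \<G>B B \<Longrightarrow> G \<in> \<G>B B \<Longrightarrow> F \<circ> G \<in> \<G>B B"
  by (simp add: \<G>B_def G_comp)

lemma GB_G: "F \<in> \<G>B B \<Longrightarrow> F \<in> \<G>"
  by (simp add: \<G>B_def)

lemma GB_inv:
  assumes "F \<in> \<G>B B" "B \<subseteq> univ M'"
  obtains G where "G \<in> \<G>B B" "undo G F" "undo F G"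
proof -
  obtain G where G: "G \<in> \<G>" "undo G F" "undo F G"
    using G_inv[OF GB_G[OF assms(1)]] .
  have "G a = a" if "a \<in> B" for a
    using undoD[OF G(2), of a] that assms by (auto simp: \<G>B_def)
  then show ?thesis using that[of G] G by (simp add: \<G>B_def)
qed

lemma Lt_eq_transport:
  assumes "Lt_eq S' A c z" "G \<in> autos L M'" "\<And>a. a \<in> A \<Longrightarrow> G a = a"
  shows "Lt_eq S' A (map G c) (map G z)"
  using assms unfolding Lt_eq_def inv_equivs_def fixing_def by (auto simp: subset_iff)

end

section \<open>Conjugates of a global type\<close>

locale global_point = fur K \<delta> M M'
  for K :: "('u, 'f, 'r) aec" and \<delta> :: "'u rel" and M M' :: "('u, 'f, 'r) struct" +
  fixes b :: "'u list" and A0 :: "'u set"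
  assumes b: "b \<in> lists (univ M')" and A0: "finite A0" "A0 \<subseteq> univ M"
    and nonsplit: "\<not> Lsplits S' b (univ M) A0"
begin

text \<open>Modulo \<open>geq\<close> these are the \<open>B\<close>-conjugates of t(b/M), standing
  in for those of the canonical base.\<close>

definition orbit :: "'u set \<Rightarrow> 'u list set" where
  "orbit B = (\<lambda>F. map F b) ` \<G>B B"

lemma orbit_lists: "x \<in> orbit B \<Longrightarrow> x \<in> lists (univ M')"
  unfolding orbit_def using G_lists'[OF GB_G b] by blast

text \<open>The conjugating automorphism fixes \<open>A0\<close> and preserves M, so nonsplitting
  over \<open>A0\<close> passes from \<open>b\<close> to its conjugates.\<close>

lemma orbit_nonsplit:
  assumes x: "x \<in> orbit B" and B: "A0 \<subseteq> B" and c: "c \<in> lists (univ M)" "z \<in> lists (univ M)" "Lt_eq S' A0 c z"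
  shows "conjugate S' A0 (x @ c) (x @ z)"
proof -
  obtain F where F: "F \<in> \<G>B A0" "x = map F b"
    using x B unfolding orbit_def \<G>B_def by blast
  have A0': "A0 \<subseteq> univ M'" using A0(2) M_sub by simp
  obtain G where G: "G \<in> \<G>B A0" "undo F G"
    using GB_inv[OF F(1) A0'] by metis
  have GM: "map G c \<in> lists (univ M)" "map G z \<in> lists (univ M)" using G_lists[OF GB_G[OF G(1)]] c by auto
  have "Lt_eq S' A0 (map G c) (map G z)"
    using Lt_eq_transport[OF c(3), of G] G(1) G_autos by (auto simp: \<G>B_def)
  then have "wtp_eq S' A0 (b @ map G c) (b @ map G z)"
    using nonsplit GM unfolding Lsplits_def by blast
  moreover have bGc: "b @ map G c \<in> lists (univ M')" using b M_lists[OF GM(1)] by simp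
  ultimately have "conjugate S' A0 (b @ map G c) (b @ map G z)"
    using S'.wtp_eq_iff[of "b @ map G c" A0] A0' A0(1) by simp
  then have "conjugate S' (F ` A0) (map F (b @ map G c)) (map F (b @ map G z))"
    by (rule S'.conjugate_transport) (use F(1) G_autos bGc A0' in \<open>simp_all add: \<G>B_def\<close>)
  moreover have "F ` A0 = A0" using F(1) by (force simp: \<G>B_def)
  moreover have "map F (map G c) = c" "map F (map G z) = z"
    using map_inverse[OF G(2)] c M_lists by blast+
  ultimately show ?thesis by (simp only: F(2) map_append)
qed

lemma small_orbit:
  assumes "A0 \<subseteq> B"
  obtains R where "R \<subseteq> orbit B" "small R" "\<forall>x\<in>orbit B. \<exists>r\<in>R. geq r x"
proof -
  obtain Z where Z: "Z \<subseteq> univ M" "small Z" "\<forall>c\<in>lists (univ M). \<exists>z\<in>lists Z. Lt_eq S' A0 c z"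
    using Lascar_representatives[OF A0] .
  let ?sig = "\<lambda>x. restrict (\<lambda>z. gtp S' A0 (x @ z)) (lists Z)"
  have ZM: "lists Z \<subseteq> lists (univ M')" using Z(1) M_sub by auto
  have "?sig ` orbit B \<subseteq> PiE (lists Z) (\<lambda>_. gtp S' A0 ` lists (univ M'))"
  proof (rule image_subsetI)
    fix x assume "x \<in> orbit B"
    then have "x @ z \<in> lists (univ M')" if "z \<in> lists Z" for z
      using orbit_lists subsetD[OF ZM that] by simp
    then show "?sig x \<in> PiE (lists Z) (\<lambda>_. gtp S' A0 ` lists (univ M'))" by auto
  qed
  moreover have "small (PiE (lists Z) (\<lambda>_. gtp S' A0 ` lists (univ M')))"
    by (intro small_PiE small_lists Z(2) small_countable countable_orbits A0)
  ultimately have im: "small (?sig ` orbit B)" by (rule small_mono)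
  obtain R where R: "R \<subseteq> orbit B" "small R" "\<forall>x\<in>orbit B. \<exists>r\<in>R. ?sig r = ?sig x"
    by (rule small_representatives[OF im])
  have A0': "A0 \<subseteq> univ M'" using A0(2) M_sub by simp
  have "geq r x" if r: "r \<in> orbit B" and x: "x \<in> orbit B" and sig: "?sig r = ?sig x" for r x
    unfolding geq_def
  proof
    fix c assume c: "c \<in> lists (univ M)"
    then obtain z where z: "z \<in> lists Z" "Lt_eq S' A0 c z" using Z(3) by blast
    have zM: "z \<in> lists (univ M)" using z(1) Z(1) by auto
    have lists: "r @ z \<in> lists (univ M')" "x @ c \<in> lists (univ M')"
      using orbit_lists[OF r] orbit_lists[OF x] M_lists[OF zM] M_lists[OF c] by auto
    have "gtp S' A0 (r @ z) = gtp S' A0 (x @ z)" using fun_cong[OF sig, of z] z(1) by simp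
    then have "conjugate S' A0 (r @ z) (x @ z)" using S'.gtp_eq_iff lists(1) A0' by simp
    \<comment> \<open>Nonsplitting replaces an arbitrary \<open>c\<close> by its representative
      \<open>z\<close> on both sides, where the signatures agree.\<close>
    moreover have "conjugate S' A0 (r @ c) (r @ z)" by (rule orbit_nonsplit[OF r assms c zM z(2)])
    moreover have "conjugate S' A0 (x @ z) (x @ c)"
      using S'.conjugate_sym[OF orbit_nonsplit[OF x assms c zM z(2)]] lists(2) A0' by simp
    ultimately have "conjugate S' A0 (r @ c) (x @ c)" using S'.conjugate_trans by blast
    moreover have "length r = length x" using r x unfolding orbit_def by auto
    ultimately show "conjugate S' (set c) r x"
      using conjugate_append conjugate_mono by (metis sup_ge2)
  qed
  then show ?thesis using that[of R] R by blast
qed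

text \<open>Quantifying over all conjugates, not just \<open>b\<close>, makes the relation invariant
  under automorphisms fixing \<open>B\<close>.\<close>

definition E0 :: "'u set \<Rightarrow> 'u list \<Rightarrow> 'u list \<Rightarrow> bool" where
  "E0 B x y \<longleftrightarrow> (\<forall>b'\<in>orbit B. \<exists>H\<in>\<G>B B \<inter> St b'. map H x = y)"

lemma E0_refl: "E0 B x x"
  unfolding E0_def by (intro ballI bexI[of _ id]) (simp_all add: GB_id St_id)

lemma E0_trans:
  assumes "E0 B x y" "E0 B y z"
  shows "E0 B x z"
  unfolding E0_def
proof
  fix b' assume b': "b' \<in> orbit B"
  obtain F G where "F \<in> \<G>B B \<inter> St b'" "map F x = y" "G \<in> \<G>B B \<inter> St b'" "map G y = z"
    using assms b' unfolding E0_def by blast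
  then show "\<exists>H\<in>\<G>B B \<inter> St b'. map H x = z"
    using GB_comp St_comp orbit_lists[OF b'] by (intro bexI[of _ "G \<circ> F"]) auto
qed

lemma E0_sym:
  assumes "E0 B x y" "x \<in> lists (univ M')" "B \<subseteq> univ M'"
  shows "E0 B y x"
  unfolding E0_def
proof
  fix b' assume b': "b' \<in> orbit B"
  obtain F where F: "F \<in> \<G>B B" "F \<in> St b'" "map F x = y"
    using assms b' unfolding E0_def by blast
  obtain G where G: "G \<in> \<G>B B" "undo G F"
    using GB_inv[OF F(1) assms(3)] by metis
  have "G \<in> St b'" using St_inverse[OF F(2) orbit_lists[OF b'] GB_G[OF G(1)] G(2)] .
  then show "\<exists>H\<in>\<G>B B \<inter> St b'. map H y = x"
    using G(1) map_inverse[OF G(2) assms(2)] F(3) by blast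
qed

lemma E0_transport:
  assumes "E0 B x y" "F \<in> \<G>B B" "x \<in> lists (univ M')" "B \<subseteq> univ M'"
  shows "E0 B (map F x) (map F y)"
  unfolding E0_def
proof
  fix b' assume b': "b' \<in> orbit B"
  obtain G where G: "G \<in> \<G>B B" "undo G F" "undo F G"
    using GB_inv[OF assms(2,4)] .
  have Gb': "map G b' \<in> orbit B" using b' GB_comp[OF G(1)] unfolding orbit_def by force
  then obtain H where H: "H \<in> \<G>B B" "H \<in> St (map G b')" "map H x = y"
    using assms(1) unfolding E0_def by blast
  let ?H = "F \<circ> H \<circ> G"
  have "?H \<in> \<G>B B" using GB_comp assms(2) H(1) G(1) by blast
  moreover have "?H \<in> St b'"
  proof -
    have "geq (map H (map G b')) (map G b')" using H(2) by (simp add: St_def)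
    from geq_transport[OF this GB_G[OF assms(2)] G_lists'[OF GB_G[OF H(1)] orbit_lists[OF Gb']]]
    have "geq (map F (map H (map G b'))) b'"
      using map_inverse[OF G(3) orbit_lists[OF b']] by simp
    then show ?thesis using GB_G[OF \<open>?H \<in> \<G>B B\<close>] by (simp add: St_def comp_assoc)
  qed
  moreover have "map ?H (map F x) = map F y"
    using map_inverse[OF G(2) assms(3)] H(3) by (metis map_map)
  ultimately show "\<exists>H\<in>\<G>B B \<inter> St b'. map H (map F x) = map F y" by blast
qed

text \<open>\<open>P\<close> supports t(b/M), so \<open>F r\<close>
  P\<open>supports the conjugate\<close>r\<open>. The types over\<close>B \<union> F r
  \<open>P\<close>, for \<open>r\<close> in a small set of conjugates, determine the class of a
  tuple.\<close>

lemma E0_representatives: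
  assumes B: "A0 \<subseteq> B" "finite B" "B \<subseteq> univ M"
    and P: "finite P" "P \<subseteq> univ M" "\<And>F. F \<in> \<G> \<Longrightarrow> (\<And>x. x \<in> P \<Longrightarrow> F x = x) \<Longrightarrow> F \<in> St b"
  obtains R where "R \<subseteq> nlists n (univ M)" "small R" "\<forall>x\<in>nlists n (univ M). \<exists>r\<in>R. E0 B r x"
proof -
  obtain Q where Q: "Q \<subseteq> orbit B" "small Q" "\<forall>x\<in>orbit B. \<exists>r\<in>Q. geq r x"
    using small_orbit[OF B(1)] .
  have "\<forall>r\<in>Q. \<exists>F. F \<in> \<G>B B \<and> r = map F b" using Q(1) unfolding orbit_def by blast
  then obtain F where F: "\<And>r. r \<in> Q \<Longrightarrow> F r \<in> \<G>B B" "\<And>r. r \<in> Q \<Longrightarrow> r = map (F r) b" by metis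
  have D: "finite (B \<union> F r ` P)" "B \<union> F r ` P \<subseteq> univ M" if "r \<in> Q" for r
    using B P G_univ[OF GB_G[OF F(1)[OF that]]] by auto
  have St_r: "H \<in> St r" if r: "r \<in> Q" and H: "H \<in> \<G>" "\<And>x. x \<in> F r ` P \<Longrightarrow> H x = x" for r H
  proof -
    obtain G where G: "G \<in> \<G>" "undo G (F r)" "undo (F r) G"
      using G_inv[OF GB_G[OF F(1)[OF r]]] .
    have "G \<circ> H \<circ> F r \<in> St b"
    proof (rule P(3))
      show "G \<circ> H \<circ> F r \<in> \<G>" using G_comp G(1) H(1) GB_G[OF F(1)[OF r]] by blast
      show "(G \<circ> H \<circ> F r) x = x" if "x \<in> P" for x
        using that H(2)[of "F r x"] undoD[OF G(2), of x] P(2) M_sub by auto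
    qed
    from St_conjugate[OF this b GB_G[OF F(1)[OF r]] H(1) G(3)]
    show ?thesis using F(2)[OF r] by simp
  qed
  let ?sig = "\<lambda>x. restrict (\<lambda>r. gtp S' (B \<union> F r ` P) x) Q"
  have "?sig ` nlists n (univ M) \<subseteq> PiE Q (\<lambda>r. gtp S' (B \<union> F r ` P) ` lists (univ M'))"
  proof (rule image_subsetI)
    fix x assume "x \<in> nlists n (univ M)"
    then have "x \<in> lists (univ M')" using M_sub by (auto simp: nlists_def)
    then show "?sig x \<in> PiE Q (\<lambda>r. gtp S' (B \<union> F r ` P) ` lists (univ M'))" by auto
  qed
  moreover have "small (PiE Q (\<lambda>r. gtp S' (B \<union> F r ` P) ` lists (univ M')))"
    by (intro small_PiE Q(2) small_countable countable_orbits D)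
  ultimately have im: "small (?sig ` nlists n (univ M))" by (rule small_mono)
  obtain R where R: "R \<subseteq> nlists n (univ M)" "small R"
    "\<forall>x\<in>nlists n (univ M). \<exists>r\<in>R. ?sig r = ?sig x"
    by (rule small_representatives[OF im])
  have "E0 B x y" if x: "x \<in> nlists n (univ M)" and y: "y \<in> nlists n (univ M)" and sig: "?sig x = ?sig y" for x y
    unfolding E0_def
  proof
    fix b' assume b': "b' \<in> orbit B"
    then obtain r where r: "r \<in> Q" "geq r b'" using Q(3) by blast
    have xy: "x \<in> lists (univ M)" "y \<in> lists (univ M)" using x y by (auto simp: nlists_def)
    have "gtp S' (B \<union> F r ` P) x = gtp S' (B \<union> F r ` P) y"
      using fun_cong[OF sig, of r] r(1) by simp
    then have "conjugate S' (B \<union> F r ` P) x y"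
      using S'.gtp_eq_iff[of x "B \<union> F r ` P" y] M_lists[OF xy(1)] order_trans[OF D(2)[OF r(1)] M_sub]
      by simp
    then obtain H where H: "H \<in> \<G>" "\<forall>a\<in>B \<union> F r ` P. H a = a" "map H x = y"
      using conjugate_G[OF _ xy D[OF r(1)]] by blast
    have "H \<in> St r" using St_r[OF r(1) H(1)] H(2) by blast
    \<comment> \<open>Stabilisers depend on the global type only, so the representatives
      \<open>r\<close> account for the whole orbit.\<close>
    then have "H \<in> St b'" using St_geq r(2) orbit_lists Q(1) r(1) by blast
    moreover have "H \<in> \<G>B B" using H by (simp add: \<G>B_def)
    ultimately show "\<exists>H\<in>\<G>B B \<inter> St b'. map H x = y" using H(3) by blast
  qed
  then show ?thesis using that[of R] R by blast
qed

text \<open>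
  The relation \<open>E0 B\<close> says that two tuples of \<open>M\<close> have the same type over \<open>B\<close> together with
  any conjugate of the canonical base; on \<open>M'\<close> it is read after moving tuples into \<open>M\<close>.
\<close>

lemma stabiliser_equivalence:
  assumes B: "A0 \<subseteq> B" "finite B" "B \<subseteq> univ M"
    and P: "finite P" "P \<subseteq> univ M" "\<And>F. F \<in> \<G> \<Longrightarrow> (\<And>x. x \<in> P \<Longrightarrow> F x = x) \<Longrightarrow> F \<in> St b"
  shows "\<exists>E\<in>inv_equivs S' n B. \<forall>x\<in>lists (univ M). \<forall>y\<in>lists (univ M).
    (x, y) \<in> E \<longrightarrow> (\<exists>H\<in>\<G>B B \<inter> St b. map H x = y)"
proof -
  let ?N = "nlists n (univ M')"
  have B': "B \<subseteq> univ M'" using B(3) M_sub by simp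
  \<comment> \<open>Both tuples are moved into M by the same automorphism over \<open>B\<close>;
    \<open>wd\<close> shows that its choice does not matter.\<close>
  define E where "E = {(x, y). x \<in> ?N \<and> y \<in> ?N \<and> (\<exists>F\<in>fixing S' B.
    map F x \<in> lists (univ M) \<and> map F y \<in> lists (univ M) \<and> E0 B (map F x) (map F y))}"
  have wd: "E0 B (map F2 x) (map F2 y)"
    if F: "F1 \<in> fixing S' B" "F2 \<in> fixing S' B" and xy: "x \<in> lists (univ M')" "y \<in> lists (univ M')"
      and M1: "map F1 x \<in> lists (univ M)" "map F1 y \<in> lists (univ M)"
      and M2: "map F2 x \<in> lists (univ M)" "map F2 y \<in> lists (univ M)"
      and E: "E0 B (map F1 x) (map F1 y)" for F1 F2 x y
  proof -
    \<comment> \<open>Two moves differ by a conjugation over \<open>B\<close> between tuples of M.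
      It can be taken in \<open>\<G>\<close>, under which \<open>E0\<close> is invariant.\<close>
    have c: "conjugate S' B (x @ y) (map F1 (x @ y))" "conjugate S' B (x @ y) (map F2 (x @ y))"
      using F unfolding conjugate_def by blast+
    have "x @ y \<in> lists (pts S')" "B \<subseteq> pts S'" using xy B' by simp_all
    then have conj: "conjugate S' B (map F1 (x @ y)) (map F2 (x @ y))"
      by (rule S'.conjugate_trans[OF S'.conjugate_sym[OF c(1)] c(2)])
    have "map F1 (x @ y) \<in> lists (univ M)" "map F2 (x @ y) \<in> lists (univ M)" using M1 M2 by simp_all
    then obtain H where H: "H \<in> \<G>" "\<forall>a\<in>B. H a = a" "map H (map F1 (x @ y)) = map F2 (x @ y)"
      by (rule conjugate_G[OF conj _ _ B(2,3)])
    then have "map H (map F1 x) = map F2 x" "map H (map F1 y) = map F2 y" by auto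
    moreover have "H \<in> \<G>B B" using H by (simp add: \<G>B_def)
    ultimately show ?thesis using E0_transport[OF E _ M_lists[OF M1(1)] B'] by metis
  qed
  have mv: "\<exists>F\<in>fixing S' B. map F x \<in> lists (univ M)" if "x \<in> lists (univ M')" for x
  proof -
    have "set x \<subseteq> univ M'" using that by auto
    then obtain F where F: "F \<in> fixing S' B" "F ` set x \<subseteq> univ M"
      using move_into_M[OF _ small_finite B(3) small_finite[OF B(2)]] by blast
    then have "map F x \<in> lists (univ M)" by auto
    then show ?thesis using F(1) by blast
  qed
  have E_iff: "(x, y) \<in> E \<longleftrightarrow> E0 B (map F x) (map F y)"
    if "x \<in> ?N" "y \<in> ?N" "F \<in> fixing S' B" "map F x \<in> lists (univ M)" "map F y \<in> lists (univ M)" for x y F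
  proof -
    have "x \<in> lists (univ M')" "y \<in> lists (univ M')" using that by (auto simp: nlists_def)
    then show ?thesis using that wd unfolding E_def by blast
  qed
  have N_lists: "x \<in> ?N \<Longrightarrow> x \<in> lists (univ M')" for x by (auto simp: nlists_def)
  have equiv: "equiv ?N E"
  proof (rule equivI)
    show "E \<subseteq> ?N \<times> ?N" unfolding E_def by auto
    show "refl_on ?N E"
    proof (rule refl_onI)
      fix x assume x: "x \<in> ?N"
      then obtain F where F: "F \<in> fixing S' B" "map F x \<in> lists (univ M)" using mv[OF N_lists] by blast
      show "(x, x) \<in> E" unfolding E_iff[OF x x F F(2)] by (rule E0_refl)
    qed
    show "sym E"
    proof (rule symI)
      fix x y assume E: "(x, y) \<in> E"
      then have xy: "x \<in> ?N" "y \<in> ?N" by (auto simp: E_def)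
      obtain F where F: "F \<in> fixing S' B" "map F (x @ y) \<in> lists (univ M)"
        using mv[of "x @ y"] N_lists xy by auto
      then have Fxy: "map F x \<in> lists (univ M)" "map F y \<in> lists (univ M)" by auto
      have "E0 B (map F x) (map F y)" using E E_iff[OF xy F(1) Fxy] by blast
      then have "E0 B (map F y) (map F x)" by (rule E0_sym[OF _ M_lists[OF Fxy(1)] B'])
      then show "(y, x) \<in> E" unfolding E_iff[OF xy(2,1) F(1) Fxy(2,1)] .
    qed
    show "trans E"
    proof (rule transI)
      fix x y z assume E: "(x, y) \<in> E" "(y, z) \<in> E"
      then have xyz: "x \<in> ?N" "y \<in> ?N" "z \<in> ?N" by (auto simp: E_def)
      obtain F where F: "F \<in> fixing S' B" "map F (x @ y @ z) \<in> lists (univ M)"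
        using mv[of "x @ y @ z"] N_lists xyz by auto
      then have Fx: "map F x \<in> lists (univ M)" "map F y \<in> lists (univ M)" "map F z \<in> lists (univ M)" by auto
      have "E0 B (map F x) (map F z)"
        using E E_iff[OF xyz(1,2) F(1) Fx(1,2)] E_iff[OF xyz(2,3) F(1) Fx(2,3)] E0_trans by blast
      then show "(x, z) \<in> E" unfolding E_iff[OF xyz(1,3) F(1) Fx(1,3)] .
    qed
  qed
  have inv: "(map f x, map f y) \<in> E" if f: "f \<in> fixing S' B" and E: "(x, y) \<in> E" for f x y
  proof -
    have xy: "x \<in> ?N" "y \<in> ?N" using E by (auto simp: E_def)
    have f': "map f x \<in> ?N" "map f y \<in> ?N"
      using xy f autos_univ unfolding fixing_def nlists_def by fastforce+
    obtain F where F: "F \<in> fixing S' B" "map F (map f (x @ y)) \<in> lists (univ M)"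
      using mv[of "map f (x @ y)"] N_lists f' by auto
    then have Fxy: "map F (map f x) \<in> lists (univ M)" "map F (map f y) \<in> lists (univ M)" by auto
    have "F \<circ> f \<in> fixing S' B" using F(1) f autos_comp unfolding fixing_def by auto
    then have "E0 B (map (F \<circ> f) x) (map (F \<circ> f) y)"
      using E E_iff[OF xy, of "F \<circ> f"] Fxy by simp
    then show ?thesis unfolding E_iff[OF f' F(1) Fxy] by simp
  qed
  obtain R where R: "R \<subseteq> nlists n (univ M)" "small R" "\<forall>x\<in>nlists n (univ M). \<exists>r\<in>R. E0 B r x"
    using E0_representatives[OF B P, of n] by metis
  have "?N // E \<subseteq> (\<lambda>r. E `` {r}) ` R"
  proof
    fix q assume "q \<in> ?N // E"
    then obtain x where x: "x \<in> ?N" "q = E `` {x}" by (rule quotientE)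
    \<comment> \<open>Moving \<open>x\<close> into M while fixing all representatives keeps
      \<open>r\<close> in place, so one automorphism serves for the pair \<open>r\<close>,
      \<open>x\<close>.\<close>
    let ?Y = "\<Union>r\<in>R. set r"
    have "small ?Y" by (rule small_UN[OF R(2) small_finite]) simp
    then have BY: "small (B \<union> ?Y)" by (rule small_Un[OF small_finite[OF B(2)]])
    have "B \<union> ?Y \<subseteq> univ M" "set x \<subseteq> univ M'" using R(1) B(3) x(1) by (auto simp: nlists_def)
    then obtain F where F: "F \<in> fixing S' (B \<union> ?Y)" "F ` set x \<subseteq> univ M"
      using move_into_M[OF _ small_finite _ BY] by blast
    then have "map F x \<in> nlists n (univ M)" using x(1) by (auto simp: nlists_def)
    then obtain r where r: "r \<in> R" "E0 B r (map F x)" using R(3) by blast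
    have "map F r = r" using F(1) r(1) unfolding fixing_def by (intro map_idI) auto
    moreover have "r \<in> nlists n (univ M)" using r(1) R(1) by blast
    then have "r \<in> ?N" "r \<in> lists (univ M)" using M_sub by (auto simp: nlists_def)
    moreover have "F \<in> fixing S' B" using F(1) unfolding fixing_def by blast
    moreover have "map F x \<in> lists (univ M)" using F(2) by auto
    ultimately have "(r, x) \<in> E" using E_iff[of r x F] x(1) r(2) by simp
    then have "q = E `` {r}" using equiv_class_eq[OF equiv] x(2) by blast
    then show "q \<in> (\<lambda>r. E `` {r}) ` R" using r(1) by blast
  qed
  then have "small (?N // E)" using small_mono small_image[OF R(2)] by blast
  then have "E \<in> inv_equivs S' n B"
    using equiv inv small_less unfolding inv_equivs_def by simp
  moreover have "\<exists>H\<in>\<G>B B \<inter> St b. map H x = y"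
    if xy: "x \<in> lists (univ M)" "y \<in> lists (univ M)" "(x, y) \<in> E" for x y
  proof -
    have N: "x \<in> ?N" "y \<in> ?N" using xy(3) by (auto simp: E_def)
    have "id \<in> fixing S' B" unfolding fixing_def using autos_id by auto
    then have "E0 B x y" using E_iff[OF N, of id] xy by simp
    moreover have "b \<in> orbit B" unfolding orbit_def using GB_id[of B] by force
    ultimately show ?thesis unfolding E0_def by blast
  qed
  ultimately show ?thesis by blast
qed

end

section \<open>Imaginaries\<close>

text \<open>An imaginary is a set of tuples, so automorphisms act by images and no representative
  has to be chosen.\<close>

definition hat :: "('u \<Rightarrow> 'u) \<Rightarrow> 'u list set \<Rightarrow> 'u list set" where
  "hat F q = map F ` q"

lemma hat_emb: "hat F (emb x) = emb (F x)"
  by (simp add: hat_def emb_def)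

lemma emb_inj: "emb x = emb y \<longleftrightarrow> x = y"
  by (simp add: emb_def)

lemma hat_id: "hat id q = q"
  by (simp add: hat_def)

lemma hat_comp: "hat (F \<circ> G) q = hat F (hat G q)"
  by (simp add: hat_def image_image)

lemma sort_of_iff: "q \<in> sort_of E \<longleftrightarrow> (\<exists>u\<in>Domain E. q = E `` {u})"
  by (auto simp: sort_of_def quotient_def)

lemma eq_points_iff: "q \<in> eq_points \<E> \<longleftrightarrow> (\<exists>E\<in>\<E>. \<exists>u\<in>Domain E. q = E `` {u})"
  by (simp add: eq_points_def sort_of_iff)

locale fur_imaginaries = fur K \<delta> M M'
  for K :: "('u, 'f, 'r) aec" and \<delta> :: "'u rel" and M M' :: "('u, 'f, 'r) struct" +
  fixes \<E> :: "'u list rel set"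
  assumes sorts: "imaginary_sorts K \<delta> M \<E>"
begin

abbreviation Seq where "Seq \<equiv> eq_ambient K \<delta> M \<E>"

lemma pts_Seq [simp]: "pts Seq = eq_points \<E>" and aut_Seq [simp]: "aut Seq = eq_autos K M \<E>"
  and bound_Seq [simp]: "bound Seq = \<delta>"
  by (simp_all add: eq_ambient_def)

lemma sort_equiv:
  assumes "E \<in> \<E>"
  obtains n where "equiv (nlists n (univ M)) E" "Domain E = nlists n (univ M)"
    "\<forall>f\<in>autos L M. \<forall>x y. (x, y) \<in> E \<longrightarrow> (map f x, map f y) \<in> E"
proof -
  have "\<forall>E\<in>\<E>. \<exists>n. equiv (nlists n (univ M)) E \<and>
      (\<forall>f\<in>autos L M. \<forall>x y. (x, y) \<in> E \<longrightarrow> (map f x, map f y) \<in> E) \<and>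
      (\<exists>G \<subseteq> gtypes S {}. countable G \<and>
         (\<forall>a\<in>nlists n (univ M). \<forall>b\<in>nlists n (univ M). (a, b) \<in> E \<longleftrightarrow> gtp S {} (a @ b) \<in> G))"
    using sorts unfolding imaginary_sorts_def by (elim conjE)
  from bspec[OF this assms] obtain n where n: "equiv (nlists n (univ M)) E"
    "\<forall>f\<in>autos L M. \<forall>x y. (x, y) \<in> E \<longrightarrow> (map f x, map f y) \<in> E" by (elim exE conjE)
  moreover have "Domain E = nlists n (univ M)"
    using n(1) unfolding equiv_def refl_on_def by auto
  ultimately show ?thesis by (intro that)
qed

lemma hat_class:
  assumes "F \<in> \<G>" "E \<in> \<E>" "u \<in> Domain E"
  shows "map F u \<in> Domain E" "hat F (E `` {u}) = E `` {map F u}"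
proof -
  obtain n where n: "equiv (nlists n (univ M)) E" "Domain E = nlists n (univ M)"
    and inv: "\<forall>f\<in>autos L M. \<forall>x y. (x, y) \<in> E \<longrightarrow> (map f x, map f y) \<in> E"
    using sort_equiv[OF assms(2)] .
  have u: "u \<in> nlists n (univ M)" using assms(3) n(2) by simp
  then show "map F u \<in> Domain E" using G_univ[OF assms(1)] n(2) by (auto simp: nlists_def)
  obtain G where G: "G \<in> \<G>" "undo G F" "undo F G" using G_inv[OF assms(1)] .
  have lists: "w \<in> lists (univ M')" if "w \<in> nlists n (univ M)" for w
    using that M_sub by (auto simp: nlists_def)
  show "hat F (E `` {u}) = E `` {map F u}"
  proof
    show "hat F (E `` {u}) \<subseteq> E `` {map F u}"
      using inv G_autos_M[OF assms(1)] by (auto simp: hat_def)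
    show "E `` {map F u} \<subseteq> hat F (E `` {u})"
    proof
      fix w assume "w \<in> E `` {map F u}"
      then have w: "(map F u, w) \<in> E" by simp
      then have "w \<in> nlists n (univ M)" using n(1) unfolding equiv_def by blast
      then have "map F (map G w) = w" using map_inverse[OF G(3) lists] by blast
      moreover have "(u, map G w) \<in> E"
        using bspec[OF inv G_autos_M[OF G(1)]] w map_inverse[OF G(2) lists[OF u]] by metis
      ultimately show "w \<in> hat F (E `` {u})" unfolding hat_def by (metis Image_singleton_iff imageI)
    qed
  qed
qed

text \<open>A sort and a representative are chosen together, as one set of tuples may be a class of
  several relations. The entries of \<open>su q\<close> are a finite support of
  \<open>q\<close>.\<close>

definition sE :: "'u list set \<Rightarrow> 'u list rel" where
  "sE q = fst (SOME (E, u). E \<in> \<E> \<and> u \<in> Domain E \<and> q = E `` {u})"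

definition su :: "'u list set \<Rightarrow> 'u list" where
  "su q = snd (SOME (E, u). E \<in> \<E> \<and> u \<in> Domain E \<and> q = E `` {u})"

lemma eq_point_name:
  assumes "q \<in> eq_points \<E>"
  shows "sE q \<in> \<E>" "su q \<in> Domain (sE q)" "q = sE q `` {su q}"
proof -
  obtain E u where "E \<in> \<E>" "u \<in> Domain E" "q = E `` {u}"
    using assms unfolding eq_points_iff by blast
  then have "(\<lambda>(E, u). E \<in> \<E> \<and> u \<in> Domain E \<and> q = E `` {u}) (E, u)" by simp
  from someI[of "\<lambda>(E, u). E \<in> \<E> \<and> u \<in> Domain E \<and> q = E `` {u}", OF this]
  show "sE q \<in> \<E>" "su q \<in> Domain (sE q)" "q = sE q `` {su q}"
    unfolding sE_def su_def by (auto simp: case_prod_beta)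
qed

lemma su_lists: "q \<in> eq_points \<E> \<Longrightarrow> su q \<in> lists (univ M)"
  using eq_point_name[of q] sort_equiv[of "sE q"] by (metis in_lists_conv_set nlistsE_set subsetD)

lemma hat_name:
  assumes "q \<in> eq_points \<E>" "F \<in> \<G>"
  shows "hat F q = sE q `` {map F (su q)}" "hat F q \<in> eq_points \<E>"
proof -
  note q = eq_point_name[OF assms(1)]
  show eq: "hat F q = sE q `` {map F (su q)}"
    using hat_class(2)[OF assms(2) q(1,2)] q(3) by simp
  show "hat F q \<in> eq_points \<E>"
    using q(1) hat_class(1)[OF assms(2) q(1,2)] unfolding eq eq_points_iff
    by blast
qed

lemma hat_cong:
  assumes "q \<in> eq_points \<E>" "F \<in> \<G>" "G \<in> \<G>" "\<And>x. x \<in> set (su q) \<Longrightarrow> F x = G x"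
  shows "hat F q = hat G q"
proof -
  have "map F (su q) = map G (su q)" using assms(4) by auto
  then show ?thesis unfolding hat_name(1)[OF assms(1,2)] hat_name(1)[OF assms(1,3)] by (simp only:)
qed

lemma hat_fixes:
  assumes "q \<in> eq_points \<E>" "F \<in> \<G>" "\<And>x. x \<in> set (su q) \<Longrightarrow> F x = x"
  shows "hat F q = q"
  using hat_cong[OF assms(1,2) G_id] assms(3) hat_id by simp

lemma hat_undo:
  assumes "undo G F" "F \<in> \<G>" "G \<in> \<G>" "q \<in> eq_points \<E>"
  shows "hat G (hat F q) = q"
proof -
  have "hat (G \<circ> F) q = q"
    using su_lists[OF assms(4)] undoD[OF assms(1)] M_sub by (intro hat_fixes assms(4) G_comp assms) auto
  then show ?thesis by (simp add: hat_comp)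
qed

lemma emb_points: "x \<in> univ M \<Longrightarrow> emb x \<in> eq_points \<E>"
proof -
  assume x: "x \<in> univ M"
  let ?E = "Id_on (nlists 1 (univ M))"
  have "[x] \<in> Domain ?E" using x by (auto simp: nlists_def)
  moreover have "emb x = ?E `` {[x]}" using x by (auto simp: emb_def nlists_def)
  moreover have "?E \<in> \<E>" using sorts by (simp only: imaginary_sorts_def)
  ultimately show ?thesis unfolding eq_points_iff by (intro bexI)
qed

lemma hat_aut:
  assumes "F \<in> \<G>"
  shows "hat F \<in> eq_autos K M \<E>"
proof -
  obtain G where G: "G \<in> \<G>" "undo G F" "undo F G" using G_inv[OF assms] .
  have sort: "hat H ` sort_of E \<subseteq> sort_of E" if "H \<in> \<G>" "E \<in> \<E>" for H E
  proof (rule image_subsetI)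
    fix q assume "q \<in> sort_of E"
    then obtain u where "u \<in> Domain E" "q = E `` {u}" unfolding sort_of_iff by blast
    then show "hat H q \<in> sort_of E"
      using hat_class[OF that] unfolding sort_of_iff by blast
  qed
  have sort_eq: "hat F ` sort_of E = sort_of E" if "E \<in> \<E>" for E
  proof (rule subset_antisym[OF sort[OF assms that]])
    show "sort_of E \<subseteq> hat F ` sort_of E"
    proof
      fix q assume q: "q \<in> sort_of E"
      then have "q \<in> eq_points \<E>" using that unfolding eq_points_def by blast
      then have "q = hat F (hat G q)" using hat_undo[OF G(3) G(1) assms] by simp
      moreover have "hat G q \<in> sort_of E" using sort[OF G(1) that] q by blast
      ultimately show "q \<in> hat F ` sort_of E" by blast
    qed
  qed
  have "bij_betw (hat F) (eq_points \<E>) (eq_points \<E>)"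
  proof (rule bij_betw_byWitness[of _ "hat G"])
    show "\<forall>q\<in>eq_points \<E>. hat G (hat F q) = q" using hat_undo[OF G(2) assms G(1)] by blast
    show "\<forall>q\<in>eq_points \<E>. hat F (hat G q) = q" using hat_undo[OF G(3) G(1) assms] by blast
  qed (use hat_name(2) assms G(1) in auto)
  then show ?thesis
    unfolding eq_autos_def mem_Collect_eq
  proof (intro conjI ballI bexI[of _ F])
    show "hat F ` sort_of E = sort_of E" if "E \<in> \<E>" for E by (rule sort_eq[OF that])
    show "hat F (emb x) = emb (F x)" for x by (rule hat_emb)
    show "hat F (E `` {a}) = E `` {map F a}" if "E \<in> \<E>" "a \<in> Domain E" for E a
      by (rule hat_class(2)[OF assms that])
    show "F \<in> autos L M" by (rule G_autos_M[OF assms])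
  qed
qed

text \<open>The underlying automorphism of M extends to M', and preservation of the functions
  \<open>F_E\<close> prescribes the action on all classes.\<close>

lemma aut_hat:
  assumes "g \<in> eq_autos K M \<E>"
  obtains F where "F \<in> \<G>" "\<forall>q\<in>eq_points \<E>. g q = hat F q"
proof -
  obtain f where f: "f \<in> autos L M" "\<forall>E\<in>\<E>. \<forall>a\<in>Domain E. g (E `` {a}) = E `` {map f a}"
    using assms unfolding eq_autos_def mem_Collect_eq by (elim conjE bexE)
  obtain F where F: "F \<in> \<G>" "\<And>x. x \<in> univ M \<Longrightarrow> F x = f x" using extend_auto_G[OF f(1)] by blast
  have "g q = hat F q" if q: "q \<in> eq_points \<E>" for q
  proof -
    have "map f (su q) = map F (su q)" using F(2) su_lists[OF q] by auto
    moreover have "g q = sE q `` {map f (su q)}"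
      using bspec[OF bspec[OF f(2) eq_point_name(1)[OF q]] eq_point_name(2)[OF q]]
      by (simp only: eq_point_name(3)[OF q, symmetric])
    ultimately show ?thesis by (simp only: hat_name(1)[OF q F(1)])
  qed
  then show ?thesis using that F(1) by blast
qed

sublocale Seq: ambient_group Seq
proof
  show "id \<in> aut Seq"
    using hat_aut[OF G_id] hat_id by (metis aut_Seq eq_id_iff)
  fix f assume f: "f \<in> aut Seq"
  then obtain F where F: "F \<in> \<G>" "\<forall>q\<in>eq_points \<E>. f q = hat F q" using aut_hat by auto
  show "f x \<in> pts Seq" if "x \<in> pts Seq" for x
    using that F hat_name(2) by simp
  obtain G where G: "G \<in> \<G>" "undo G F" "undo F G" using G_inv[OF F(1)] .
  show "\<exists>g\<in>aut Seq. \<forall>x\<in>pts Seq. g (f x) = x \<and> f (g x) = x"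
    using hat_aut[OF G(1)] F hat_undo[OF G(2) F(1) G(1)] hat_undo[OF G(3) G(1) F(1)] hat_name(2)[OF _ G(1)]
    by (intro bexI[of _ "hat G"]) auto
  fix g assume g: "g \<in> aut Seq"
  then obtain H where H: "H \<in> \<G>" "\<forall>q\<in>eq_points \<E>. g q = hat H q" using aut_hat by auto
  have eq: "(f \<circ> g) q = hat (F \<circ> H) q" if "q \<in> eq_points \<E>" for q
    using that F H hat_name(2)[OF that H(1)] by (simp add: hat_comp)
  have FH: "hat (F \<circ> H) \<in> eq_autos K M \<E>" by (rule hat_aut[OF G_comp[OF F(1) H(1)]])
  have sort: "sort_of E \<subseteq> eq_points \<E>" if "E \<in> \<E>" for E using that unfolding eq_points_def by blast
  have "(f \<circ> g) ` sort_of E = sort_of E" if "E \<in> \<E>" for E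
  proof -
    have "(f \<circ> g) ` sort_of E = hat (F \<circ> H) ` sort_of E" using eq sort[OF that] by (intro image_cong) auto
    then show ?thesis using FH that unfolding eq_autos_def by auto
  qed
  moreover have "bij_betw (f \<circ> g) (eq_points \<E>) (eq_points \<E>)"
  proof (rule iffD2[OF bij_betw_cong[OF eq]])
    show "bij_betw (hat (F \<circ> H)) (eq_points \<E>) (eq_points \<E>)" using FH by (simp add: eq_autos_def)
  qed
  moreover have "(f \<circ> g) (emb x) = emb ((F \<circ> H) x)" if "x \<in> univ M" for x
    using eq[OF emb_points[OF that]] by (simp add: hat_emb)
  moreover have "(f \<circ> g) (E `` {a}) = E `` {map (F \<circ> H) a}" if "E \<in> \<E>" "a \<in> Domain E" for E a
  proof -
    have "E `` {a} \<in> eq_points \<E>"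
      using that unfolding eq_points_iff by blast
    then show ?thesis using eq hat_class(2)[OF G_comp[OF F(1) H(1)] that] by simp
  qed
  moreover have "F \<circ> H \<in> autos L M" by (rule G_autos_M[OF G_comp[OF F(1) H(1)]])
  ultimately show "f \<circ> g \<in> aut Seq"
    unfolding aut_Seq eq_autos_def mem_Collect_eq by (intro conjI bexI[of _ "F \<circ> H"] ballI)
qed

lemma conjugate_hat: "F \<in> \<G> \<Longrightarrow> (\<And>q. q \<in> C \<Longrightarrow> hat F q = q) \<Longrightarrow> conjugate Seq C x (map (hat F) x)"
  using conjugate_map[of "hat F" Seq C x] hat_aut by simp

lemma support:
  assumes "C \<subseteq> eq_points \<E>"
  shows "(\<Union>q\<in>C. set (su q)) \<subseteq> univ M"
  using su_lists assms by auto

text \<open>Conjugacy over a finite \<open>C\<close> has few classes, since types of representatives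
  over a support of \<open>C\<close> determine them. It is therefore one of the relations that
  equality of Lascar types respects.\<close>

lemma Lt_eq_conjugate:
  assumes C: "finite C" "C \<subseteq> eq_points \<E>" and d: "d \<in> lists (eq_points \<E>)" "e \<in> lists (eq_points \<E>)"
    and Lt: "Lt_eq Seq C d e"
  shows "conjugate Seq C d e"
proof -
  let ?n = "length d"
  let ?X = "nlists ?n (eq_points \<E>)"
  define E where "E = {(x, y). x \<in> ?X \<and> y \<in> ?X \<and> conjugate Seq C x y}"
  have X_lists: "x \<in> lists (pts Seq)" if "x \<in> ?X" for x using that by (auto simp: nlists_def)
  have C': "C \<subseteq> pts Seq" using C(2) by simp
  have equiv: "equiv ?X E"
  proof (rule equivI)
    show "E \<subseteq> ?X \<times> ?X" unfolding E_def by auto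
    show "refl_on ?X E" unfolding E_def refl_on_def using Seq.conjugate_refl by blast
    show "sym E" unfolding E_def sym_def using Seq.conjugate_sym[OF _ X_lists C'] by blast
    show "trans E" unfolding E_def trans_def using Seq.conjugate_trans by blast
  qed
  have inv: "(map f x, map f y) \<in> E" if f: "f \<in> fixing Seq C" and xy: "(x, y) \<in> E" for f x y
  proof -
    have X: "x \<in> ?X" "y \<in> ?X" "conjugate Seq C x y" using xy by (auto simp: E_def)
    have fx: "conjugate Seq C x (map f x)" "conjugate Seq C y (map f y)"
      using f unfolding conjugate_def by auto
    have "map f x \<in> ?X" "map f y \<in> ?X"
      using Seq.conjugate_lists[OF fx(1) X_lists[OF X(1)]] Seq.conjugate_lists[OF fx(2) X_lists[OF X(2)]] X(1,2)
      by (auto simp: nlists_def)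
    moreover have "conjugate Seq C (map f x) (map f y)"
      using Seq.conjugate_trans[OF Seq.conjugate_sym[OF fx(1) X_lists[OF X(1)] C']
          Seq.conjugate_trans[OF X(3) fx(2)]] .
    ultimately show ?thesis by (simp add: E_def)
  qed
  let ?W = "\<Union>q\<in>C. set (su q)"
  have W: "finite ?W" "?W \<subseteq> univ M" using C support by auto
  \<comment> \<open>The lengths of the representatives are recorded in order to cut their
    concatenation apart again.\<close>
  let ?sig = "\<lambda>x. (map sE x, map (length \<circ> su) x, gtp S' ?W (concat (map su x)))"
  have su_M': "concat (map su x) \<in> lists (univ M)" if "x \<in> ?X" for x
  proof -
    have "set (su q) \<subseteq> univ M" if "q \<in> set x" for q
      using su_lists[of q] that \<open>x \<in> ?X\<close> by (auto simp: nlists_def)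
    then have "set (concat (map su x)) \<subseteq> univ M" unfolding set_concat set_map by blast
    then show ?thesis by (simp only: lists_eq_set mem_Collect_eq)
  qed
  have "?sig ` ?X \<subseteq> lists \<E> \<times> UNIV \<times> gtp S' ?W ` lists (univ M')"
  proof (rule image_subsetI)
    fix x assume x: "x \<in> ?X"
    then have "map sE x \<in> lists \<E>" using eq_point_name(1) by (auto simp: nlists_def subset_iff)
    then show "?sig x \<in> lists \<E> \<times> UNIV \<times> gtp S' ?W ` lists (univ M')"
      using M_lists[OF su_M'[OF x]] by blast
  qed
  moreover have "countable (lists \<E> \<times> (UNIV :: nat list set) \<times> gtp S' ?W ` lists (univ M'))"
    using sorts countable_orbits[OF W] unfolding imaginary_sorts_def by (intro countable_SIGMA) auto
  ultimately have im: "small (?sig ` ?X)" using small_mono small_countable by blast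
  obtain R where R: "R \<subseteq> ?X" "small R" "\<forall>x\<in>?X. \<exists>r\<in>R. ?sig r = ?sig x"
    by (rule small_representatives[OF im])
  have conj: "conjugate Seq C r x" if r: "r \<in> ?X" and x: "x \<in> ?X" and sig: "?sig r = ?sig x" for r x
  proof -
    have "conjugate S' ?W (concat (map su r)) (concat (map su x))"
      using sig S'.gtp_eq_iff[of "concat (map su r)" ?W] M_lists[OF su_M'[OF r]] order_trans[OF W(2) M_sub]
      by simp
    then obtain H where H: "H \<in> \<G>" "\<forall>a\<in>?W. H a = a" "map H (concat (map su r)) = concat (map su x)"
      by (rule conjugate_G[OF _ su_M'[OF r] su_M'[OF x] W])
    have len: "length r = length x" using r x by (simp add: nlists_def)
    have conc: "concat (map (map H) (map su r)) = concat (map su x)" using H(3) by (simp only: map_concat)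
    have leni: "length (su (r ! i)) = length (su (x ! i))" if "i < length x" for i
    proof -
      have "map (length \<circ> su) r ! i = map (length \<circ> su) x ! i" using sig by simp
      then show ?thesis using that len by simp
    qed
    have "\<forall>(u, v)\<in>set (zip (map (map H) (map su r)) (map su x)). length u = length v"
      using leni len by (auto simp: set_zip)
    then have "map (map H) (map su r) = map su x"
      using concat_eq_concat_iff[of "map (map H) (map su r)" "map su x"] len conc by (metis length_map)
    then have su_i: "map H (su (r ! i)) = su (x ! i)" if "i < length x" for i
      using that len by (metis length_map nth_map)
    have "hat H (r ! i) = x ! i" if i: "i < length x" for i
    proof -
      have ri: "r ! i \<in> eq_points \<E>" "x ! i \<in> eq_points \<E>" using i r x by (auto simp: nlists_def)
      have "map sE r ! i = map sE x ! i" using sig by simp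
      then have "sE (r ! i) = sE (x ! i)" using i len by simp
      then show ?thesis
        using hat_name(1)[OF ri(1) H(1)] eq_point_name(3)[OF ri(2)] su_i[OF i] by simp
    qed
    then have "map (hat H) r = x" using len by (intro nth_equalityI) auto
    moreover have "hat H q = q" if "q \<in> C" for q
      using hat_fixes[of q H] that C(2) H(1,2) by auto
    ultimately show ?thesis using conjugate_hat[OF H(1), of C r] by simp
  qed
  have "?X // E \<subseteq> (\<lambda>r. E `` {r}) ` R"
  proof
    fix q assume "q \<in> ?X // E"
    then obtain x where x: "x \<in> ?X" "q = E `` {x}" by (rule quotientE)
    then obtain r where r: "r \<in> R" "?sig r = ?sig x" using R(3) by blast
    then have "(r, x) \<in> E" using conj[of r x] x(1) R(1) by (auto simp: E_def)
    then have "q = E `` {r}" using equiv_class_eq[OF equiv] x(2) by blast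
    then show "q \<in> (\<lambda>r. E `` {r}) ` R" using r(1) by blast
  qed
  then have "small (?X // E)" using small_mono small_image[OF R(2)] by blast
  then have "E \<in> inv_equivs Seq ?n C"
    using equiv inv unfolding inv_equivs_def small_def by simp
  then have "(d, e) \<in> E" using Lt C(1) unfolding Lt_eq_def by blast
  then show ?thesis by (simp add: E_def)
qed

end

section \<open>Independence over the canonical base\<close>

locale canonical_point = fur_imaginaries K \<delta> M M' \<E> + global_point K \<delta> M M' b A0
  for K :: "('u, 'f, 'r) aec" and \<delta> :: "'u rel" and M M' :: "('u, 'f, 'r) struct"
    and \<E> :: "'u list rel set" and b :: "'u list" and A0 :: "'u set"
begin

text \<open>Turns preservation of the family of types, which is tested on tuples of M, into the
  condition that \<open>F\<close> moves \<open>b\<close> to a realisation of t(b/M).\<close>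

lemma preserves_global_iff:
  assumes F: "F \<in> \<G>"
  shows "preserves_global (univ M) (hat F) (global_tp S' (univ M) b) \<longleftrightarrow> F \<in> St b"
proof -
  have gtp: "x \<in> gtp S' A b \<longleftrightarrow> conjugate S' A b x" for x A
    unfolding gtp_def conjugate_def by blast
  have inj: "inj emb" by (simp add: inj_def emb_inj)
  have "hat F ` emb ` B = emb ` F ` B" for B by (simp add: image_image hat_emb)
  then have image: "hat F ` emb ` B = emb ` A \<longleftrightarrow> F ` B = A" for A B
    by (simp only: inj_image_eq_iff[OF inj])
  have "map (hat F) (map emb x) = map emb (map F x)" for x by (simp add: hat_emb)
  then have maps: "map (hat F) (map emb x) = map emb y \<longleftrightarrow> map F x = y" for x y
    by (simp only: inj_map_eq_map[OF inj])
  show ?thesis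
  proof
    assume pres: "preserves_global (univ M) (hat F) (global_tp S' (univ M) b)"
    obtain G where G: "G \<in> \<G>" "undo G F" "undo F G" using G_inv[OF F] .
    have "conjugate S' (set c) (map F b) b" if c: "c \<in> lists (univ M)" for c
    proof -
      let ?B = "set (map G c)"
      have Gc: "map G c \<in> lists (univ M)" by (rule G_lists[OF G(1) c])
      then have B: "finite ?B" "?B \<subseteq> univ M" by auto
      have FB: "F ` ?B = set c" using map_inverse[OF G(3) M_lists[OF c]] by (metis set_map)
      have "set b \<subseteq> univ M'" using b by auto
      \<comment> \<open>Only realisations in M are tested, so \<open>b\<close> is replaced by one of
        its type over \<open>?B\<close>.\<close>
      then obtain J where J: "J \<in> fixing S' ?B" "J ` set b \<subseteq> univ M"
        using move_into_M[OF _ small_finite B(2) small_finite[OF B(1)]] by blast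
      let ?b1 = "map J b"
      have b1: "?b1 \<in> lists (univ M)" using J(2) by auto
      have bb1: "conjugate S' ?B b ?b1" using J(1) unfolding conjugate_def by blast
      have p1: "finite (set c) \<and> set c \<subseteq> univ M \<and> finite ?B \<and> ?B \<subseteq> univ M \<and>
          hat F ` emb ` ?B = emb ` set c \<and>
          global_tp S' (univ M) b (set c) = Some (gtp S' (set c) b) \<and>
          global_tp S' (univ M) b ?B = Some (gtp S' ?B b)"
      proof (intro conjI)
        show cM: "set c \<subseteq> univ M" using c by auto
        show "hat F ` emb ` ?B = emb ` set c" by (rule iffD2[OF image FB])
        show "global_tp S' (univ M) b (set c) = Some (gtp S' (set c) b)"
          using cM by (simp add: global_tp_def)
        show "global_tp S' (univ M) b ?B = Some (gtp S' ?B b)"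
          using B by (simp only: global_tp_def simp_thms if_True)
      qed (use B in simp_all)
      have p2: "?b1 \<in> gtp S' ?B b \<and> map (hat F) (map emb ?b1) = map emb (map F ?b1)"
        using bb1 gtp maps by blast
      have "map F ?b1 \<in> gtp S' (set c) b"
        using pres[unfolded preserves_global_def, rule_format, OF p1 b1 G_lists[OF F b1] p2] .
      then have "conjugate S' (set c) b (map F ?b1)" by (simp add: gtp)
      moreover have "conjugate S' (F ` ?B) (map F b) (map F ?b1)"
        using S'.conjugate_transport[OF bb1, of F] G_autos[OF F] b M_set[OF Gc] by simp
      ultimately show ?thesis
        using S'.conjugate_trans S'.conjugate_sym[of "set c" b] b M_set[OF c] unfolding FB by fastforce
    qed
    then show "F \<in> St b" using F by (simp add: St_def geq_def)
  next
    assume St: "F \<in> St b"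
    show "preserves_global (univ M) (hat F) (global_tp S' (univ M) b)"
      unfolding preserves_global_def
    proof (intro allI impI ballI)
      fix A B q r x y
      assume *: "finite A \<and> A \<subseteq> univ M \<and> finite B \<and> B \<subseteq> univ M \<and> hat F ` emb ` B = emb ` A \<and>
        global_tp S' (univ M) b A = Some q \<and> global_tp S' (univ M) b B = Some r"
        and x: "x \<in> lists (univ M)" and y: "y \<in> lists (univ M)"
        and xy: "x \<in> r \<and> map (hat F) (map emb x) = map emb y"
      have q: "q = gtp S' A b" and r: "r = gtp S' B b" using * by (auto simp: global_tp_def)
      have "hat F ` emb ` B = emb ` A" using * by blast
      then have FB: "F ` B = A" by (rule iffD1[OF image])
      have AB: "finite A" "A \<subseteq> univ M" "B \<subseteq> univ M'" "A \<subseteq> univ M'" using * M_sub by auto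
      have "conjugate S' B b x" using xy gtp unfolding r by blast
      then have "conjugate S' (F ` B) (map F b) (map F x)"
        by (rule S'.conjugate_transport) (use G_autos[OF F] b AB(3) in simp_all)
      then have t: "conjugate S' A (map F b) (map F x)" by (simp only: FB)
      obtain c where c: "set c = A" using AB(1) finite_list by blast
      then have "c \<in> lists (univ M)" using AB(2) by auto
      then have "conjugate S' (set c) (map F b) b" using St unfolding St_def geq_def by blast
      then have "conjugate S' A b (map F b)"
        unfolding c by (rule S'.conjugate_sym) (use G_lists'[OF F b] AB(4) in simp_all)
      then have "conjugate S' A b (map F x)" by (rule S'.conjugate_trans[OF _ t])
      moreover have "map F x = y" using iffD1[OF maps] xy by blast
      ultimately show "y \<in> q" unfolding q gtp by simp
    qed
  qed
qed

lemma indep_over_base: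
  assumes a: "a \<in> lists (univ M)" and A: "A \<subseteq> univ M" "small A" "A0 \<subseteq> A" and Lt: "Lt_eq S' A b a"
    and \<alpha>: "\<alpha> \<in> lists (eq_points \<E>)" and base: "\<And>F. F \<in> \<G> \<Longrightarrow> F \<in> St b \<longleftrightarrow> map (hat F) \<alpha> = \<alpha>"
  shows "indep Seq (map emb a) (set \<alpha>) (emb ` A)"
  unfolding indep_def
proof (intro exI[of _ "set \<alpha>"] conjI allI impI)
  fix D assume D: "bounded_set Seq D \<and> set \<alpha> \<union> emb ` A \<subseteq> D"
  then have D_points: "D \<subseteq> eq_points \<E>" and D_small: "small D"
    by (auto simp: bounded_set_def small_def)
  have \<alpha>_points: "set \<alpha> \<subseteq> eq_points \<E>" using \<alpha> by auto
  let ?sup = "\<lambda>X. \<Union>q\<in>X. set (su q)"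
  \<comment> \<open>Supports of all imaginaries in \<open>D\<close>, together with \<open>A\<close>
    and \<open>a\<close>: the automorphism moving \<open>b\<close> into M then fixes
    \<open>a\<close> as well.\<close>
  let ?D = "?sup D \<union> A \<union> set a"
  have D': "?D \<subseteq> univ M" using support[OF D_points] A(1) a by auto
  have "small (?sup D)" by (rule small_UN[OF D_small small_finite]) simp
  then have D'_small: "small ?D" by (rule small_Un[OF small_Un[OF _ A(2)] small_finite[OF finite_set]])
  have "set b \<subseteq> univ M'" using b by auto
  then obtain F where F: "F \<in> fixing S' ?D" "F ` set b \<subseteq> univ M"
    using move_into_M[OF _ small_finite D' D'_small] by blast
  let ?a' = "map F b"
  have a': "?a' \<in> lists (univ M)" using F(2) by auto
  have emb_a': "map emb ?a' \<in> lists (pts Seq)" using a' emb_points by auto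
  have fixed: "hat H q = q" if "H \<in> St b" "q \<in> set \<alpha>" for H q
  proof -
    have "H \<in> \<G>" using that(1) by (simp add: St_def)
    then have "map (hat H) \<alpha> = \<alpha>" using base that(1) by blast
    then show ?thesis using that(2) by (metis map_eq_conv map_ident)
  qed
  have "wtp_eq Seq (set \<alpha> \<union> emb ` A) (map emb ?a') (map emb a)"
  proof -
    have "conjugate Seq C (map emb ?a') (map emb a)" if C: "C \<subseteq> set \<alpha> \<union> emb ` A" "finite C" for C
    proof -
      \<comment> \<open>The home-sort part of \<open>C\<close> that lies in \<open>A\<close>,
        enlarged by \<open>A0\<close> so that the conjugates over it can be counted.\<close>
      let ?B = "A0 \<union> (A \<inter> emb -` C)"
      have "inj_on emb (emb -` C)" by (simp add: inj_on_def emb_inj)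
      then have B: "A0 \<subseteq> ?B" "finite ?B" "?B \<subseteq> univ M"
        using A0 A(1) finite_vimage_IntI[OF C(2), of emb A]
        by (auto simp: inj_on_def emb_inj Int_commute)
      have P: "F \<in> St b" if "F \<in> \<G>" "\<And>x. x \<in> ?sup (set \<alpha>) \<Longrightarrow> F x = x" for F
      proof -
        have "hat F q = q" if "q \<in> set \<alpha>" for q
          using \<open>F \<in> \<G>\<close> \<open>\<And>x. x \<in> ?sup (set \<alpha>) \<Longrightarrow> F x = x\<close> that \<alpha>_points
          by (intro hat_fixes) auto
        then have "map (hat F) \<alpha> = \<alpha>" by (simp add: map_idI)
        then show ?thesis using base that(1) by simp
      qed
      have "\<exists>E\<in>inv_equivs S' (length b) ?B. \<forall>x\<in>lists (univ M). \<forall>y\<in>lists (univ M).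
          (x, y) \<in> E \<longrightarrow> (\<exists>H\<in>\<G>B ?B \<inter> St b. map H x = y)"
        by (rule stabiliser_equivalence[OF B _ support[OF \<alpha>_points] P]) simp_all
      then obtain E where E: "E \<in> inv_equivs S' (length b) ?B"
        "\<forall>x\<in>lists (univ M). \<forall>y\<in>lists (univ M).
          (x, y) \<in> E \<longrightarrow> (\<exists>H\<in>\<G>B ?B \<inter> St b. map H x = y)" by (elim bexE)
      have BA: "?B \<subseteq> A" using A(3) by auto
      \<comment> \<open>Equality of Lascar types applies because \<open>?B\<close> is a finite
        subset of \<open>A\<close>; \<open>F\<close>, which fixes \<open>?B\<close> and
        \<open>a\<close>, then replaces \<open>b\<close> by \<open>?a'\<close>.\<close>
      then have "(b, a) \<in> E" using Lt E(1) B(2) unfolding Lt_eq_def by blast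
      moreover have "F \<in> fixing S' ?B" using F(1) BA unfolding fixing_def by auto
      ultimately have "(?a', map F a) \<in> E" using E(1) unfolding inv_equivs_def by blast
      moreover have "map F a = a" using F(1) unfolding fixing_def by (intro map_idI) auto
      ultimately have "\<exists>H\<in>\<G>B ?B \<inter> St b. map H ?a' = a"
        using bspec[OF bspec[OF E(2) a'] a] by simp
      then obtain H where H: "H \<in> \<G>B ?B" "H \<in> St b" "map H ?a' = a" by blast
      have "hat H q = q" if q: "q \<in> C" for q
      proof (cases "q \<in> set \<alpha>")
        case False
        then obtain x where "q = emb x" "x \<in> A" using q C(1) by blast
        then show ?thesis using q H(1) by (simp add: hat_emb \<G>B_def)
      qed (use fixed[OF H(2)] in blast)
      then have "conjugate Seq C (map emb ?a') (map (hat H) (map emb ?a'))"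
        by (rule conjugate_hat[OF GB_G[OF H(1)]])
      moreover have "map (hat H) (map emb ?a') = map emb a"
        unfolding H(3)[symmetric] by (simp add: hat_emb)
      ultimately show ?thesis by simp
    qed
    moreover have "set \<alpha> \<union> emb ` A \<subseteq> pts Seq" using D D_points by auto
    ultimately show ?thesis using Seq.wtp_eq_iff[OF emb_a'] by blast
  qed
  moreover have "\<not> Lsplits Seq (map emb ?a') D (set \<alpha>)"
  proof
    assume "Lsplits Seq (map emb ?a') D (set \<alpha>)"
    then obtain d e where de: "d \<in> lists D" "e \<in> lists D" "Lt_eq Seq (set \<alpha>) d e"
      and split: "\<not> wtp_eq Seq (set \<alpha>) (map emb ?a' @ d) (map emb ?a' @ e)"
      unfolding Lsplits_def by blast
    have de_points: "d \<in> lists (eq_points \<E>)" "e \<in> lists (eq_points \<E>)" using de D_points by auto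
    have "conjugate Seq (set \<alpha>) d e"
      by (rule Lt_eq_conjugate[OF _ \<alpha>_points de_points de(3)]) simp
    then obtain g where g: "g \<in> eq_autos K M \<E>" "\<And>q. q \<in> set \<alpha> \<Longrightarrow> g q = q" "map g d = e"
      unfolding conjugate_def fixing_def by auto
    obtain F0 where F0: "F0 \<in> \<G>" "\<forall>q\<in>eq_points \<E>. g q = hat F0 q" using aut_hat[OF g(1)] .
    have F0_\<alpha>: "hat F0 q = q" if "q \<in> set \<alpha>" for q using F0(2) g(2) that \<alpha>_points by fastforce
    then have F0_St: "F0 \<in> St b" using base[OF F0(1)] by (simp add: map_idI)
    have F0_d: "map (hat F0) d = e"
      unfolding g(3)[symmetric] using F0(2) de_points(1) by auto
    define W1 where "W1 = ?sup (set \<alpha> \<union> set d \<union> set e)"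
    have W1_points: "set \<alpha> \<union> set d \<union> set e \<subseteq> eq_points \<E>" using \<alpha>_points de_points by auto
    have W1: "finite W1" "W1 \<subseteq> univ M" unfolding W1_def using support[OF W1_points] by auto
    have W1_D: "W1 \<subseteq> ?D" unfolding W1_def using D de(1,2) by auto
    \<comment> \<open>\<open>F0\<close> may carry \<open>W1\<close> out of the set over which
      \<open>?a'\<close> realises t(b/M). A second realisation, over \<open>W1\<close> and its
      image, is therefore treated first.\<close>
    let ?W = "W1 \<union> F0 ` W1"
    have W: "finite ?W" "?W \<subseteq> univ M" using W1 G_univ[OF F0(1)] by auto
    obtain G where G: "G \<in> fixing S' ?W" "G ` set b \<subseteq> univ M"
      using move_into_M[OF \<open>set b \<subseteq> univ M'\<close> small_finite W(2) small_finite[OF W(1)]] by auto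
    let ?a'' = "map G b"
    have a'': "?a'' \<in> lists (univ M)" using G(2) by auto
    obtain w where w: "set w = W1" using finite_list[OF W1(1)] by blast
    have w_lists: "w \<in> lists (univ M)" using w W1(2) by (simp only: lists_eq_set mem_Collect_eq)
    note w_lists = this G_lists[OF F0(1) this]
    \<comment> \<open>Both ends are compared with \<open>b\<close>; the decisive link
      \<open>t3\<close> is invariance of t(b/M) under \<open>F0\<close>.\<close>
    have conj: "conjugate S' {} (?a'' @ w) (?a'' @ map F0 w)"
    proof -
      have Gw: "map G w = w" "map G (map F0 w) = map F0 w"
        using G(1) w unfolding fixing_def by (auto intro!: map_idI)
      have G_conj: "conjugate S' {} (b @ z) (?a'' @ map G z)" for z
        using conjugate_map[of G S' "{}" "b @ z"] G(1) by (simp add: fixing_def)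
      have t1: "conjugate S' {} (?a'' @ w) (b @ w)"
        using S'.conjugate_sym[OF G_conj[of w]] b M_lists[OF w_lists(1)] by (simp add: Gw(1))
      have t2: "conjugate S' {} (b @ w) (map F0 b @ map F0 w)"
        using conjugate_map[of F0 S' "{}" "b @ w"] G_autos[OF F0(1)] by simp
      have t3: "conjugate S' {} (map F0 b @ map F0 w) (b @ map F0 w)"
      proof -
        have "conjugate S' (set (map F0 w)) (map F0 b) b"
          using F0_St w_lists(2) unfolding St_def geq_def by blast
        then show ?thesis by (subst conjugate_append) simp_all
      qed
      have t4: "conjugate S' {} (b @ map F0 w) (?a'' @ map F0 w)"
        using G_conj[of "map F0 w"] by (simp only: Gw(2))
      show ?thesis
        by (rule S'.conjugate_trans[OF t1 S'.conjugate_trans[OF t2 S'.conjugate_trans[OF t3 t4]]])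
    qed
    have "?a'' @ w \<in> lists (univ M)" "?a'' @ map F0 w \<in> lists (univ M)"
      using a'' w_lists by simp_all
    then obtain H where H: "H \<in> \<G>" "\<forall>x\<in>{}. H x = x" "map H (?a'' @ w) = ?a'' @ map F0 w"
      by (rule conjugate_G[OF conj _ _ finite.emptyI empty_subsetI])
    have HH: "map H ?a'' = ?a'' \<and> map H w = map F0 w"
      using H(3)[unfolded map_append] by (subst (asm) append_eq_append_conv) simp_all
    note Ha = conjunct1[OF HH]
    have Hw: "\<forall>x\<in>W1. H x = F0 x"
      using conjunct2[OF HH] unfolding map_eq_conv w .
    have cF: "conjugate S' ?D b ?a'" unfolding conjugate_def by (rule bexI[OF _ F(1)]) (rule refl)
    have cG: "conjugate S' ?W b ?a''" unfolding conjugate_def by (rule bexI[OF _ G(1)]) (rule refl)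
    note c1 = conjugate_mono[OF cF W1_D] conjugate_mono[OF cG Un_upper1]
    have W1': "W1 \<subseteq> univ M'" using W1(2) M_sub by simp
    have "conjugate S' W1 ?a' ?a''"
      using S'.conjugate_trans[OF S'.conjugate_sym[OF c1(1)] c1(2)] b W1' by simp
    then obtain J where J: "J \<in> \<G>" "\<forall>x\<in>W1. J x = x" "map J ?a' = ?a''"
      by (rule conjugate_G[OF _ a' a'' W1])
    obtain J' where J': "J' \<in> \<G>" "undo J' J" "undo J J'" using G_inv[OF J(1)] .
    have J'_W1: "J' x = x" if "x \<in> W1" for x
      using undoD[OF J'(2), of x] J(2) that W1' by auto
    \<comment> \<open>\<open>H\<close> fixes \<open>?a''\<close> and agrees with \<open>F0\<close>
      on \<open>W1\<close>; conjugation by \<open>J\<close> makes it fix \<open>?a'\<close> and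
      still send \<open>d\<close> to \<open>e\<close>. \<open>W1\<close> includes supports of
      \<open>e\<close> because \<open>F0\<close> need not carry the chosen support of an entry of
      \<open>d\<close> to that of its image.\<close>
    let ?T = "J' \<circ> H \<circ> J"
    have T: "?T \<in> \<G>" using G_comp J J' H by blast
    have "map ?T ?a' = map J' (map H (map J ?a'))" by simp
    also have "\<dots> = map J' (map J ?a')" by (simp only: J(3) Ha)
    also have "\<dots> = ?a'" by (rule map_inverse[OF J'(2) M_lists[OF a']])
    finally have T_a': "map ?T ?a' = ?a'" .
    have T_hat: "hat ?T q = hat F0 q" if q: "q \<in> set \<alpha> \<union> set d" for q
    proof -
      have qp: "q \<in> eq_points \<E>" using q W1_points by blast
      have qW: "set (su q) \<subseteq> W1" using q unfolding W1_def by blast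
      have "hat F0 q \<in> set \<alpha> \<union> set e" using q F0_\<alpha> F0_d by auto
      then have fp: "hat F0 q \<in> eq_points \<E>" and fW: "set (su (hat F0 q)) \<subseteq> W1"
        using W1_points unfolding W1_def by blast+
      have "hat J q = q" by (rule hat_fixes[OF qp J(1)]) (use J(2) qW in blast)
      moreover have "hat H q = hat F0 q"
        by (rule hat_cong[OF qp H(1) F0(1)]) (use Hw qW in auto)
      moreover have "hat J' (hat F0 q) = hat F0 q"
        by (rule hat_fixes[OF fp J'(1)]) (use J'_W1 fW in blast)
      ultimately show ?thesis by (simp only: hat_comp)
    qed
    have "map (hat ?T) (map emb ?a') = map emb (map ?T ?a')" by (simp add: hat_emb)
    then have T1: "map (hat ?T) (map emb ?a') = map emb ?a'" by (simp only: T_a')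
    have "map (hat ?T) d = map (hat F0) d" by (intro map_cong refl T_hat) simp
    then have "map (hat ?T) (map emb ?a' @ d) = map emb ?a' @ e" by (simp only: map_append T1 F0_d)
    moreover have "conjugate Seq (set \<alpha>) (map emb ?a' @ d) (map (hat ?T) (map emb ?a' @ d))"
      by (rule conjugate_hat[OF T]) (use T_hat F0_\<alpha> in simp)
    ultimately have conj_de: "conjugate Seq (set \<alpha>) (map emb ?a' @ d) (map emb ?a' @ e)" by (simp only:)
    have "map emb ?a' @ d \<in> lists (pts Seq)" using emb_a' de_points(1) by auto
    then have "wtp_eq Seq (set \<alpha>) (map emb ?a' @ d) (map emb ?a' @ e)"
      using Seq.wtp_eq_iff[of "map emb ?a' @ d" "set \<alpha>"] \<alpha>_points conjugate_mono[OF conj_de]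
      unfolding pts_Seq by blast
    then show False using split by blast
  qed
  ultimately show "\<exists>c\<in>lists (pts Seq). wtp_eq Seq (set \<alpha> \<union> emb ` A) c (map emb a) \<and> \<not> Lsplits Seq c D (set \<alpha>)"
    using emb_a' by blast
qed auto

end

theorem lemma2p81:
  fixes K :: "('u, 'f, 'r) aec"
    and \<delta> :: "'u rel"
    and M M' :: "('u, 'f, 'r) struct"
    and \<E> :: "'u list rel set"
    and a :: "'u list"
    and A :: "'u set"
    and \<alpha> :: "'u list set list"
  assumes "monster_model K \<delta> M"
    and "FUR_class K \<delta> M"
    and "supermonster K M M'"
    and "imaginary_sorts K \<delta> M \<E>"
    and "contains_cb_sorts K M M' \<E>"
    and "a \<in> lists (univ M)"
    and "bounded_set (monster_ambient K \<delta> M) A"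
    and "is_Cb K M M' \<E> a A \<alpha>"
  shows "indep (eq_ambient K \<delta> M \<E>) (map emb a) (set \<alpha>) (emb ` A)"
proof -
  let ?S' = "monster_ambient K |univ M'| M'"
  have mon: "strongly_inaccessible \<delta>" "M \<in> mods K" "model_homogeneous K \<delta> M" "universal K \<delta> M"
    using assms(1) by (simp_all add: monster_model_def)
  have fur: "AEC_LS_omega K" "AP K" "arbitrarily_large K" "\<forall>A\<in>mods K. infinite (univ A)" "axiom_AI K \<delta> M"
    using assms(2) by (simp_all add: FUR_class_def)
  have sup: "M' \<in> mods K" "le K M M'" "|univ M| <o |univ M'|" "model_homogeneous K |univ M'| M'"
    "universal K |univ M'| M'"
    using assms(3) by (simp_all add: supermonster_def)
  interpret fur_imaginaries K \<delta> M M' \<E>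
    by unfold_locales (use mon fur sup assms(4) in simp_all)
  obtain b where bb: "b \<in> lists (univ M')" "Lt_eq ?S' A b a" "indep ?S' b A (univ M)"
    "canonical_base K M M' \<E> (global_tp ?S' (univ M) b) \<alpha>"
    using assms(8) unfolding is_Cb_def Let_def by blast
  have A: "A \<subseteq> univ M" "small A" using assms(7) by (auto simp: bounded_set_def small_def)
  obtain A0 where A0f: "A0 \<subseteq> A" "finite A0"
    and ext: "\<And>D. bounded_set ?S' D \<and> A \<union> univ M \<subseteq> D \<Longrightarrow>
      \<exists>b'\<in>lists (pts ?S'). wtp_eq ?S' (A \<union> univ M) b' b \<and> \<not> Lsplits ?S' b' D A0"
    using bb(3) unfolding indep_def by blast
  \<comment> \<open>In M' the whole of M is bounded, so nonsplitting over all of M is obtained at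
    once.\<close>
  have "bounded_set ?S' (univ M) \<and> A \<union> univ M \<subseteq> univ M"
    using M_sub M_less A(1) by (simp add: bounded_set_def)
  from ext[OF this] obtain b' where b': "b' \<in> lists (univ M')" "wtp_eq ?S' (univ M) b' b"
    "\<not> Lsplits ?S' b' (univ M) A0"
    using A(1) by (auto simp: Un_absorb1)
  have A0M: "A0 \<subseteq> univ M" using A0f(1) A(1) by simp
  \<comment> \<open>\<open>b'\<close> and \<open>b\<close> have the same type over M, and splitting
    over \<open>A0\<close> by tuples of M depends on that type alone.\<close>
  have "\<not> Lsplits ?S' b (univ M) A0"
  proof
    assume "Lsplits ?S' b (univ M) A0"
    then obtain c d where cd: "c \<in> lists (univ M)" "d \<in> lists (univ M)" "Lt_eq ?S' A0 c d"
      and split: "\<not> wtp_eq ?S' A0 (b @ c) (b @ d)" unfolding Lsplits_def by blast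
    have same: "conjugate ?S' A0 (b' @ z) (b @ z)" if z: "z \<in> lists (univ M)" for z
    proof -
      have "A0 \<union> set z \<subseteq> univ M" "finite (A0 \<union> set z)" using A0M A0f(2) z by auto
      then have "conjugate ?S' (A0 \<union> set z) b' b"
        using b'(2) S'.wtp_eq_iff[of b' "univ M" b] b'(1) M_sub by simp
      then show ?thesis using conjugate_append conjugate_length by metis
    qed
    have lists: "b' @ c \<in> lists (univ M')" "b' @ d \<in> lists (univ M')" "b @ c \<in> lists (univ M')"
      using bb(1) b'(1) M_lists cd by auto
    have A0': "A0 \<subseteq> univ M'" using A0M M_sub by simp
    have "wtp_eq ?S' A0 (b' @ c) (b' @ d)" using b'(3) cd unfolding Lsplits_def by blast
    then have "conjugate ?S' A0 (b' @ c) (b' @ d)"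
      using S'.wtp_eq_iff[of "b' @ c" A0] lists(1) A0' A0f(2) by simp
    then have "conjugate ?S' A0 (b @ c) (b @ d)"
      using S'.conjugate_trans S'.conjugate_sym[OF same[OF cd(1)]] same[OF cd(2)] lists(1) A0'
      by (metis pts_monster)
    then show False
      using split S'.wtp_eq_iff[of "b @ c" A0] lists(3) A0' conjugate_mono by (metis pts_monster)
  qed
  then interpret canonical_point K \<delta> M M' \<E> b A0
    using bb(1) A0f(2) A0M by unfold_locales
  have "\<alpha> \<in> lists (eq_points \<E>)" using bb(4) unfolding canonical_base_def by blast
  moreover have "F \<in> St b \<longleftrightarrow> map (hat F) \<alpha> = \<alpha>" if "F \<in> \<G>" for F
    using bb(4) preserves_global_iff[OF that] hat_aut[OF that] unfolding canonical_base_def by blast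
  ultimately show ?thesis
    using indep_over_base[OF assms(6) A A0f(1) bb(2)] by blast
qed

end
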